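(* For every planar pairing $\pi$ of $\mathbf N$, $$\sum_{\tau\ \text{planar pairing}}2^{c(\pi\cup\tau)}\,\frac{Z^{DD}_\tau(G,\mathbf N)}{(Z^D(G))^2}=\sum_{\rho\ \text{black-white pairing}}\mathrm{sign}(\pi,\rho)\,2^{c(\pi\cup\rho)}\,Y'_\rho,$$ with $\mathrm{sign}(\pi,\rho)=(-1)^n(-1)^{c(\pi\cup\rho)}\mathrm{sign}_{OE}(\pi)\mathrm{sign}_{BW}(\rho)$ and $Y'_\rho=(-1)^{\#\text{crossings of }\rho}\prod_{\{b,w\}\in\rho}Y_{b,w}$.
   Context: $G=(V_1,V_2,E)$ is a finite edge-weighted planar bipartite graph in the plane, $V_1$ black, $V_2$ white; nodes $\mathbf N$: $2n$ outer-face vertices labeled $1,\dots,2n$ counterclockwise, $n$ black and $n$ white, colors otherwise arbitrary. $Z^D$ = weighted sum of perfect matchings; $Z^D(G)\ne0$; $Y_{i,j}=Z^D(G\setminus\{i,j\})/Z^D(G)$. A double-dimer configuration on $(G,\mathbf N)$ is a multiset of edges with each node of degree 1 and every other vertex of degree 2; weight = product of edge weights times $2^{\#\text{loops}}$ (loops = cycles of length $>2$); $Z^{DD}_\tau(G,\mathbf N)$ = total weight of configurations whose paths pair the nodes according to $\tau$. Pairings, crossings ($a<b<c<d$), planar, odd-even, black-white pairings as usual; $\mathrm{sign}_{OE}(\pi)$ = sign of $(\pi(1)/2,\dots,\pi(2n-1)/2)$; $\mathrm{sign}_{BW}(\rho)$ = sign of the permutation $\theta$ with $\rho(b_i)=w_{\theta(i)}$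 ($b_1<\dots<b_n$ black, $w_1<\dots<w_n$ white nodes). $c(\pi\cup\tau)$ = number of components of the multigraph on $\mathbf N$ whose edges are the pairs of $\pi$ and $\tau$. *)

theory Defs
  imports "HOL-Analysis.Analysis" "HOL-Combinatorics.Permutations"
begin

section \<open>Pairings of the node labels {1..2n}\<close>

text \<open>A pairing of {1..2n} is a fixed-point-free involution of {1..2n},
  extended by the identity outside {1..2n} (so that the set of pairings is finite).\<close>

definition pairings :: "nat \<Rightarrow> (nat \<Rightarrow> nat) set" where
  "pairings n = {p. (\<forall>i\<in>{1..2*n}. p i \<in> {1..2*n} \<and> p i \<noteq> i \<and> p (p i) = i)
                    \<and> (\<forall>i. i \<notin> {1..2*n} \<longrightarrow> p i = i)}"

text \<open>Two pairs {a,c},{b,d} cross iff a<b<c<d.\<close>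
definition crossings :: "nat \<Rightarrow> (nat \<Rightarrow> nat) \<Rightarrow> nat" where
  "crossings n p = card {(a,b). a \<in> {1..2*n} \<and> b \<in> {1..2*n} \<and> a < b \<and> b < p a \<and> p a < p b}"

definition planar_pairing :: "nat \<Rightarrow> (nat \<Rightarrow> nat) \<Rightarrow> bool" where
  "planar_pairing n p \<longleftrightarrow> p \<in> pairings n \<and>
     \<not> (\<exists>a b. a \<in> {1..2*n} \<and> b \<in> {1..2*n} \<and> a < b \<and> b < p a \<and> p a < p b)"

text \<open>sign_OE: sign of the permutation i \<mapsto> p(2i-1)/2 of {1..n}.\<close>
definition sign_OE :: "nat \<Rightarrow> (nat \<Rightarrow> nat) \<Rightarrow> int" where
  "sign_OE n p = sign (\<lambda>i. if i \<in> {1..n} then p (2*i - 1) div 2 else i)"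

text \<open>Black node labels (labels i with node i black) and white node labels.\<close>
definition black_labels :: "nat \<Rightarrow> (nat \<Rightarrow> 'v) \<Rightarrow> 'v set \<Rightarrow> nat set" where
  "black_labels n node B = {i\<in>{1..2*n}. node i \<in> B}"

definition white_labels :: "nat \<Rightarrow> (nat \<Rightarrow> 'v) \<Rightarrow> 'v set \<Rightarrow> nat set" where
  "white_labels n node B = {i\<in>{1..2*n}. node i \<notin> B}"

definition bw_pairing :: "nat \<Rightarrow> (nat \<Rightarrow> 'v) \<Rightarrow> 'v set \<Rightarrow> (nat \<Rightarrow> nat) \<Rightarrow> bool" where
  "bw_pairing n node B p \<longleftrightarrow> p \<in> pairings n \<and>
     (\<forall>i\<in>{1..2*n}. (node i \<in> B) \<noteq> (node (p i) \<in> B))"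

text \<open>sign_BW: with b_1<...<b_n the black and w_1<...<w_n the white labels,
  the sign of theta where rho(b_k) = w_theta(k). Here indices run over {0..<n}:
  b_k is the k-th element of the sorted list of black labels, and theta(k) is
  the rank of rho(b_k) among the white labels.\<close>
definition sign_BW :: "nat \<Rightarrow> (nat \<Rightarrow> 'v) \<Rightarrow> 'v set \<Rightarrow> (nat \<Rightarrow> nat) \<Rightarrow> int" where
  "sign_BW n node B p =
     sign (\<lambda>k. if k < n then
                 card {w \<in> white_labels n node B.
                         w < p (sorted_list_of_set (black_labels n node B) ! k)}
               else k)"

text \<open>c(p \<union> q): number of connected components of the multigraph on {1..2n}
  whose edges are the pairs of p and of q.\<close>
definition ncomp :: "nat \<Rightarrow> (nat \<Rightarrow> nat) \<Rightarrow> (nat \<Rightarrow> nat) \<Rightarrow> nat" where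
  "ncomp n p q = card ({1..2*n} //
      ({(i, p i) | i. i \<in> {1..2*n}} \<union> {(i, q i) | i. i \<in> {1..2*n}})\<^sup>*)"

section \<open>Bipartite graphs, dimers and double dimers\<close>

text \<open>A bipartite graph is given by a vertex set V, a set B of black vertices
  (the others are white), and an edge set E of pairs (black, white).\<close>

definition edges_in :: "'v set \<Rightarrow> ('v \<times> 'v) set \<Rightarrow> ('v \<times> 'v) set" where
  "edges_in V E = {e\<in>E. fst e \<in> V \<and> snd e \<in> V}"

definition perfect_matchings :: "'v set \<Rightarrow> ('v \<times> 'v) set \<Rightarrow> ('v \<times> 'v) set set" where
  "perfect_matchings V E = {M. M \<subseteq> edges_in V E \<and>
      (\<forall>v\<in>V. card {e\<in>M. fst e = v \<or> snd e = v} = 1)}"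

text \<open>Z^D of the subgraph of (V,E) induced on V.\<close>
definition ZD :: "'v set \<Rightarrow> ('v \<times> 'v) set \<Rightarrow> ('v \<times> 'v \<Rightarrow> real) \<Rightarrow> real" where
  "ZD V E wt = (\<Sum>M\<in>perfect_matchings V E. \<Prod>e\<in>M. wt e)"

text \<open>Y_{i,j} = Z^D(G \ {node i, node j}) / Z^D(G).\<close>
definition Yij :: "'v set \<Rightarrow> ('v \<times> 'v) set \<Rightarrow> ('v \<times> 'v \<Rightarrow> real) \<Rightarrow> (nat \<Rightarrow> 'v) \<Rightarrow> nat \<Rightarrow> nat \<Rightarrow> real" where
  "Yij V E wt node i j = ZD (V - {node i, node j}) E wt / ZD V E wt"

text \<open>Y'_rho = (-1)^{#crossings} * prod over pairs {b,w} of Y_{b,w}.\<close>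
definition Yprime :: "'v set \<Rightarrow> ('v \<times> 'v) set \<Rightarrow> ('v \<times> 'v \<Rightarrow> real) \<Rightarrow> nat \<Rightarrow> (nat \<Rightarrow> 'v) \<Rightarrow> 'v set
                      \<Rightarrow> (nat \<Rightarrow> nat) \<Rightarrow> real" where
  "Yprime V E wt n node B p = (-1) ^ crossings n p *
      (\<Prod>b\<in>black_labels n node B. Yij V E wt node b (p b))"

text \<open>A double-dimer configuration is a multiset of edges, represented by its
  multiplicity function m (zero off E).\<close>
definition mdeg :: "('v \<times> 'v) set \<Rightarrow> ('v \<times> 'v \<Rightarrow> nat) \<Rightarrow> 'v \<Rightarrow> nat" where
  "mdeg E m v = (\<Sum>e\<in>E. if fst e = v \<or> snd e = v then m e else 0)"

definition dd_configs :: "'v set \<Rightarrow> ('v \<times> 'v) set \<Rightarrow> 'v set \<Rightarrow> ('v \<times> 'v \<Rightarrow> nat) set" where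
  "dd_configs V E Nd = {m. (\<forall>e. e \<notin> E \<longrightarrow> m e = 0) \<and>
      (\<forall>v\<in>V. mdeg E m v = (if v \<in> Nd then 1 else 2))}"

text \<open>Connectivity relation of the support of m (symmetric).\<close>
definition supp_rel :: "('v \<times> 'v) set \<Rightarrow> ('v \<times> 'v \<Rightarrow> nat) \<Rightarrow> ('v \<times> 'v) set" where
  "supp_rel E m = {(a,b). ((a,b) \<in> E \<and> m (a,b) > 0) \<or> ((b,a) \<in> E \<and> m (b,a) > 0)}"

text \<open>Loops: components containing no node and more than 2 vertices
  (i.e. cycles of length > 2; doubled edges are excluded).\<close>
definition nloops :: "'v set \<Rightarrow> ('v \<times> 'v) set \<Rightarrow> 'v set \<Rightarrow> ('v \<times> 'v \<Rightarrow> nat) \<Rightarrow> nat" where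
  "nloops V E Nd m = card {C \<in> V // (supp_rel E m)\<^sup>*. C \<inter> Nd = {} \<and> card C > 2}"

definition dd_weight :: "'v set \<Rightarrow> ('v \<times> 'v) set \<Rightarrow> ('v \<times> 'v \<Rightarrow> real) \<Rightarrow> 'v set
                         \<Rightarrow> ('v \<times> 'v \<Rightarrow> nat) \<Rightarrow> real" where
  "dd_weight V E wt Nd m = (\<Prod>e\<in>E. wt e ^ m e) * 2 ^ nloops V E Nd m"

text \<open>Z^DD_tau: the paths of m connect node i with node (tau i).\<close>
definition ZDD :: "'v set \<Rightarrow> ('v \<times> 'v) set \<Rightarrow> ('v \<times> 'v \<Rightarrow> real) \<Rightarrow> nat \<Rightarrow> (nat \<Rightarrow> 'v)
                   \<Rightarrow> (nat \<Rightarrow> nat) \<Rightarrow> real" where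
  "ZDD V E wt n node tau =
     (\<Sum>m\<in>{m \<in> dd_configs V E (node ` {1..2*n}).
             \<forall>i\<in>{1..2*n}. (node i, node (tau i)) \<in> (supp_rel E m)\<^sup>*}.
        dd_weight V E wt (node ` {1..2*n}) m)"

section \<open>Planar embedding with nodes on the outer face\<close>

text \<open>Circular planar embedding: the graph is drawn in the closed unit disk,
  edges are arcs meeting only at common endpoints, the nodes lie on the unit
  circle in counterclockwise order 1..2n, everything else lies in the open disk.\<close>
definition circular_planar ::
  "'v set \<Rightarrow> ('v \<times> 'v) set \<Rightarrow> nat \<Rightarrow> (nat \<Rightarrow> 'v) \<Rightarrow> ('v \<Rightarrow> complex)
    \<Rightarrow> ('v \<times> 'v \<Rightarrow> real \<Rightarrow> complex) \<Rightarrow> bool" where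
  "circular_planar V E n node pos \<gamma> \<longleftrightarrow>
     inj_on pos V \<and>
     (\<forall>v\<in>V - node ` {1..2*n}. pos v \<in> ball 0 1) \<and>
     (\<exists>\<theta>::nat \<Rightarrow> real. strict_mono_on {1..2*n} \<theta> \<and>
        (\<forall>i\<in>{1..2*n}. 0 \<le> \<theta> i \<and> \<theta> i < 2 * pi \<and> pos (node i) = cis (\<theta> i))) \<and>
     (\<forall>e\<in>E. arc (\<gamma> e) \<and> pathstart (\<gamma> e) = pos (fst e) \<and> pathfinish (\<gamma> e) = pos (snd e) \<and>
        path_image (\<gamma> e) - {pos (fst e), pos (snd e)} \<subseteq> ball 0 1 - pos ` V) \<and>
     (\<forall>e\<in>E. \<forall>e'\<in>E. e \<noteq> e' \<longrightarrow>
        path_image (\<gamma> e) \<inter> path_image (\<gamma> e') \<subseteq>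
          {pos (fst e), pos (snd e)} \<inter> {pos (fst e'), pos (snd e')})"

end

theory Submission
  imports Defs
begin

text \<open>Close a double-dimer configuration up by drawing \<open>\<pi>\<close> outside the disk and orient all resulting
  loops: putting the edges oriented from black to white into one matching and the others into a second
  one shows that the left-hand side, times \<open>(Z\<^sup>D)\<^sup>2\<close>, is the sum of
  \<open>Z(G - A) Z(G - A\<^sup>c)\<close> over the node sets \<open>A\<close> compatible with \<open>\<pi>\<close>. By planarity the paths in
  a superposition of two matchings do not cross, so Kuo--Ciucu condensation (recolouring one path)
  expresses \<open>Z(G - A) / Z(G)\<close> as a Pfaffian in the \<open>Y\<^bsub>i,j\<^esub>\<close>. Expanding both Pfaffians, a black-white
  pairing \<open>\<rho>\<close> arises from those \<open>A\<close> that are compatible with \<open>\<pi>\<close> and invariant under \<open>\<rho>\<close>; there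
  are \<open>2\<^bsup>c\<^esup>\<close> of them, \<open>c\<close> the number of components of \<open>\<pi> \<union> \<rho>\<close>. Each contributes the same sign, because the
  inversion sign of a pairing read from a set T containing one point of each pair changes, when T is replaced
  by T', by the parity of the crossings between a pair on which T and T' agree and one on which they differ.\<close>

section \<open>Pairings and their sections\<close>

text \<open>A section takes one point from each pair, so it orients every pair. Two fixed-point-free
  involutions always have a common section, since the union of two perfect matchings consists of
  even cycles. This fact orients the closed-up configurations (applied to half-edges) and produces
  the factor 2^c (applied to two pairings). As the node colours are arbitrary, the conditions on A
  depend on them; toggling A at the black nodes turns compatibility with \<pi> and invariance under
  \<rho> into one condition, that of being a section. Topology enters once, to show that two
  interleaved connected pairs of nodes lie in one component; everything later argues from that
  statement for arbitrary edge sets. The Pfaffians range over all pairings, but a pair of equal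
  colour has Y = 0 because a perfect matching balances black and white, so only black-white pairings
  survive. Planarity of \<pi> enters the signs by making the inversion sign of \<pi> the same on all
  its sections, so that it may be read at the odd labels, where it is
  \<open>sign_OE\<close>.\<close>

definition ff_involution :: "'a set \<Rightarrow> ('a \<Rightarrow> 'a) \<Rightarrow> bool" where
  "ff_involution X p \<longleftrightarrow> (\<forall>i\<in>X. p i \<in> X \<and> p i \<noteq> i \<and> p (p i) = i)"

definition pairs_on :: "'a set \<Rightarrow> ('a \<Rightarrow> 'a) set" where
  "pairs_on X = {p. ff_involution X p \<and> (\<forall>i. i \<notin> X \<longrightarrow> p i = i)}"

definition is_section :: "'a set \<Rightarrow> ('a \<Rightarrow> 'a) \<Rightarrow> 'a set \<Rightarrow> bool" where
  "is_section X p T \<longleftrightarrow> T \<subseteq> X \<and> (\<forall>i\<in>X. i \<in> T \<longleftrightarrow> p i \<notin> T)"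

text \<open>Unions of orbits of the maps in P. For two pairings these are the unions of components,
  for a single permutation the unions of cycles, so both numbers can be compared through the
  cardinality of such a family.\<close>

definition invariant_subsets :: "'a set \<Rightarrow> ('a \<Rightarrow> 'a) set \<Rightarrow> 'a set set" where
  "invariant_subsets X P = {F. F \<subseteq> X \<and> (\<forall>p\<in>P. \<forall>i\<in>X. i \<in> F \<longleftrightarrow> p i \<in> F)}"

lemma ff_involutionD:
  assumes "ff_involution X p" "i \<in> X"
  shows "p i \<in> X" "p i \<noteq> i" "p (p i) = i"
  using assms by (auto simp: ff_involution_def)

lemma is_sectionD: "is_section X p T \<Longrightarrow> i \<in> X \<Longrightarrow> p i \<in> T \<longleftrightarrow> i \<notin> T"
  unfolding is_section_def by metis

lemma invariant_subsetsD: "F \<in> invariant_subsets X P \<Longrightarrow> p \<in> P \<Longrightarrow> i \<in> X \<Longrightarrow> p i \<in> F \<longleftrightarrow> i \<in> F"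
  unfolding invariant_subsets_def by blast

lemma pairs_on_ff: "p \<in> pairs_on X \<Longrightarrow> ff_involution X p"
  by (simp add: pairs_on_def)

lemma pairs_on_out: "p \<in> pairs_on X \<Longrightarrow> k \<notin> X \<Longrightarrow> p k = k"
  by (simp add: pairs_on_def)

lemma pairings_eq_pairs_on: "pairings n = pairs_on {1..2*n}"
  by (simp add: pairings_def pairs_on_def ff_involution_def)

lemma pairs_on_permutes: "p \<in> pairs_on X \<Longrightarrow> p permutes X"
proof -
  assume p: "p \<in> pairs_on X"
  then have "p (p i) = i" for i
    by (cases "i \<in> X") (auto simp: pairs_on_def ff_involution_def)
  then have "\<exists>!i. p i = j" for j by metis
  then show ?thesis using p by (simp add: permutes_def pairs_on_def)
qed

lemma finite_pairs_on: "finite X \<Longrightarrow> finite (pairs_on X)"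
  using finite_subset[OF _ finite_permutations[of X]] pairs_on_permutes by blast

text \<open>The graph with the pairs of \<open>a\<close> and \<open>b\<close> as edges is a union of
  even cycles, and T is one class of a proper 2-colouring. The induction removes one
  \<open>a\<close>-pair at a time and repairs \<open>b\<close> where it has been cut.\<close>

lemma common_section_exists:
  assumes "finite X" "ff_involution X a" "ff_involution X b"
  shows "\<exists>T. is_section X a T \<and> is_section X b T"
  using assms
proof (induction "card X" arbitrary: X b rule: less_induct)
  case less
  note a = ff_involutionD[OF less.prems(2)] and b = ff_involutionD[OF less.prems(3)]
  show ?case
  proof (cases "X = {}")
    case True
    then show ?thesis by (auto simp: is_section_def)
  next
    case False
    then obtain x where x: "x \<in> X" by blast
    define y where "y = a x"
    define X' where "X' = X - {x, y}"
    have y: "y \<in> X" "y \<noteq> x" "a y = x" using a[OF x] by (auto simp: y_def)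
    have smaller: "card X' < card X"
      using less.prems(1) x by (auto simp: X'_def intro!: psubset_card_mono)
    have fin: "finite X'" using less.prems(1) by (simp add: X'_def)
    have a': "ff_involution X' a"
      unfolding ff_involution_def
    proof
      fix i assume "i \<in> X'"
      then have i: "i \<in> X" "i \<noteq> x" "i \<noteq> y" by (auto simp: X'_def)
      show "a i \<in> X' \<and> a i \<noteq> i \<and> a (a i) = i"
        using a[OF i(1)] i y y_def by (auto simp: X'_def)
    qed
    show ?thesis
    proof (cases "b x = y")
      case True
      have by_: "b y = x" using b[OF x] True by simp
      have "ff_involution X' b"
        unfolding ff_involution_def
      proof
        fix i assume "i \<in> X'"
        then have i: "i \<in> X" "i \<noteq> x" "i \<noteq> y" by (auto simp: X'_def)
        show "b i \<in> X' \<and> b i \<noteq> i \<and> b (b i) = i"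
          using b[OF i(1)] i True by_ by (auto simp: X'_def)
      qed
      from less.hyps[OF smaller fin a' this] obtain T where
        T: "is_section X' a T" "is_section X' b T" by blast
      have TX: "T \<subseteq> X - {x,y}" using T by (auto simp: is_section_def X'_def)
      have memT: "i \<in> insert x T \<longleftrightarrow> (if i = x then True else if i = y then False else i \<in> T)" for i
        using TX y by auto
      have sa: "i \<in> insert x T \<longleftrightarrow> a i \<notin> insert x T" if i: "i \<in> X" for i
      proof (cases "i = x \<or> i = y")
        case True
        then show ?thesis unfolding memT using y y_def by auto
      next
        case False
        then have "a i \<noteq> x" "a i \<noteq> y" using a[OF i] y y_def by metis+
        moreover have "i \<in> T \<longleftrightarrow> a i \<notin> T" using T(1) i False by (auto simp: is_section_def X'_def)
        ultimately show ?thesis unfolding memT using False by simp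
      qed
      have sb: "i \<in> insert x T \<longleftrightarrow> b i \<notin> insert x T" if i: "i \<in> X" for i
      proof (cases "i = x \<or> i = y")
        case True
        then show ?thesis unfolding memT using y \<open>b x = y\<close> by_ by auto
      next
        case False
        then have "b i \<noteq> x" "b i \<noteq> y" using b[OF i] by_ \<open>b x = y\<close> by metis+
        moreover have "i \<in> T \<longleftrightarrow> b i \<notin> T" using T(2) i False by (auto simp: is_section_def X'_def)
        ultimately show ?thesis unfolding memT using False by simp
      qed
      have "is_section X a (insert x T)" "is_section X b (insert x T)"
        unfolding is_section_def using sa sb TX x by blast+
      then show ?thesis by blast
    next
      case False
      define u v where "u = b x" and "v = b y"
      have uv: "u \<in> X" "v \<in> X" "u \<noteq> x" "u \<noteq> y" "v \<noteq> x" "v \<noteq> y" "u \<noteq> v" "b u = x" "b v = y"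
        using b[OF x] b[OF y(1)] False y unfolding u_def v_def by metis+
      \<comment> \<open>The stretch u, x, y, v of the cycle is contracted to a single
        \<open>b\<close>-edge from u to v.\<close>
      define b' where "b' = b(u := v, v := u)"
      have b': "ff_involution X' b'"
        unfolding ff_involution_def
      proof
        fix i assume "i \<in> X'"
        then have i: "i \<in> X" "i \<noteq> x" "i \<noteq> y" by (auto simp: X'_def)
        show "b' i \<in> X' \<and> b' i \<noteq> i \<and> b' (b' i) = i"
        proof (cases "i = u \<or> i = v")
          case True
          then show ?thesis using uv by (auto simp: b'_def X'_def)
        next
          case False
          then have "b i \<noteq> u" "b i \<noteq> v" "b i \<noteq> x" "b i \<noteq> y"
            using b[OF i(1)] i uv unfolding u_def v_def by metis+
          then show ?thesis using False b[OF i(1)] by (auto simp: b'_def X'_def)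
        qed
      qed
      from less.hyps[OF smaller fin a' b'] obtain T where
        T: "is_section X' a T" "is_section X' b' T" by blast
      have TX: "x \<notin> T" "y \<notin> T" "T \<subseteq> X" using T by (auto simp: is_section_def X'_def)
      have uvT: "u \<in> T \<longleftrightarrow> v \<notin> T"
      proof -
        have "u \<in> X'" using uv by (simp add: X'_def)
        moreover have "b' u = v" using uv by (simp add: b'_def)
        ultimately show ?thesis using T(2) unfolding is_section_def by metis
      qed
      \<comment> \<open>Since u and v have opposite colours, x and y can be coloured opposite to u
        and v respectively; exactly one of them joins T.\<close>
      define T' where "T' = (if u \<in> T then insert y T else insert x T)"
      have memT: "i \<in> T' \<longleftrightarrow> (if i = x then u \<notin> T else if i = y then u \<in> T else i \<in> T)" for i
        using TX y by (auto simp: T'_def)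
      have sa: "i \<in> T' \<longleftrightarrow> a i \<notin> T'" if i: "i \<in> X" for i
      proof (cases "i = x \<or> i = y")
        case True
        then show ?thesis using memT y y_def by auto
      next
        case False
        then have "a i \<noteq> x" "a i \<noteq> y" using a[OF i] y y_def by metis+
        moreover have "i \<in> T \<longleftrightarrow> a i \<notin> T" using T(1) i False by (auto simp: is_section_def X'_def)
        ultimately show ?thesis using False by (simp add: memT)
      qed
      have sb: "i \<in> T' \<longleftrightarrow> b i \<notin> T'" if i: "i \<in> X" for i
      proof (cases "i = x \<or> i = y \<or> i = u \<or> i = v")
        case True
        then show ?thesis using memT y uv uvT u_def v_def by auto
      next
        case False
        then have "b i \<noteq> x" "b i \<noteq> y" using b[OF i] u_def v_def by metis+
        moreover have "i \<in> T \<longleftrightarrow> b i \<notin> T"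
          using T(2) i False by (auto simp: is_section_def X'_def b'_def)
        ultimately show ?thesis using False by (simp add: memT)
      qed
      have "T' \<subseteq> X" using TX x y by (auto simp: T'_def)
      then show ?thesis using sa sb by (auto simp: is_section_def intro!: exI[of _ T'])
    qed
  qed
qed

lemma even_card_ff_involution:
  assumes "finite X" "ff_involution X p"
  shows "even (card X)"
proof -
  obtain T where T: "is_section X p T" using common_section_exists[OF assms assms(2)] by blast
  have "X = T \<union> p ` T"
  proof
    show "X \<subseteq> T \<union> p ` T"
      using T ff_involutionD[OF assms(2)] unfolding is_section_def
      by (metis UnCI image_eqI subsetI)
    show "T \<union> p ` T \<subseteq> X"
      using T ff_involutionD[OF assms(2)] unfolding is_section_def by blast
  qed
  moreover have "T \<inter> p ` T = {}" using T unfolding is_section_def by auto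
  moreover have "inj_on p T"
    using T ff_involutionD[OF assms(2)] unfolding is_section_def inj_on_def by (metis subsetD)
  moreover have "finite T" using T assms(1) finite_subset by (auto simp: is_section_def)
  ultimately have "card X = card T + card T"
    by (metis card_Un_disjoint card_image finite_imageI)
  then show ?thesis by simp
qed

section \<open>Components of two pairings, counted by powers of two\<close>

lemma card_Union_Pow_disjoint:
  assumes "finite \<C>" "pairwise disjnt \<C>" "{} \<notin> \<C>"
  shows "card (Union ` Pow \<C>) = 2 ^ card \<C>"
proof -
  have "\<F> \<subseteq> \<G>" if F: "\<F> \<subseteq> \<C>" and G: "\<G> \<subseteq> \<C>" and eq: "\<Union>\<F> = \<Union>\<G>" for \<F> \<G>
  proof
    fix C assume C: "C \<in> \<F>"
    then have "C \<noteq> {}" using F assms(3) by blast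
    then obtain x where x: "x \<in> C" by blast
    then obtain C' where C': "C' \<in> \<G>" "x \<in> C'" using C eq by blast
    then have "C = C'"
      using x C F G assms(2) unfolding pairwise_def disjnt_def by blast
    then show "C \<in> \<G>" using C' by simp
  qed
  then have "inj_on Union (Pow \<C>)" by (metis PowD inj_onI subset_antisym)
  then show ?thesis using assms(1) by (simp add: card_image card_Pow)
qed

lemma sym_rtrancl_equiv: "sym R \<Longrightarrow> equiv UNIV (R\<^sup>*)"
  by (auto simp: equiv_def refl_rtrancl trans_rtrancl sym_rtrancl)

lemma pairwise_disjnt_classes:
  assumes "sym R" shows "pairwise disjnt (X // R\<^sup>*)"
proof -
  have "disjnt C D" if C: "C \<in> X // R\<^sup>*" and D: "D \<in> X // R\<^sup>*" and CD: "C \<noteq> D" for C D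
  proof -
    have "C \<in> UNIV // R\<^sup>*" "D \<in> UNIV // R\<^sup>*" using C D by (auto simp: quotient_def)
    then show ?thesis
      using quotient_disj[OF sym_rtrancl_equiv[OF assms]] CD by (auto simp: disjnt_def)
  qed
  then show ?thesis by (auto simp: pairwise_def)
qed

lemma empty_not_class: "{} \<notin> X // R\<^sup>*"
  by (auto simp: quotient_def)

lemma rtrancl_closed:
  assumes "(x, y) \<in> R\<^sup>*" "x \<in> F" "\<And>a b. (a, b) \<in> R \<Longrightarrow> a \<in> F \<Longrightarrow> b \<in> F"
  shows "y \<in> F"
  using assms by (induction rule: rtrancl_induct) auto

text \<open>A closed set is the union of the classes of its elements, and distinct families of
  classes have distinct unions. This replaces the quotient in \<open>ncomp\<close> by a count of
  subsets, which is easier to transport.\<close>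

lemma card_closed_sets:
  assumes "finite X" "sym R" "R `` X \<subseteq> X"
  shows "card {F. F \<subseteq> X \<and> (\<forall>a b. (a, b) \<in> R \<longrightarrow> a \<in> F \<longrightarrow> b \<in> F)} = 2 ^ card (X // R\<^sup>*)"
proof -
  have cl: "R\<^sup>* `` {x} \<subseteq> X" if "x \<in> X" for x
  proof
    fix y assume "y \<in> R\<^sup>* `` {x}"
    then have "(x, y) \<in> R\<^sup>*" by simp
    then show "y \<in> X" using that by (rule rtrancl_closed) (use assms(3) in blast)
  qed
  have "{F. F \<subseteq> X \<and> (\<forall>a b. (a, b) \<in> R \<longrightarrow> a \<in> F \<longrightarrow> b \<in> F)} = Union ` Pow (X // R\<^sup>*)" (is "?L = ?R")
  proof
    show "?L \<subseteq> ?R"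
    proof
      fix F assume F: "F \<in> ?L"
      have "F = \<Union>((\<lambda>x. R\<^sup>* `` {x}) ` F)"
      proof (intro equalityI subsetI)
        fix y assume "y \<in> \<Union>((\<lambda>x. R\<^sup>* `` {x}) ` F)"
        then obtain x where "x \<in> F" "(x, y) \<in> R\<^sup>*" by blast
        then show "y \<in> F" using F rtrancl_closed[of x y R F] by blast
      qed blast
      moreover have "(\<lambda>x. R\<^sup>* `` {x}) ` F \<in> Pow (X // R\<^sup>*)"
        using F by (auto simp: quotient_def)
      ultimately show "F \<in> ?R" by blast
    qed
    show "?R \<subseteq> ?L"
    proof
      fix F assume "F \<in> ?R"
      then obtain \<C> where C: "\<C> \<subseteq> X // R\<^sup>*" "F = \<Union>\<C>" by blast
      have "F \<subseteq> X" using C cl unfolding quotient_def by blast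
      moreover have "b \<in> F" if ab: "(a, b) \<in> R" and a: "a \<in> F" for a b
      proof -
        obtain x where x: "R\<^sup>* `` {x} \<in> \<C>" "(x, a) \<in> R\<^sup>*"
          using a C unfolding quotient_def by blast
        then show ?thesis using rtrancl_into_rtrancl[OF x(2) ab] C(2) by blast
      qed
      ultimately show "F \<in> ?L" by blast
    qed
  qed
  moreover have "finite (X // R\<^sup>*)" using assms(1) by (simp add: quotient_def)
  ultimately show ?thesis
    using card_Union_Pow_disjoint[OF _ pairwise_disjnt_classes[OF assms(2)] empty_not_class] by simp
qed

lemma card_invariant_subsets_pairings:
  assumes "p \<in> pairings n" "q \<in> pairings n"
  shows "card (invariant_subsets {1..2*n} {p, q}) = 2 ^ ncomp n p q"
proof -
  let ?X = "{1..2*n}"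
  let ?R = "{(i, p i) | i. i \<in> ?X} \<union> {(i, q i) | i. i \<in> ?X}"
  have inv: "ff_involution ?X p" "ff_involution ?X q"
    using assms by (auto simp: pairings_eq_pairs_on pairs_on_def)
  note P = ff_involutionD[OF inv(1)] and Q = ff_involutionD[OF inv(2)]
  have s: "sym ?R"
  proof (rule symI)
    fix i j assume "(i, j) \<in> ?R"
    then have "(i \<in> ?X \<and> j = p i) \<or> (i \<in> ?X \<and> j = q i)" by auto
    then show "(j, i) \<in> ?R" using P[of i] Q[of i] by auto
  qed
  have "?R `` ?X \<subseteq> ?X" using P Q by blast
  from card_closed_sets[OF _ s this]
  have "card {F. F \<subseteq> ?X \<and> (\<forall>a b. (a, b) \<in> ?R \<longrightarrow> a \<in> F \<longrightarrow> b \<in> F)} = 2 ^ ncomp n p q"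
    by (simp add: ncomp_def)
  moreover have "{F. F \<subseteq> ?X \<and> (\<forall>a b. (a, b) \<in> ?R \<longrightarrow> a \<in> F \<longrightarrow> b \<in> F)} = invariant_subsets ?X {p, q}"
  proof (intro equalityI subsetI)
    fix F assume F: "F \<in> {F. F \<subseteq> ?X \<and> (\<forall>a b. (a, b) \<in> ?R \<longrightarrow> a \<in> F \<longrightarrow> b \<in> F)}"
    have "i \<in> F \<longleftrightarrow> p i \<in> F" "i \<in> F \<longleftrightarrow> q i \<in> F" if i: "i \<in> ?X" for i
    proof -
      have "(i, p i) \<in> ?R" "(p i, i) \<in> ?R" "(i, q i) \<in> ?R" "(q i, i) \<in> ?R"
        using i s[unfolded sym_def] by blast+
      then show "i \<in> F \<longleftrightarrow> p i \<in> F" "i \<in> F \<longleftrightarrow> q i \<in> F" using F by blast+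
    qed
    then show "F \<in> invariant_subsets ?X {p, q}" using F by (simp add: invariant_subsets_def)
  next
    fix F assume "F \<in> invariant_subsets ?X {p, q}"
    then show "F \<in> {F. F \<subseteq> ?X \<and> (\<forall>a b. (a, b) \<in> ?R \<longrightarrow> a \<in> F \<longrightarrow> b \<in> F)}"
      by (auto simp: invariant_subsets_def)
  qed
  ultimately show ?thesis by simp
qed

text \<open>The common sections form a coset of the invariant sets under symmetric difference: the
  symmetric difference with one fixed common section S exchanges the two families.\<close>

lemma card_common_sections_eq_invariant:
  assumes "finite X" "ff_involution X p" "ff_involution X q"
  shows "card {T. is_section X p T \<and> is_section X q T} = card (invariant_subsets X {p, q})"
proof -
  obtain S where S: "is_section X p S" "is_section X q S"
    using common_section_exists[OF assms] by auto
  let ?f = "\<lambda>F. sym_diff F S"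
  have S': "i \<in> S \<longleftrightarrow> p i \<notin> S" "i \<in> S \<longleftrightarrow> q i \<notin> S" if "i \<in> X" for i
    using S is_sectionD[OF _ that] by blast+
  have "bij_betw ?f (invariant_subsets X {p,q}) {T. is_section X p T \<and> is_section X q T}"
  proof (rule bij_betwI[where g = ?f])
    show "?f \<in> invariant_subsets X {p,q} \<rightarrow> {T. is_section X p T \<and> is_section X q T}"
    proof
      fix F assume F: "F \<in> invariant_subsets X {p,q}"
      have "i \<in> ?f F \<longleftrightarrow> p i \<notin> ?f F" "i \<in> ?f F \<longleftrightarrow> q i \<notin> ?f F" if i: "i \<in> X" for i
      proof -
        have "i \<in> F \<longleftrightarrow> p i \<in> F" "i \<in> F \<longleftrightarrow> q i \<in> F"
          using invariant_subsetsD[OF F _ i] by blast+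
        then show "i \<in> ?f F \<longleftrightarrow> p i \<notin> ?f F" "i \<in> ?f F \<longleftrightarrow> q i \<notin> ?f F"
          using S'[OF i] by auto
      qed
      moreover have "?f F \<subseteq> X" using F S unfolding invariant_subsets_def is_section_def by blast
      ultimately show "?f F \<in> {T. is_section X p T \<and> is_section X q T}"
        by (simp add: is_section_def)
    qed
    show "?f \<in> {T. is_section X p T \<and> is_section X q T} \<rightarrow> invariant_subsets X {p,q}"
    proof
      fix F assume F: "F \<in> {T. is_section X p T \<and> is_section X q T}"
      have "i \<in> ?f F \<longleftrightarrow> p i \<in> ?f F" "i \<in> ?f F \<longleftrightarrow> q i \<in> ?f F" if i: "i \<in> X" for i
      proof -
        have "i \<in> F \<longleftrightarrow> p i \<notin> F" "i \<in> F \<longleftrightarrow> q i \<notin> F"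
          using F is_sectionD[OF _ i] by blast+
        then show "i \<in> ?f F \<longleftrightarrow> p i \<in> ?f F" "i \<in> ?f F \<longleftrightarrow> q i \<in> ?f F"
          using S'[OF i] by auto
      qed
      moreover have "?f F \<subseteq> X" using F S unfolding is_section_def by blast
      ultimately show "?f F \<in> invariant_subsets X {p,q}"
        by (simp add: invariant_subsets_def)
    qed
  qed auto
  then show ?thesis
    using bij_betw_same_card by metis
qed

lemma card_common_sections:
  assumes "p \<in> pairings n" "q \<in> pairings n"
  shows "card {T. is_section {1..2*n} p T \<and> is_section {1..2*n} q T} = 2 ^ ncomp n p q"
  using card_common_sections_eq_invariant[of "{1..2*n}" p q] card_invariant_subsets_pairings[OF assms] assms
  by (simp add: pairings_eq_pairs_on pairs_on_ff)

section \<open>Signs and inversions\<close>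

text \<open>Here c is the number of cycles, fixed points included, so this is the formula (-1)^(size
  - cycles) for the sign, with cycles counted through invariant subsets instead of a cycle
  decomposition. A new fixed point doubles the family; a new point inside a cycle leaves it
  unchanged in size and changes the sign.\<close>

lemma sign_eq_invariant_subsets_parity:
  assumes "finite A" "p permutes A"
  shows "\<exists>c. card (invariant_subsets A {p}) = 2 ^ c \<and> sign p = (-1) ^ (card A + c)"
  using assms
proof (induction A arbitrary: p rule: finite_induct)
  case empty
  then have "p = id" by simp
  then show ?case by (auto simp: invariant_subsets_def intro!: exI[of _ 0])
next
  case (insert x A)
  show ?case
  proof (cases "p x = x")
    case True
    have "p permutes A" using permutes_insert_lemma[OF insert.prems] True by simp
    from insert.IH[OF this] obtain c where
      c: "card (invariant_subsets A {p}) = 2 ^ c" "sign p = (-1) ^ (card A + c)" by blast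
    let ?I = "invariant_subsets A {p}"
    have px: "p y = x \<longleftrightarrow> y = x" for y using True insert.prems permutes_inj by (metis injD)
    have "invariant_subsets (insert x A) {p} = ?I \<union> insert x ` ?I"
    proof (intro equalityI subsetI)
      fix F assume F: "F \<in> invariant_subsets (insert x A) {p}"
      then have F1: "F \<subseteq> insert x A" by (simp add: invariant_subsets_def)
      have "F - {x} \<in> ?I"
        using F1 invariant_subsetsD[OF F, of p] px by (auto simp: invariant_subsets_def)
      moreover have "F = F - {x} \<or> F = insert x (F - {x})" by blast
      ultimately show "F \<in> ?I \<union> insert x ` ?I" by (metis UnI1 UnI2 image_eqI)
    next
      fix F assume "F \<in> ?I \<union> insert x ` ?I"
      then obtain G where G: "G \<in> ?I" "F = G \<or> F = insert x G" by blast
      then have GA: "G \<subseteq> A" by (simp add: invariant_subsets_def)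
      show "F \<in> invariant_subsets (insert x A) {p}"
      proof -
        have "p y \<in> G \<longleftrightarrow> y \<in> G" if "y \<in> insert x A" for y
          using invariant_subsetsD[OF G(1), of p y] that True by auto
        then show ?thesis using G(2) GA px by (auto simp: invariant_subsets_def)
      qed
    qed
    moreover have "?I \<inter> insert x ` ?I = {}"
      using insert.hyps by (auto simp: invariant_subsets_def)
    moreover have "finite ?I"
      using insert.hyps by (auto intro: finite_subset[of _ "Pow A"] simp: invariant_subsets_def)
    moreover have "inj_on (insert x) ?I"
    proof (rule inj_onI)
      fix F G assume "F \<in> ?I" "G \<in> ?I" "insert x F = insert x G"
      moreover have "x \<notin> F" "x \<notin> G"
        using insert.hyps calculation by (auto simp: invariant_subsets_def)
      ultimately show "F = G" by (metis insert_ident)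
    qed
    ultimately have "card (invariant_subsets (insert x A) {p}) = 2 ^ Suc c"
      using c by (simp add: card_Un_disjoint card_image)
    moreover have "sign p = (-1) ^ (card (insert x A) + Suc c)"
      using c insert.hyps by simp
    ultimately show ?thesis by blast
  next
    case False
    \<comment> \<open>The map \<open>q\<close> fixes x and sends the predecessor of x straight to
      \<open>p x\<close>, which deletes x from its cycle.\<close>
    define q where "q = Transposition.transpose x (p x) \<circ> p"
    have "q permutes A" unfolding q_def by (rule permutes_insert_lemma[OF insert.prems])
    from insert.IH[OF this] obtain c where
      c: "card (invariant_subsets A {q}) = 2 ^ c" "sign q = (-1) ^ (card A + c)" by blast
    have inj: "p a = p b \<Longrightarrow> a = b" for a b using insert.prems permutes_inj by (metis injD)
    have q: "q y = (if p y = x then p x else p y)" if "y \<noteq> x" for y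
      using that inj[of y x] by (auto simp: q_def Transposition.transpose_def)
    \<comment> \<open>In a set invariant under p the point x goes along with \<open>p x\<close>, so
      its membership can be restored from the rest.\<close>
    have "bij_betw (\<lambda>F. F - {x}) (invariant_subsets (insert x A) {p}) (invariant_subsets A {q})"
    proof (rule bij_betwI[where g = "\<lambda>G. if p x \<in> G then insert x G else G"])
      show "(\<lambda>F. F - {x}) \<in> invariant_subsets (insert x A) {p} \<rightarrow> invariant_subsets A {q}"
      proof
        fix F assume F: "F \<in> invariant_subsets (insert x A) {p}"
        have F': "p y \<in> F \<longleftrightarrow> y \<in> F" if "y \<in> insert x A" for y
          using invariant_subsetsD[OF F _ that] by blast
        have "y \<in> F - {x} \<longleftrightarrow> q y \<in> F - {x}" if y: "y \<in> A" for y
        proof -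
          have "y \<noteq> x" using y insert.hyps by auto
          then show ?thesis using F'[of y] F'[of x] y q[of y] False by auto
        qed
        moreover have "F - {x} \<subseteq> A" using F by (auto simp: invariant_subsets_def)
        ultimately show "F - {x} \<in> invariant_subsets A {q}" by (simp add: invariant_subsets_def)
      qed
      show "(\<lambda>G. if p x \<in> G then insert x G else G) \<in> invariant_subsets A {q} \<rightarrow> invariant_subsets (insert x A) {p}"
      proof
        fix G assume G: "G \<in> invariant_subsets A {q}"
        let ?F = "if p x \<in> G then insert x G else G"
        have GA: "G \<subseteq> A" using G by (auto simp: invariant_subsets_def)
        have mem: "y \<in> ?F \<longleftrightarrow> (if y = x then p x \<in> G else y \<in> G)" for y
          using GA insert.hyps by auto
        have "y \<in> ?F \<longleftrightarrow> p y \<in> ?F" if y: "y \<in> insert x A" for y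
        proof (cases "y = x")
          case True
          then show ?thesis using False unfolding mem by simp
        next
          case neq: False
          then have "q y \<in> G \<longleftrightarrow> y \<in> G" using invariant_subsetsD[OF G, of q y] y by auto
          then show ?thesis using neq q[OF neq] unfolding mem by auto
        qed
        moreover have "?F \<subseteq> insert x A" using GA by auto
        ultimately show "?F \<in> invariant_subsets (insert x A) {p}" by (simp add: invariant_subsets_def)
      qed
      show "(if p x \<in> F - {x} then insert x (F - {x}) else F - {x}) = F"
        if F: "F \<in> invariant_subsets (insert x A) {p}" for F
        using invariant_subsetsD[OF F, of p x] False by auto
      show "(if p x \<in> G then insert x G else G) - {x} = G"
        if "G \<in> invariant_subsets A {q}" for G
        using that insert.hyps by (auto simp: invariant_subsets_def)
    qed
    then have "card (invariant_subsets (insert x A) {p}) = 2 ^ c"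
      using c bij_betw_same_card by metis
    moreover have "sign p = (-1) ^ (card (insert x A) + c)"
    proof -
      have "permutation p" using insert.prems insert.hyps permutation_permutes by blast
      then have "sign q = - sign p"
        unfolding q_def using False by (simp add: sign_compose permutation_swap_id sign_swap_id)
      then show ?thesis using c insert.hyps by simp
    qed
    ultimately show ?thesis by blast
  qed
qed

section \<open>Inversion signs of maps between linear orders\<close>

definition lt_pairs :: "'a::linorder set \<Rightarrow> ('a \<times> 'a) set" where
  "lt_pairs X = {(x, y). x \<in> X \<and> y \<in> X \<and> x < y}"

text \<open>The sign of a permutation, freed from the requirement that domain and image coincide: it
  applies to a pairing restricted to one of its sections, whose image is the complement. It is meant
  for maps injective on X; a tie would count as an inversion.\<close>

definition inv_sign :: "('a::linorder \<Rightarrow> 'b::linorder) \<Rightarrow> 'a set \<Rightarrow> int" where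
  "inv_sign f X = (\<Prod>(x, y)\<in>lt_pairs X. if f x < f y then 1 else -1)"

lemma finite_lt_pairs: "finite X \<Longrightarrow> finite (lt_pairs X)"
  by (rule finite_subset[of _ "X \<times> X"]) (auto simp: lt_pairs_def)

lemma inv_sign_cong: "(\<And>x. x \<in> X \<Longrightarrow> f x = g x) \<Longrightarrow> inv_sign f X = inv_sign g X"
  unfolding inv_sign_def by (rule prod.cong) (auto simp: lt_pairs_def)

text \<open>Two-element subsets of X and of the image correspond under f, but f may reverse the
  order inside one of them. The symmetry of h absorbs this.\<close>

lemma prod_lt_pairs_reindex:
  fixes f :: "'a::linorder \<Rightarrow> 'b::linorder" and h :: "'b \<Rightarrow> 'b \<Rightarrow> 'c::comm_monoid_mult"
  assumes inj: "inj_on f X" and sym: "\<And>u v. u \<in> f ` X \<Longrightarrow> v \<in> f ` X \<Longrightarrow> h u v = h v u"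
  shows "(\<Prod>(u, v)\<in>lt_pairs (f ` X). h u v) = (\<Prod>(x, y)\<in>lt_pairs X. h (f x) (f y))"
proof -
  let ?\<phi> = "\<lambda>(x, y). if f x < f y then (f x, f y) else (f y, f x)"
  have ne: "f x \<noteq> f y" if "(x, y) \<in> lt_pairs X" for x y
    using that inj by (auto simp: lt_pairs_def inj_on_def)
  have "bij_betw ?\<phi> (lt_pairs X) (lt_pairs (f ` X))"
    unfolding bij_betw_def
  proof
    show "inj_on ?\<phi> (lt_pairs X)"
    proof (rule inj_onI)
      fix z w assume zw: "z \<in> lt_pairs X" "w \<in> lt_pairs X" "?\<phi> z = ?\<phi> w"
      obtain x y where z: "z = (x, y)" "x \<in> X" "y \<in> X" "x < y"
        using zw by (cases z) (auto simp: lt_pairs_def)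
      obtain x' y' where w: "w = (x', y')" "x' \<in> X" "y' \<in> X" "x' < y'"
        using zw by (cases w) (auto simp: lt_pairs_def)
      have "f x = f x' \<and> f y = f y' \<or> f x = f y' \<and> f y = f x'"
        using zw z w by (auto split: if_splits)
      then have "x = x' \<and> y = y' \<or> x = y' \<and> y = x'"
        using inj z w by (auto simp: inj_on_def)
      then show "z = w" using z w by auto
    qed
    show "?\<phi> ` lt_pairs X = lt_pairs (f ` X)"
    proof
      show "?\<phi> ` lt_pairs X \<subseteq> lt_pairs (f ` X)"
        using ne by (auto simp: lt_pairs_def split: if_splits) (meson not_less_iff_gr_or_eq)
      show "lt_pairs (f ` X) \<subseteq> ?\<phi> ` lt_pairs X"
      proof
        fix w assume "w \<in> lt_pairs (f ` X)"
        then obtain x y where xy: "w = (f x, f y)" "x \<in> X" "y \<in> X" "f x < f y"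
          by (auto simp: lt_pairs_def)
        then consider "x < y" | "y < x" by (metis less_irrefl neqE)
        then show "w \<in> ?\<phi> ` lt_pairs X"
        proof cases
          case 1
          then show ?thesis using xy by (auto simp: lt_pairs_def image_iff intro!: bexI[of _ "(x, y)"])
        next
          case 2
          moreover have "?\<phi> (y, x) = w" using xy by auto
          ultimately show ?thesis using xy by (intro image_eqI[of _ _ "(y, x)"]) (auto simp: lt_pairs_def)
        qed
      qed
    qed
  qed
  from prod.reindex_bij_betw[OF this, of "\<lambda>(u, v). h u v"]
  have "(\<Prod>(u, v)\<in>lt_pairs (f ` X). h u v) = (\<Prod>z\<in>lt_pairs X. case ?\<phi> z of (u, v) \<Rightarrow> h u v)"
    by simp
  also have "\<dots> = (\<Prod>(x, y)\<in>lt_pairs X. h (f x) (f y))"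
    by (rule prod.cong) (auto simp: lt_pairs_def sym)
  finally show ?thesis .
qed

lemma inv_sign_reindex:
  assumes "inj_on f X" "inj_on g (f ` X)"
  shows "inv_sign g (f ` X) = (\<Prod>(x, y)\<in>lt_pairs X. if (f x < f y) = (g (f x) < g (f y)) then 1 else -1)"
proof -
  \<comment> \<open>Asking whether g preserves the order of u and v, rather than whether g u < g v,
    makes the factor symmetric.\<close>
  have "inv_sign g (f ` X) = (\<Prod>(u, v)\<in>lt_pairs (f ` X). if (u < v) = (g u < g v) then 1 else -1)"
    unfolding inv_sign_def by (rule prod.cong) (auto simp: lt_pairs_def)
  also have "\<dots> = (\<Prod>(x, y)\<in>lt_pairs X. if (f x < f y) = (g (f x) < g (f y)) then 1 else -1)"
  proof (rule prod_lt_pairs_reindex[OF assms(1)])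
    fix u v assume "u \<in> f ` X" "v \<in> f ` X"
    then have "g u = g v \<longleftrightarrow> u = v" using assms(2) by (auto simp: inj_on_def)
    then show "(if (u < v) = (g u < g v) then 1 else -1) = (if (v < u) = (g v < g u) then 1 else - 1 :: int)"
      by (metis less_asym linorder_neqE)
  qed
  finally show ?thesis .
qed

text \<open>A pair is inverted by the composition exactly when it is inverted by one of the two maps
  and not by the other.\<close>

lemma inv_sign_comp:
  assumes "inj_on f X" "inj_on g (f ` X)"
  shows "inv_sign (\<lambda>x. g (f x)) X = inv_sign f X * inv_sign g (f ` X)"
  unfolding inv_sign_reindex[OF assms] inv_sign_def[of f] inv_sign_def[of "\<lambda>x. g (f x)"]
    prod.distrib[symmetric]
  by (rule prod.cong) auto

lemma inv_sign_strict_mono: "strict_mono_on X f \<Longrightarrow> inv_sign f X = 1"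
  unfolding inv_sign_def by (rule prod.neutral) (auto simp: lt_pairs_def strict_mono_on_def)

lemma prod_minus_one_if:
  "finite A \<Longrightarrow> (\<Prod>x\<in>A. if P x then -1 else 1 :: int) = (-1) ^ card {x \<in> A. P x}"
  by (simp add: prod.If_cases Int_def)

text \<open>The inverted pairs are (a, b) itself and, for every element x of X strictly between,
  both (a, x) and (x, b): an odd number.\<close>

lemma inv_sign_transpose:
  assumes "finite X" "a \<in> X" "b \<in> X" "a < b"
  shows "inv_sign (Transposition.transpose a b) X = -1"
proof -
  let ?M = "{x \<in> X. a < x \<and> x < b}"
  have "inv_sign (Transposition.transpose a b) X =
      (\<Prod>z\<in>lt_pairs X. if \<not> Transposition.transpose a b (fst z) < Transposition.transpose a b (snd z) then -1 else 1)"
    unfolding inv_sign_def by (rule prod.cong) auto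
  also have "\<dots> = (-1) ^ card {z \<in> lt_pairs X. \<not> Transposition.transpose a b (fst z) < Transposition.transpose a b (snd z)}"
    by (rule prod_minus_one_if[OF finite_lt_pairs[OF assms(1)]])
  also have "{z \<in> lt_pairs X. \<not> Transposition.transpose a b (fst z) < Transposition.transpose a b (snd z)} =
      insert (a, b) (Pair a ` ?M \<union> (\<lambda>x. (x, b)) ` ?M)" (is "?L = ?R")
  proof (intro equalityI subsetI)
    fix z assume "z \<in> ?L"
    then show "z \<in> ?R" using assms
      by (cases z) (auto simp: lt_pairs_def Transposition.transpose_def split: if_splits)
  next
    fix z assume "z \<in> ?R"
    then show "z \<in> ?L" using assms
      by (cases z) (auto simp: lt_pairs_def Transposition.transpose_def split: if_splits)
  qed
  also have "card \<dots> = Suc (card ?M + card ?M)"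
    using assms by (subst card_insert_disjoint; (subst card_Un_disjoint)?)
      (auto simp: card_image inj_on_def)
  finally show ?thesis by simp
qed

lemma sign_eq_inv_sign:
  fixes p :: "'a::linorder \<Rightarrow> 'a"
  assumes "finite X" "p permutes X"
  shows "sign p = inv_sign p X"
  using assms
proof (induction rule: permutes_rev_induct)
  case id
  have "inv_sign id X = 1" by (rule inv_sign_strict_mono) (simp add: strict_mono_on_def)
  then show ?case by (simp only: sign_id)
next
  case (swap a b p)
  have t: "Transposition.transpose a b permutes X" using swap by (simp add: permutes_swap_id)
  have "permutation p" using swap assms permutation_permutes by blast
  then have "sign (p \<circ> Transposition.transpose a b) = - sign p"
    using swap by (simp add: sign_compose permutation_swap_id sign_swap_id)
  moreover have "inv_sign (Transposition.transpose a b) X = -1"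
    using swap inv_sign_transpose[OF assms(1), of a b] inv_sign_transpose[OF assms(1), of b a]
    by (metis neqE Transposition.transpose_commute)
  moreover have "inv_sign (\<lambda>x. p (Transposition.transpose a b x)) X = inv_sign (Transposition.transpose a b) X * inv_sign p (Transposition.transpose a b ` X)"
    by (rule inv_sign_comp) (use swap in \<open>auto intro: inj_on_subset[OF permutes_inj]\<close>)
  ultimately show ?case using swap permutes_image[OF t] by (simp add: comp_def)
qed

text \<open>Compare two pairs by position. Disjoint pairs contribute 1 and nested pairs -1,
  whichever representatives the section takes. Crossing pairs contribute 1 if the section takes both
  left ends or both right ends, and -1 otherwise. So in the product for T and T' only a crossing
  pair of pairs matters, and it gives -1 when exactly one of the two pairs has its representative
  changed.\<close>

lemma inv_sign_sections:
  fixes p :: "'a::linorder \<Rightarrow> 'a"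
  assumes X: "finite X" and p: "ff_involution X p" and T: "is_section X p T" "is_section X p T'"
  shows "inv_sign p T * inv_sign p T' = (-1) ^ card {(a, b). a \<in> X \<and> b \<in> X \<and> a < b \<and> b < p a \<and>
           p a < p b \<and> ((a \<in> T) = (a \<in> T')) \<noteq> ((b \<in> T) = (b \<in> T'))}"
proof -
  note P = ff_involutionD[OF p]
  define A where "A = {i \<in> X. i < p i}"
  have inj: "p i = p j \<longleftrightarrow> i = j" if "i \<in> X" "j \<in> X" for i j using P that by metis
  have key: "inv_sign p S = (\<Prod>(a, b)\<in>lt_pairs A.
      let x = (if a \<in> S then a else p a); y = (if b \<in> S then b else p b)
      in if (x < y) = (p x < p y) then 1 else -1)" if S: "is_section X p S" for S
  proof -
    \<comment> \<open>Each pair is indexed by its left end in \<open>A\<close>; \<open>f\<close>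
      moves this index to the representative chosen by S.\<close>
    define f where "f = (\<lambda>i. if i \<in> S then i else p i)"
    have SX: "S \<subseteq> X" using S by (simp add: is_section_def)
    have "f ` A = S"
    proof
      show "f ` A \<subseteq> S" using is_sectionD[OF S] by (auto simp: f_def A_def)
      show "S \<subseteq> f ` A"
      proof
        fix i assume i: "i \<in> S"
        then have iX: "i \<in> X" using SX by blast
        show "i \<in> f ` A"
        proof (cases "i < p i")
          case True
          then show ?thesis using i iX by (auto simp: f_def A_def image_iff intro!: bexI[of _ i])
        next
          case False
          then have "p i \<in> A" using P[OF iX] by (auto simp: A_def)
          moreover have "f (p i) = i" using P[OF iX] is_sectionD[OF S iX] i by (simp add: f_def)
          ultimately show ?thesis by (metis image_eqI)
        qed
      qed
    qed
    moreover have "inj_on f A"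
    proof (rule inj_onI)
      fix i j assume ij: "i \<in> A" "j \<in> A" "f i = f j"
      then have "i = j \<or> i = p j \<or> p i = j \<or> p i = p j" by (auto simp: f_def split: if_splits)
      then show "i = j" using ij P inj by (auto simp: A_def)
    qed
    moreover have "inj_on p S" using inj SX by (auto simp: inj_on_def)
    ultimately show ?thesis using inv_sign_reindex[of f A p] by (simp add: f_def Let_def)
  qed
  have "inv_sign p T * inv_sign p T' = (\<Prod>z\<in>lt_pairs A.
      if snd z < p (fst z) \<and> p (fst z) < p (snd z) \<and>
         ((fst z \<in> T) = (fst z \<in> T')) \<noteq> ((snd z \<in> T) = (snd z \<in> T')) then -1 else 1)"
    unfolding key[OF T(1)] key[OF T(2)] prod.distrib[symmetric]
  proof (rule prod.cong[OF refl])
    fix z assume "z \<in> lt_pairs A"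
    then obtain a b where z: "z = (a, b)" "a \<in> X" "b \<in> X" "a < p a" "b < p b" "a < b"
      by (auto simp: lt_pairs_def A_def)
    have "p a \<noteq> p b" "p a \<noteq> b" "p (p a) = a" "p (p b) = b" using z P inj by force+
    then show "(case z of (a, b) \<Rightarrow> let x = if a \<in> T then a else p a; y = if b \<in> T then b else p b
                 in if (x < y) = (p x < p y) then 1 else - 1) *
          (case z of (a, b) \<Rightarrow> let x = if a \<in> T' then a else p a; y = if b \<in> T' then b else p b
                 in if (x < y) = (p x < p y) then 1 else - 1) =
          (if snd z < p (fst z) \<and> p (fst z) < p (snd z) \<and>
             ((fst z \<in> T) = (fst z \<in> T')) \<noteq> ((snd z \<in> T) = (snd z \<in> T')) then - 1 else 1 :: int)"
      using z by (cases "a \<in> T"; cases "a \<in> T'"; cases "b \<in> T"; cases "b \<in> T'") (auto simp: Let_def)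
  qed
  also have "\<dots> = (-1) ^ card {z \<in> lt_pairs A. snd z < p (fst z) \<and> p (fst z) < p (snd z) \<and>
         ((fst z \<in> T) = (fst z \<in> T')) \<noteq> ((snd z \<in> T) = (snd z \<in> T'))}"
    by (rule prod_minus_one_if) (use X in \<open>auto intro: finite_lt_pairs simp: A_def\<close>)
  also have "{z \<in> lt_pairs A. snd z < p (fst z) \<and> p (fst z) < p (snd z) \<and>
         ((fst z \<in> T) = (fst z \<in> T')) \<noteq> ((snd z \<in> T) = (snd z \<in> T'))} =
      {(a, b). a \<in> X \<and> b \<in> X \<and> a < b \<and> b < p a \<and> p a < p b \<and> ((a \<in> T) = (a \<in> T')) \<noteq> ((b \<in> T) = (b \<in> T'))}"
    by (auto simp: lt_pairs_def A_def)
  finally show ?thesis .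
qed

text \<open>The labels strictly between j and its partner are paired among themselves, as a pair
  leaving the interval would cross; hence their number is even.\<close>

lemma planar_pairing_odd_even:
  assumes "planar_pairing n p" "i \<in> {1..2*n}"
  shows "odd (p i) \<longleftrightarrow> even i"
proof -
  let ?X = "{1..2*n}"
  have p: "ff_involution ?X p"
    using assms(1) by (simp add: planar_pairing_def pairings_eq_pairs_on pairs_on_ff)
  have nc: False if "a \<in> ?X" "b \<in> ?X" "a < b" "b < p a" "p a < p b" for a b
    using assms(1) that by (auto simp: planar_pairing_def)
  note P = ff_involutionD[OF p]
  have main: "odd (p j) \<longleftrightarrow> even j" if j: "j \<in> ?X" "j < p j" for j
  proof -
    have "ff_involution {j<..<p j} p"
      unfolding ff_involution_def
    proof
      fix x assume x: "x \<in> {j<..<p j}"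
      have pj: "p j \<in> ?X" "p (p j) = j" using P[OF j(1)] by auto
      have xX: "x \<in> ?X" using x j pj by auto
      note Px = P[OF xX]
      have "p x \<noteq> j" "p x \<noteq> p j" using x Px pj j P by force+
      moreover have "\<not> p x < j" using nc[of "p x" j] Px j x by auto
      moreover have "\<not> p j < p x" using nc[of j x] xX j x by auto
      ultimately show "p x \<in> {j<..<p j} \<and> p x \<noteq> x \<and> p (p x) = x" using Px by auto
    qed
    then have "even (card {j<..<p j})" by (rule even_card_ff_involution[rotated]) simp
    then show ?thesis using j by (auto simp: even_diff_nat)
  qed
  show ?thesis
  proof (cases "i < p i")
    case True then show ?thesis using main assms by blast
  next
    case False
    then have "p i < p (p i)" using P[OF assms(2)] by auto
    then have "odd (p (p i)) \<longleftrightarrow> even (p i)" using main[OF P(1)[OF assms(2)]] by blast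
    then show ?thesis using P[OF assms(2)] by auto
  qed
qed

text \<open>The permutation in \<open>sign_OE\<close> is p, preceded by i to 2i - 1 and followed by
  halving. Halving is increasing on the partners of the odd labels because planarity makes these
  even, so both outer maps have inversion sign 1.\<close>

lemma sign_OE_eq_inv_sign:
  assumes "planar_pairing n p"
  shows "sign_OE n p = inv_sign p {i \<in> {1..2*n}. odd i}"
proof -
  let ?X = "{1..2*n}" and ?q = "\<lambda>i. if i \<in> {1..n} then p (2*i - 1) div 2 else i"
  let ?O = "{i \<in> ?X. odd i}"
  have p: "ff_involution ?X p"
    using assms(1) by (simp add: planar_pairing_def pairings_eq_pairs_on pairs_on_ff)
  note P = ff_involutionD[OF p]
  have img: "(\<lambda>i. 2 * i - 1) ` {1..n} = ?O"
  proof
    show "(\<lambda>i. 2 * i - 1) ` {1..n} \<subseteq> ?O" by auto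
    show "?O \<subseteq> (\<lambda>i. 2 * i - 1) ` {1..n}"
    proof
      fix j assume "j \<in> ?O"
      then obtain k where "j = 2 * k + 1" "j \<in> ?X" by (auto elim!: oddE)
      then show "j \<in> (\<lambda>i. 2 * i - 1) ` {1..n}" by (intro image_eqI[of _ _ "k + 1"]) auto
    qed
  qed
  have inj1: "inj_on (\<lambda>i::nat. 2 * i - 1) {1..n}" by (auto simp: inj_on_def)
  have injp: "inj_on p ?O" using P by (intro inj_on_inverseI[of _ p]) auto
  have even: "even (p i)" "p i \<in> ?X" if "i \<in> ?O" for i
    using that planar_pairing_odd_even[OF assms, of i] P[of i] by blast+
  have sm: "strict_mono_on (p ` ?O) (\<lambda>y. y div 2)"
  proof (rule strict_mono_onI)
    fix u v assume uv: "u \<in> p ` ?O" "v \<in> p ` ?O" "u < v"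
    then have "even u" "even v" using even by blast+
    then show "u div 2 < v div 2" using \<open>u < v\<close> by (elim evenE) simp
  qed
  have injd: "inj_on (\<lambda>y. y div 2) (p ` ?O)" using sm strict_mono_on_imp_inj_on by blast
  have comp: "inj_on (\<lambda>i. p (2 * i - 1)) {1..n}"
    using comp_inj_on[OF inj1, of p] injp img by (simp add: comp_def)
  have imgp: "(\<lambda>i. p (2 * i - 1)) ` {1..n} = p ` ?O" using img by (metis image_image)
  have comp2: "inj_on (\<lambda>i. p (2 * i - 1) div 2) {1..n}"
    using comp_inj_on[OF comp, unfolded imgp, OF injd] by (simp add: comp_def)
  have "p (2 * i - 1) div 2 \<in> {1..n}" if "i \<in> {1..n}" for i
  proof -
    have "2 * i - 1 \<in> ?O" using that by auto
    from even[OF this] show ?thesis by auto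
  qed
  then have "?q ` {1..n} \<subseteq> {1..n}" by auto
  moreover have injq: "inj_on ?q {1..n}"
    using comp2 by (rule inj_on_cong[THEN iffD1, rotated]) simp
  ultimately have "?q ` {1..n} = {1..n}" by (intro endo_inj_surj) auto
  then have "?q permutes {1..n}"
    using injq by (intro bij_imp_permutes) (auto simp: bij_betw_def)
  then have "sign_OE n p = inv_sign ?q {1..n}"
    unfolding sign_OE_def by (intro sign_eq_inv_sign) auto
  also have "\<dots> = inv_sign (\<lambda>i. (\<lambda>y. y div 2) (p (2*i - 1))) {1..n}"
    by (rule inv_sign_cong) simp
  also have "\<dots> = inv_sign (\<lambda>i. p (2*i - 1)) {1..n} * inv_sign (\<lambda>y. y div 2) ((\<lambda>i. p (2*i - 1)) ` {1..n})"
    by (rule inv_sign_comp[OF comp]) (unfold imgp, rule injd)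
  also note imgp
  also have "inv_sign (\<lambda>y. y div 2) (p ` ?O) = 1" by (rule inv_sign_strict_mono[OF sm])
  also have "inv_sign (\<lambda>i. p (2*i - 1)) {1..n} = inv_sign (\<lambda>i. 2*i - 1) {1..n} * inv_sign p ((\<lambda>i. 2*i - 1) ` {1..n})"
    by (rule inv_sign_comp[OF inj1]) (use injp img in simp)
  also have "inv_sign (\<lambda>i::nat. 2*i - 1) {1..n} = 1"
    by (rule inv_sign_strict_mono) (auto simp: strict_mono_on_def)
  finally show ?thesis using img by simp
qed

lemma black_section_iff:
  "bw_pairing n node B p \<longleftrightarrow> p \<in> pairings n \<and> is_section {1..2*n} p (black_labels n node B)"
  unfolding bw_pairing_def is_section_def black_labels_def pairings_def by blast

text \<open>The permutation in \<open>sign_BW\<close> is p between the enumeration of the black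
  labels and the ranking of the white ones; both are increasing and contribute 1.\<close>

lemma sign_BW_eq_inv_sign:
  assumes bw: "bw_pairing n node B p" and card: "card (black_labels n node B) = n"
  shows "sign_BW n node B p = inv_sign p (black_labels n node B)"
proof -
  let ?X = "{1..2*n}"
  define K where "K = black_labels n node B"
  define W where "W = white_labels n node B"
  define b where "b = (\<lambda>k. sorted_list_of_set K ! k)"
  define r where "r = (\<lambda>x. card {w \<in> W. w < x})"
  have KX: "K \<subseteq> ?X" and W: "W = ?X - K"
    by (auto simp: K_def W_def black_labels_def white_labels_def)
  have fin: "finite K" "finite W" using KX W finite_subset by auto
  have p: "ff_involution ?X p" and sec: "is_section ?X p K"
    using bw unfolding black_section_iff K_def by (simp_all add: pairings_eq_pairs_on pairs_on_ff)
  note P = ff_involutionD[OF p]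
  have pK: "p ` K = W"
  proof (intro equalityI subsetI)
    fix y assume "y \<in> p ` K"
    then show "y \<in> W" using KX P is_sectionD[OF sec] unfolding W by blast
  next
    fix y assume "y \<in> W"
    then have "y \<in> ?X" "y \<notin> K" by (auto simp: W)
    then have "p y \<in> K" "p (p y) = y" using is_sectionD[OF sec] P by blast+
    then show "y \<in> p ` K" by (metis image_eqI)
  qed
  have inj: "inj_on p K" using KX P by (intro inj_on_inverseI[of _ p]) auto
  have cK: "card K = n" using card by (simp add: K_def)
  then have cW: "card W = n" using card_image[OF inj] pK by simp
  have smb: "strict_mono_on {..<n} b"
    unfolding strict_mono_on_def b_def using cK fin
    by (auto intro!: sorted_wrt_nth_less[OF strict_sorted_list_of_set])
  have bK: "b ` {..<n} = K"
  proof -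
    have "b ` {..<n} = set (sorted_list_of_set K)"
      using cK fin unfolding b_def set_conv_nth by auto
    then show ?thesis using fin by simp
  qed
  have smr: "strict_mono_on W r"
    unfolding strict_mono_on_def r_def using fin
    by (auto intro!: psubset_card_mono)
  have rb: "r x < n" if "x \<in> W" for x
    unfolding r_def using that fin psubset_card_mono[of W "{w \<in> W. w < x}"] cW by auto
  note injb = strict_mono_on_imp_inj_on[OF smb] and injr = strict_mono_on_imp_inj_on[OF smr]
  have injpb: "inj_on (\<lambda>k. p (b k)) {..<n}"
    using comp_inj_on[OF injb, of p] inj bK by (simp add: comp_def)
  have imgpb: "(\<lambda>k. p (b k)) ` {..<n} = W" using bK pK by (metis image_image)
  have injrpb: "inj_on (\<lambda>k. r (p (b k))) {..<n}"
    using comp_inj_on[OF injpb, of r] injr imgpb by (simp add: comp_def)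
  let ?q = "\<lambda>k. if k < n then r (p (b k)) else k"
  have "?q ` {..<n} \<subseteq> {..<n}" using rb imgpb by auto
  moreover have injq: "inj_on ?q {..<n}" using injrpb by (simp add: inj_on_def)
  ultimately have "?q ` {..<n} = {..<n}" by (intro endo_inj_surj) auto
  then have "?q permutes {..<n}"
    using injq by (intro bij_imp_permutes) (auto simp: bij_betw_def)
  moreover have "sign_BW n node B p = sign ?q"
    unfolding sign_BW_def r_def b_def K_def W_def by (rule refl)
  ultimately have "sign_BW n node B p = inv_sign ?q {..<n}"
    using sign_eq_inv_sign[of "{..<n}" ?q] by simp
  also have "\<dots> = inv_sign (\<lambda>k. r (p (b k))) {..<n}"
    by (rule inv_sign_cong) simp
  also have "\<dots> = inv_sign (\<lambda>k. p (b k)) {..<n} * inv_sign r ((\<lambda>k. p (b k)) ` {..<n})"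
    by (rule inv_sign_comp[OF injpb]) (use injr imgpb in simp)
  also have "\<dots> = inv_sign b {..<n} * inv_sign p (b ` {..<n})"
    using inv_sign_comp[OF injb, of p] inj bK imgpb inv_sign_strict_mono[OF smr] by simp
  also have "\<dots> = inv_sign p K" using bK inv_sign_strict_mono[OF smb] by simp
  finally show ?thesis by (simp add: K_def)
qed

text \<open>On a common section T, the composition of the two pairings is a permutation with one
  cycle per component, and its inversion sign factors through the sections.\<close>

lemma sign_common_section:
  assumes p: "p \<in> pairings n" and q: "q \<in> pairings n"
    and T: "is_section {1..2*n} p T" "is_section {1..2*n} q T"
  shows "(-1) ^ n * (-1) ^ ncomp n p q = inv_sign q T * inv_sign p ({1..2*n} - T)"
proof -
  define X where "X = {1..2*n}"
  have inv: "ff_involution X p" "ff_involution X q"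
    using p q by (simp_all add: X_def pairings_eq_pairs_on pairs_on_ff)
  note P = ff_involutionD[OF inv(1)] and Q = ff_involutionD[OF inv(2)]
  have TX: "T \<subseteq> X" and finX: "finite X" using T by (auto simp: is_section_def X_def)
  then have finT: "finite T" using finite_subset by blast
  note Tp = is_sectionD[OF T(1), folded X_def] and Tq = is_sectionD[OF T(2), folded X_def]
  have qT: "q ` T = X - T"
  proof (intro equalityI subsetI)
    fix y assume "y \<in> q ` T" then show "y \<in> X - T" using TX Q Tq by blast
  next
    fix y assume y: "y \<in> X - T"
    then have "q y \<in> T" "q (q y) = y" using Tq Q by blast+
    then show "y \<in> q ` T" by (metis image_eqI)
  qed
  have injq: "inj_on q T" using TX Q by (intro inj_on_inverseI[of _ q]) auto
  have injp: "inj_on p (X - T)" using P by (intro inj_on_inverseI[of _ p]) auto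
  have cardT: "card T = n"
  proof -
    have "card (X - T) = card T" using card_image[OF injq] qT by simp
    moreover have "card X = card T + card (X - T)" using TX finX
      by (metis card_Diff_subset card_mono finT le_add_diff_inverse)
    ultimately show ?thesis by (simp add: X_def)
  qed
  \<comment> \<open>On T, \<open>q\<close> leads into the complement and \<open>p\<close> leads
    back: \<open>g\<close> walks around each component of the two pairings in steps of two.\<close>
  define g where "g = (\<lambda>x. if x \<in> T then p (q x) else x)"
  have gT: "g x \<in> T" if "x \<in> T" for x
    using that TX Tp[of "q x"] Tq[of x] Q[of x] by (auto simp: g_def)
  have "inj_on (\<lambda>x. p (q x)) T" using comp_inj_on[OF injq, of p] injp qT by (simp add: comp_def)
  then have "inj_on g T" by (simp add: g_def inj_on_def)
  moreover have "g ` T \<subseteq> T" using gT by blast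
  ultimately have "bij_betw g T T" using finT by (simp add: bij_betw_def endo_inj_surj)
  then have gperm: "g permutes T" by (intro bij_imp_permutes) (auto simp: g_def)
  \<comment> \<open>Each component meets T in a single cycle of \<open>g\<close>, and adding the
    \<open>q\<close>-partners recovers the component; so the cycles of \<open>g\<close> are counted
    by \<open>ncomp\<close>.\<close>
  have "bij_betw (\<lambda>F. F \<inter> T) (invariant_subsets X {p, q}) (invariant_subsets T {g})"
  proof (rule bij_betwI[where g = "\<lambda>G. G \<union> q ` G"])
    show "(\<lambda>F. F \<inter> T) \<in> invariant_subsets X {p, q} \<rightarrow> invariant_subsets T {g}"
    proof
      fix F assume F: "F \<in> invariant_subsets X {p, q}"
      have "x \<in> F \<inter> T \<longleftrightarrow> g x \<in> F \<inter> T" if x: "x \<in> T" for x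
      proof -
        have "x \<in> X" "q x \<in> X" using x TX Q by blast+
        then have "p (q x) \<in> F \<longleftrightarrow> x \<in> F"
          using invariant_subsetsD[OF F, of p "q x"] invariant_subsetsD[OF F, of q x] by auto
        then show ?thesis using x gT[OF x] by (auto simp: g_def)
      qed
      then show "F \<inter> T \<in> invariant_subsets T {g}" by (simp add: invariant_subsets_def)
    qed
    show "(\<lambda>G. G \<union> q ` G) \<in> invariant_subsets T {g} \<rightarrow> invariant_subsets X {p, q}"
    proof
      fix G assume G: "G \<in> invariant_subsets T {g}"
      then have GT: "G \<subseteq> T" by (simp add: invariant_subsets_def)
      have mem: "x \<in> G \<union> q ` G \<longleftrightarrow> (if x \<in> T then x \<in> G else q x \<in> G)" if x: "x \<in> X" for x
      proof (cases "x \<in> T")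
        case True
        then have "x \<notin> q ` G" using qT GT by blast
        then show ?thesis using True by simp
      next
        case False
        then have "x \<notin> G" using GT by blast
        moreover have "x \<in> q ` G \<longleftrightarrow> q x \<in> G"
          using Q[OF x] GT TX Q by (metis image_iff subsetD)
        ultimately show ?thesis using False by simp
      qed
      have main: "x \<in> G \<union> q ` G \<longleftrightarrow> p x \<in> G \<union> q ` G" if x: "x \<in> X" "x \<notin> T" for x
      proof -
        have px: "p x \<in> T" "p x \<in> X" using Tp[OF x(1)] P[OF x(1)] x by blast+
        have "q x \<in> T" "q (q x) = x" using Tq[OF x(1)] Q[OF x(1)] x by blast+
        then have "g (q x) = p x" by (simp add: g_def)
        then have "p x \<in> G \<longleftrightarrow> q x \<in> G"
          using invariant_subsetsD[OF G, of g "q x"] \<open>q x \<in> T\<close> by simp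
        then show ?thesis using mem[OF x(1)] mem[OF px(2)] x px by simp
      qed
      have "x \<in> G \<union> q ` G \<longleftrightarrow> p x \<in> G \<union> q ` G" if x: "x \<in> X" for x
      proof (cases "x \<in> T")
        case True
        then have "p x \<in> X" "p x \<notin> T" "p (p x) = x" using Tp[OF x] P[OF x] by blast+
        then show ?thesis using main[of "p x"] by simp
      next
        case False
        then show ?thesis using main x by simp
      qed
      moreover have "x \<in> G \<union> q ` G \<longleftrightarrow> q x \<in> G \<union> q ` G" if x: "x \<in> X" for x
        using mem[OF x] mem[OF Q(1)[OF x]] Tq[OF x] Q[OF x] by simp
      moreover have "G \<union> q ` G \<subseteq> X" using GT TX Q by blast
      ultimately show "G \<union> q ` G \<in> invariant_subsets X {p, q}"
        by (simp add: invariant_subsets_def)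
    qed
    show "F \<inter> T \<union> q ` (F \<inter> T) = F" if F: "F \<in> invariant_subsets X {p, q}" for F
    proof (intro equalityI subsetI)
      have FX: "F \<subseteq> X" using F by (simp add: invariant_subsets_def)
      fix x assume "x \<in> F \<inter> T \<union> q ` (F \<inter> T)"
      then show "x \<in> F" using invariant_subsetsD[OF F, of q] FX by blast
    next
      have FX: "F \<subseteq> X" using F by (simp add: invariant_subsets_def)
      fix x assume x: "x \<in> F"
      then have xX: "x \<in> X" using FX by blast
      then have "q x \<in> F" "q (q x) = x" using x invariant_subsetsD[OF F, of q x] Q by blast+
      then show "x \<in> F \<inter> T \<union> q ` (F \<inter> T)"
        using x Tq[OF xX] by (metis IntI UnCI image_eqI)
    qed
    show "(G \<union> q ` G) \<inter> T = G" if "G \<in> invariant_subsets T {g}" for G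
    proof -
      have "G \<subseteq> T" using that by (simp add: invariant_subsets_def)
      then show ?thesis using qT by blast
    qed
  qed
  then have "card (invariant_subsets T {g}) = 2 ^ ncomp n p q"
    using bij_betw_same_card card_invariant_subsets_pairings[OF p q] unfolding X_def by metis
  then have "sign g = (-1) ^ (n + ncomp n p q)"
    using sign_eq_invariant_subsets_parity[OF finT gperm] cardT by auto
  moreover have "sign g = inv_sign q T * inv_sign p (X - T)"
  proof -
    have "sign g = inv_sign g T" by (rule sign_eq_inv_sign[OF finT gperm])
    also have "\<dots> = inv_sign (\<lambda>x. p (q x)) T" by (rule inv_sign_cong) (simp add: g_def)
    also have "\<dots> = inv_sign q T * inv_sign p (X - T)"
      using inv_sign_comp[OF injq, of p] injp qT by simp
    finally show ?thesis .
  qed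
  ultimately show ?thesis by (simp add: X_def power_add)
qed

lemma is_section_compl:
  assumes "ff_involution X p" "is_section X p T" shows "is_section X p (X - T)"
  using assms unfolding is_section_def ff_involution_def by blast

text \<open>The factor with n and \<open>ncomp\<close> is an inversion sign of \<rho> on T times one
  of \<pi> on the complement of T. The latter cancels \<open>sign_OE\<close>, because all sections
  of a planar pairing have the same inversion sign. The former is compared with
  \<open>sign_BW\<close> by replacing T with the section of black labels, and only the crossings
  counted on the right remain.\<close>

lemma pairing_sign_identity:
  assumes \<pi>: "planar_pairing n \<pi>" and \<rho>: "bw_pairing n node B \<rho>"
    and card: "card (black_labels n node B) = n"
    and T: "is_section {1..2*n} \<pi> T" "is_section {1..2*n} \<rho> T"
  shows "(-1) ^ n * (-1) ^ ncomp n \<pi> \<rho> * sign_OE n \<pi> * sign_BW n node B \<rho> =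
    (-1) ^ card {(a, b). a \<in> {1..2*n} \<and> b \<in> {1..2*n} \<and> a < b \<and> b < \<rho> a \<and> \<rho> a < \<rho> b \<and>
      ((a \<in> T) = (a \<in> black_labels n node B)) \<noteq> ((b \<in> T) = (b \<in> black_labels n node B))}"
proof -
  let ?X = "{1..2*n}" and ?K = "black_labels n node B"
  have p: "\<pi> \<in> pairings n" and q: "\<rho> \<in> pairings n"
    using \<pi> \<rho> by (simp_all add: planar_pairing_def bw_pairing_def)
  then have inv: "ff_involution ?X \<pi>" "ff_involution ?X \<rho>"
    by (simp_all add: pairings_eq_pairs_on pairs_on_ff)
  have odd: "is_section ?X \<pi> {i \<in> ?X. odd i}"
    unfolding is_section_def using planar_pairing_odd_even[OF \<pi>] ff_involutionD(1)[OF inv(1)] by blast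
  \<comment> \<open>A planar pairing has no crossings, so the exponent from
    \<open>inv_sign_sections\<close> counts an empty set.\<close>
  have "inv_sign \<pi> (?X - T) * inv_sign \<pi> {i \<in> ?X. odd i} = (-1) ^ card ({} :: (nat \<times> nat) set)"
    unfolding inv_sign_sections[OF finite_atLeastAtMost inv(1) is_section_compl[OF inv(1) T(1)] odd]
    using \<pi> by (intro arg_cong[where f = "\<lambda>S. (-1) ^ card S"]) (auto simp: planar_pairing_def)
  then have 1: "inv_sign \<pi> (?X - T) * sign_OE n \<pi> = 1"
    by (simp add: sign_OE_eq_inv_sign[OF \<pi>])
  have sec: "is_section ?X \<rho> ?K" using \<rho> by (simp add: black_section_iff)
  have "(-1) ^ n * (-1) ^ ncomp n \<pi> \<rho> * sign_OE n \<pi> * sign_BW n node B \<rho> =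
      inv_sign \<rho> T * (inv_sign \<pi> (?X - T) * sign_OE n \<pi>) * sign_BW n node B \<rho>"
    unfolding sign_common_section[OF p q T] by simp
  also have "\<dots> = inv_sign \<rho> T * inv_sign \<rho> ?K"
    unfolding 1 sign_BW_eq_inv_sign[OF \<rho> card] by simp
  also have "\<dots> = (-1) ^ card {(a, b). a \<in> ?X \<and> b \<in> ?X \<and> a < b \<and> b < \<rho> a \<and> \<rho> a < \<rho> b \<and>
      ((a \<in> T) = (a \<in> ?K)) \<noteq> ((b \<in> T) = (b \<in> ?K))}"
    by (rule inv_sign_sections[OF finite_atLeastAtMost inv(2) T(2) sec])
  finally show ?thesis .
qed

section \<open>Connections inside the disk do not cross\<close>

text \<open>Half angles: 1 + cis d and 1 - cis d are cis (d/2) times 2 cos (d/2) and -2 \<i> sin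
  (d/2). The quotient is thus -cot (d/2), the position on the real line of a circle point under the
  Cayley transform.\<close>

lemma cayley_cis:
  assumes "sin (d / 2) \<noteq> 0"
  shows "\<i> * (1 + cis d) / (1 - cis d) = complex_of_real (- cos (d / 2) / sin (d / 2))"
proof -
  define x where "x = d / 2"
  have s: "sin x \<noteq> 0" using assms by (simp add: x_def)
  have d: "cis d = cis x * cis x" by (simp add: x_def cis_mult)
  have sq: "(cos x)\<^sup>2 = 1 - (sin x)\<^sup>2" by (rule cos_squared_eq)
  have 1: "1 + cis d = 2 * complex_of_real (cos x) * cis x"
    unfolding d using sq by (simp add: complex_eq_iff power2_eq_square algebra_simps)
  have 2: "1 - cis d = -2 * \<i> * complex_of_real (sin x) * cis x"
    unfolding d using sq by (simp add: complex_eq_iff power2_eq_square algebra_simps)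
  have "\<i> * (1 + cis d) = complex_of_real (- cos x / sin x) * (1 - cis d)"
    unfolding 1 2 using s by (simp add: field_simps)
  moreover have "1 - cis d \<noteq> 0" unfolding 2 using s by simp
  ultimately show ?thesis unfolding x_def[symmetric] by (metis nonzero_mult_div_cancel_right)
qed

lemma neg_cot_strict_mono:
  fixes x y :: real
  assumes "- pi < x" "x < y" "y < 0"
  shows "- cos x / sin x < - cos y / sin y"
proof -
  have "sin x < 0" "sin y < 0"
    using assms sin_gt_zero[of "-x"] sin_gt_zero[of "-y"] by auto
  moreover have "0 < sin (y - x)" using assms by (intro sin_gt_zero) auto
  ultimately show ?thesis by (simp add: field_simps sin_diff)
qed

text \<open>Both paths avoid the boundary point \<open>cis \<phi>\<close>. The Cayley transform with
  its pole there sends the rest of the closed disk to the closed upper half-plane and the four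
  endpoints to the real line in their given order. There the paths lie in a rectangle with
  interlaced endpoints on its bottom side, and \<open>fashoda_interlace\<close> makes them
  meet.\<close>

lemma interleaved_paths_in_disk_meet:
  fixes f g :: "real \<Rightarrow> complex"
  assumes path: "path f" "path g"
    and disk: "path_image f \<subseteq> cball 0 1 - {cis \<phi>}" "path_image g \<subseteq> cball 0 1 - {cis \<phi>}"
    and ends: "pathstart f = cis a" "pathstart g = cis b" "pathfinish f = cis c" "pathfinish g = cis d"
    and order: "\<phi> - 2 * pi < a" "a < b" "b < c" "c < d" "d < \<phi>"
  shows "path_image f \<inter> path_image g \<noteq> {}"
proof -
  define \<omega> where "\<omega> = cis \<phi>"
  define T where "T = (\<lambda>w. \<i> * (\<omega> + w) / (\<omega> - w))"
  define F :: "complex \<Rightarrow> real^2" where "F = (\<lambda>w. \<chi> k. if k = 1 then Re (T w) else Im (T w))"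
  define t where "t = (\<lambda>\<theta>. - cos ((\<theta> - \<phi>) / 2) / sin ((\<theta> - \<phi>) / 2))"
  have F12: "F w $ 1 = Re (T w)" "F w $ 2 = Im (T w)" for w by (simp_all add: F_def)
  have contT: "continuous_on (- {\<omega>}) T"
    unfolding T_def by (auto intro!: continuous_intros)
  have "continuous_on (- {\<omega>}) F"
    unfolding F_def
  proof (rule continuous_on_vec_lambda)
    fix k :: 2
    show "continuous_on (- {\<omega>}) (\<lambda>w. if k = 1 then Re (T w) else Im (T w))"
      using contT by (cases "k = 1") (auto intro!: continuous_intros)
  qed
  then have cont: "continuous_on (path_image f) F" "continuous_on (path_image g) F"
    using disk by (auto simp: \<omega>_def elim!: continuous_on_subset)
  \<comment> \<open>Clearing the denominator by its conjugate, Im (T w) is the difference of the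
    squared moduli of \<omega> and w, divided by the squared modulus of \<omega> - w.\<close>
  have Im_nonneg: "0 \<le> Im (T w)" if "w \<in> cball 0 1 - {\<omega>}" for w
  proof -
    have "cnj (\<omega> - w) \<noteq> 0" using that by auto
    then have "T w = \<i> * (\<omega> + w) * cnj (\<omega> - w) / (complex_of_real ((cmod (\<omega> - w))\<^sup>2))"
      unfolding T_def complex_norm_square by (rule nonzero_mult_divide_mult_cancel_right[symmetric])
    then have "Im (T w) = Im (\<i> * (\<omega> + w) * cnj (\<omega> - w)) / (cmod (\<omega> - w))\<^sup>2"
      by (simp only: Im_divide_of_real)
    also have "Im (\<i> * (\<omega> + w) * cnj (\<omega> - w)) = (cmod \<omega>)\<^sup>2 - (cmod w)\<^sup>2"
      unfolding cmod_power2 by (simp add: power2_eq_square algebra_simps)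
    finally have "Im (T w) = ((cmod \<omega>)\<^sup>2 - (cmod w)\<^sup>2) / (cmod (\<omega> - w))\<^sup>2" .
    moreover have "(cmod \<omega>)\<^sup>2 - (cmod w)\<^sup>2 \<ge> 0"
      using that by (simp add: \<omega>_def power_le_one)
    ultimately show ?thesis by simp
  qed
  have Tcis: "T (cis \<theta>) = complex_of_real (t \<theta>)" if "\<phi> - 2 * pi < \<theta>" "\<theta> < \<phi>" for \<theta>
  proof -
    have "sin ((\<theta> - \<phi>) / 2) \<noteq> 0"
    proof -
      have "0 < - ((\<theta> - \<phi>) / 2)" "- ((\<theta> - \<phi>) / 2) < pi"
        using that by (simp_all add: field_simps)
      then have "0 < sin (- ((\<theta> - \<phi>) / 2))" by (rule sin_gt_zero)
      then show ?thesis unfolding sin_minus by linarith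
    qed
    moreover have "T (cis \<theta>) = \<i> * (1 + cis (\<theta> - \<phi>)) / (1 - cis (\<theta> - \<phi>))"
    proof -
      have "cis \<theta> = \<omega> * cis (\<theta> - \<phi>)" by (simp add: \<omega>_def cis_mult)
      then have "T (cis \<theta>) = \<omega> * (\<i> * (1 + cis (\<theta> - \<phi>))) / (\<omega> * (1 - cis (\<theta> - \<phi>)))"
        by (simp add: T_def algebra_simps)
      then show ?thesis by (simp add: \<omega>_def)
    qed
    ultimately show ?thesis using cayley_cis[of "\<theta> - \<phi>"] by (simp add: t_def)
  qed
  have tmono: "t x < t y" if "\<phi> - 2 * pi < x" "x < y" "y < \<phi>" for x y
    unfolding t_def using that by (intro neg_cot_strict_mono) auto
  have "compact (F ` (path_image f \<union> path_image g))"
    using cont path by (intro compact_continuous_image continuous_on_closed_Un compact_Un)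
      (auto intro: compact_path_image closed_path_image)
  then obtain R where R: "\<forall>z \<in> F ` (path_image f \<union> path_image g). norm z \<le> R"
    using compact_imp_bounded bounded_iff by blast
  \<comment> \<open>The bottom side lies on the real line and carries the four endpoints; R bounds
    the compact images of both paths.\<close>
  define lo hi :: "real^2" where "lo = (\<chi> k. if k = 1 then - R else 0)" and "hi = (\<chi> k. R)"
  have box: "F w \<in> cbox lo hi" if "w \<in> path_image f \<union> path_image g" for w
  proof -
    have "\<bar>F w $ k\<bar> \<le> R" for k
      using bspec[OF R imageI[OF that]] component_le_norm_cart[of "F w" k] by linarith
    moreover have "w \<in> cball 0 1 - {\<omega>}" using that disk by (auto simp: \<omega>_def)
    ultimately have "\<bar>Re (T w)\<bar> \<le> R" "\<bar>Im (T w)\<bar> \<le> R" "0 \<le> Im (T w)"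
      using Im_nonneg by (metis F12(1), metis F12(2), blast)
    then show ?thesis by (auto simp: mem_box_cart forall_2 lo_def hi_def F12)
  qed
  have st: "pathstart (F \<circ> f) = F (cis a)" "pathfinish (F \<circ> f) = F (cis c)"
    "pathstart (F \<circ> g) = F (cis b)" "pathfinish (F \<circ> g) = F (cis d)"
    using ends by (simp_all add: pathstart_compose pathfinish_compose)
  obtain z where z: "z \<in> path_image (F \<circ> f)" "z \<in> path_image (F \<circ> g)"
  proof (rule fashoda_interlace[of "F \<circ> f" "F \<circ> g" lo hi])
    show "path (F \<circ> f)" "path (F \<circ> g)"
      using path cont by (auto intro: path_continuous_image)
    show "path_image (F \<circ> f) \<subseteq> cbox lo hi" "path_image (F \<circ> g) \<subseteq> cbox lo hi"
      using box by (auto simp: path_image_compose)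
  qed (use order tmono in \<open>simp_all add: st F12 Tcis lo_def\<close>)
  then obtain u v where uv: "u \<in> path_image f" "v \<in> path_image g" "F u = F v"
    by (auto simp: path_image_compose)
  \<comment> \<open>A common image point comes from one point of the disk, since T is injective away
    from its pole.\<close>
  then have "T u = T v" using F12 by (metis complex_eqI)
  moreover have ne: "\<omega> - u \<noteq> 0" "\<omega> - v \<noteq> 0" using uv disk by (auto simp: \<omega>_def)
  ultimately have "(\<omega> + u) * (\<omega> - v) = (\<omega> + v) * (\<omega> - u)"
    by (simp add: T_def field_simps)
  then have "\<omega> * u = \<omega> * v" by (simp add: algebra_simps)
  then have "u = v" by (simp add: \<omega>_def)
  then show ?thesis using uv by blast
qed

definition edge_rel :: "('v \<times> 'v) set \<Rightarrow> ('v \<times> 'v) set" where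
  "edge_rel D = {(a, b). (a, b) \<in> D \<or> (b, a) \<in> D}"

lemma sym_edge_rel: "sym (edge_rel D)"
  by (auto simp: sym_def edge_rel_def)

text \<open>If nodes i and j lay in different components, the drawings of these components would be
  disjoint; but one contains a path from i to k and the other a path from j to l, and these must
  meet.\<close>

lemma circular_planar_noncrossing:
  assumes cp: "circular_planar V E n node pos \<gamma>" and EV: "E \<subseteq> V \<times> V"
    and nodeV: "node ` {1..2*n} \<subseteq> V" and DE: "D \<subseteq> E"
    and lab: "i \<in> {1..2*n}" "j \<in> {1..2*n}" "k \<in> {1..2*n}" "l \<in> {1..2*n}"
    and order: "i < j" "j < k" "k < l"
    and ik: "(node i, node k) \<in> (edge_rel D)\<^sup>*" and jl: "(node j, node l) \<in> (edge_rel D)\<^sup>*"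
  shows "(node i, node j) \<in> (edge_rel D)\<^sup>*"
proof (rule ccontr)
  assume ij: "(node i, node j) \<notin> (edge_rel D)\<^sup>*"
  let ?X = "{1..2*n}" and ?R = "(edge_rel D)\<^sup>*"
  have injpos: "inj_on pos V" using cp by (simp add: circular_planar_def)
  have inner: "pos v \<in> ball 0 1" if "v \<in> V - node ` ?X" for v
    using cp that by (simp add: circular_planar_def)
  obtain \<theta> :: "nat \<Rightarrow> real" where \<theta>: "strict_mono_on ?X \<theta>"
    "\<And>i. i \<in> ?X \<Longrightarrow> 0 \<le> \<theta> i \<and> \<theta> i < 2 * pi \<and> pos (node i) = cis (\<theta> i)"
    using cp[unfolded circular_planar_def, THEN conjunct2, THEN conjunct2, THEN conjunct1] by metis
  have edge: "path (\<gamma> e)" "pathstart (\<gamma> e) = pos (fst e)" "pathfinish (\<gamma> e) = pos (snd e)"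
    "path_image (\<gamma> e) - {pos (fst e), pos (snd e)} \<subseteq> ball 0 1 - pos ` V" if "e \<in> E" for e
    using cp that by (auto simp: circular_planar_def arc_imp_path)
  have cross: "path_image (\<gamma> e) \<inter> path_image (\<gamma> e') \<subseteq> {pos (fst e), pos (snd e)} \<inter> {pos (fst e'), pos (snd e')}"
    if "e \<in> E" "e' \<in> E" "e \<noteq> e'" for e e'
    using cp that by (auto simp: circular_planar_def)
  \<comment> \<open>The drawing of a component. Looking at \<open>fst e\<close> is enough there,
    because an edge of D has both ends in the component or none.\<close>
  define K where "K = (\<lambda>C. pos ` C \<union> (\<Union>e\<in>{e \<in> D. fst e \<in> C}. path_image (\<gamma> e)))"
  have Dstep: "(fst e, snd e) \<in> edge_rel D" "(snd e, fst e) \<in> edge_rel D" if "e \<in> D" for e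
    using that by (cases e; simp add: edge_rel_def)+
  have symR: "(x, y) \<in> ?R \<longleftrightarrow> (y, x) \<in> ?R" for x y
    using sym_rtrancl[OF sym_edge_rel] by (meson symD)
  have ends: "fst e \<in> ?R `` {u} \<longleftrightarrow> snd e \<in> ?R `` {u}" if "e \<in> D" for e u
    using Dstep[OF that] by (auto intro: rtrancl_into_rtrancl)
  have CV: "?R `` {u} \<subseteq> V" if "u \<in> V" for u
  proof
    fix v assume "v \<in> ?R `` {u}"
    then have "(u, v) \<in> ?R" by simp
    then show "v \<in> V" using that by (rule rtrancl_closed) (use EV DE in \<open>auto simp: edge_rel_def\<close>)
  qed
  have ex_path: "\<exists>g. path g \<and> pathstart g = pos u \<and> pathfinish g = pos v \<and> path_image g \<subseteq> K (?R `` {u})"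
    if "(u, v) \<in> ?R" for u v
    using that
  proof (induction rule: rtrancl_induct)
    case base
    show ?case
    proof (intro exI conjI)
      show "path (linepath (pos u) (pos u))" by (rule path_linepath)
      show "path_image (linepath (pos u) (pos u)) \<subseteq> K (?R `` {u})" by (auto simp: K_def)
    qed (rule pathstart_linepath pathfinish_linepath)+
  next
    case (step y z)
    then obtain g where g: "path g" "pathstart g = pos u" "pathfinish g = pos y"
      "path_image g \<subseteq> K (?R `` {u})" by blast
    obtain e where e: "e \<in> D" "e = (y, z) \<or> e = (z, y)" using step by (auto simp: edge_rel_def)
    have eE: "e \<in> E" using e DE by blast
    have "fst e \<in> ?R `` {u}" using e ends[OF e(1), of u] step by auto
    then have sub: "path_image (\<gamma> e) \<subseteq> K (?R `` {u})" using e(1) by (auto simp: K_def)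
    define h where "h = (if e = (y, z) then \<gamma> e else reversepath (\<gamma> e))"
    have h: "path h" "pathstart h = pos y" "pathfinish h = pos z" "path_image h = path_image (\<gamma> e)"
      using edge[OF eE] e by (auto simp: h_def)
    show ?case
      using g h sub by (intro exI[of _ "g +++ h"]) (auto simp: path_image_join)
  qed
  have K_disk: "x \<in> ball 0 1 \<or> (\<exists>m\<in>?X. x = cis (\<theta> m))" if "x \<in> K (?R `` {u})" "u \<in> V" for x u
  proof -
    have pv: "pos v \<in> ball 0 1 \<or> (\<exists>m\<in>?X. pos v = cis (\<theta> m))" if "v \<in> V" for v
      using inner[of v] that \<theta>(2) by blast
    from that(1) consider v where "v \<in> ?R `` {u}" "x = pos v"
      | e where "e \<in> D" "x \<in> path_image (\<gamma> e)" unfolding K_def by blast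
    then show ?thesis
    proof cases
      case 1 then show ?thesis using pv CV[OF that(2)] by blast
    next
      case 2
      have "e \<in> E" "fst e \<in> V" "snd e \<in> V" using 2 DE EV by auto
      then show ?thesis using edge(4)[of e] 2 pv by blast
    qed
  qed
  \<comment> \<open>Arcs meet each other only at common endpoints and pass through no other vertex,
    so a common point would yield a common vertex.\<close>
  have K_disjoint: "K (?R `` {node i}) \<inter> K (?R `` {node j}) = {}"
  proof -
    let ?C = "?R `` {node i}" and ?C' = "?R `` {node j}"
    have V: "?C \<subseteq> V" "?C' \<subseteq> V" using CV lab nodeV by blast+
    have disj: "v \<in> ?C \<Longrightarrow> v \<in> ?C' \<Longrightarrow> False" for v
      using ij symR by (metis Image_singleton_iff rtrancl_trans)
    have inj: "pos v = pos w \<Longrightarrow> v \<in> V \<Longrightarrow> w \<in> V \<Longrightarrow> v = w" for v w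
      using injpos by (rule inj_onD)
    have on_edge: "v = fst e \<or> v = snd e" if "pos v \<in> path_image (\<gamma> e)" "v \<in> V" "e \<in> D" for v e
    proof -
      have "e \<in> E" "fst e \<in> V" "snd e \<in> V" using that DE EV by auto
      then show ?thesis using edge(4)[of e] that inj by blast
    qed
    show ?thesis
    proof (rule ccontr)
      assume "K ?C \<inter> K ?C' \<noteq> {}"
      then obtain x where x: "x \<in> K ?C" "x \<in> K ?C'" by blast
      from x(1) consider v where "v \<in> ?C" "x = pos v" | e where "e \<in> D" "fst e \<in> ?C" "x \<in> path_image (\<gamma> e)"
        unfolding K_def by blast
      then show False
      proof cases
        case v: 1
        from x(2) consider w where "w \<in> ?C'" "x = pos w" | e where "e \<in> D" "fst e \<in> ?C'" "x \<in> path_image (\<gamma> e)"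
          unfolding K_def by blast
        then show False
        proof cases
          case 1
          then have "v = w" using v inj[of v w] V by (metis subsetD)
          then show False using v(1) 1(1) disj by blast
        next
          case 2
          then have "v = fst e \<or> v = snd e" using on_edge[of v e] v V by blast
          then show False using ends[OF 2(1)] 2 v disj by blast
        qed
      next
        case e: 2
        from x(2) consider w where "w \<in> ?C'" "x = pos w" | e where "e \<in> D" "fst e \<in> ?C'" "x \<in> path_image (\<gamma> e)"
          unfolding K_def by blast
        then show False
        proof cases
          case 1
          then have "w = fst e \<or> w = snd e" using on_edge[of w e] e V by blast
          then show False using ends[OF e(1)] 1 e disj by blast
        next
          case e': (2 e')
          have ee: "e \<noteq> e'" "e \<in> E" "e' \<in> E" using e e' disj DE by auto
          then obtain v w where "v \<in> {fst e, snd e}" "w \<in> {fst e', snd e'}" "x = pos v" "x = pos w"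
            using cross[OF ee(2,3,1)] e e' by blast
          moreover have "v \<in> ?C" "w \<in> ?C'" using ends[OF e(1)] ends[OF e'(1)] e e' calculation by blast+
          moreover from calculation have "v = w" using inj[of v w] V by (metis subsetD)
          ultimately show False using disj by blast
        qed
      qed
    qed
  qed
  obtain f where f: "path f" "pathstart f = pos (node i)" "pathfinish f = pos (node k)"
    "path_image f \<subseteq> K (?R `` {node i})" using ex_path[OF ik] by blast
  obtain g where g: "path g" "pathstart g = pos (node j)" "pathfinish g = pos (node l)"
    "path_image g \<subseteq> K (?R `` {node j})" using ex_path[OF jl] by blast
  \<comment> \<open>Halfway between the last node and the angle 2 pi. The drawings reach the circle
    only at nodes, so they avoid this point, and all node angles lie between \<phi> - 2 pi and
    \<phi>.\<close>
  define \<phi> where "\<phi> = (\<theta> (2*n) + 2 * pi) / 2"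
  have top: "2 * n \<in> ?X" using lab by auto
  have \<theta>_le: "\<theta> m \<le> \<theta> (2*n)" if "m \<in> ?X" for m
    using strict_mono_onD[OF \<theta>(1) that top] that by (cases "m = 2*n") auto
  have \<theta>\<phi>: "0 \<le> \<theta> m" "\<theta> m < \<phi>" "\<phi> < 2 * pi" if "m \<in> ?X" for m
    using \<theta>(2)[OF that] \<theta>_le[OF that] \<theta>(2)[OF top] by (auto simp: \<phi>_def)
  have sub: "K (?R `` {u}) \<subseteq> cball 0 1 - {cis \<phi>}" if uV: "u \<in> V" for u
  proof
    fix x assume x: "x \<in> K (?R `` {u})"
    have "x \<noteq> cis \<phi>"
    proof
      assume eq: "x = cis \<phi>"
      then obtain m where m: "m \<in> ?X" "cis \<phi> = cis (\<theta> m)"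
        using K_disk[OF x uV] by auto
      define y where "y = (\<phi> - \<theta> m) / 2"
      have "cos \<phi> = cos (\<theta> m)" "sin \<phi> = sin (\<theta> m)" using m(2) by (auto simp: complex_eq_iff)
      then have "cos (\<phi> - \<theta> m) = 1" by (simp add: cos_diff flip: power2_eq_square)
      moreover have "\<phi> - \<theta> m = 2 * y" by (simp add: y_def)
      ultimately have "cos (2 * y) = 1" by (simp only:)
      then have "sin y = 0" by (simp add: cos_double_sin)
      moreover have "0 < sin y" by (rule sin_gt_zero) (use \<theta>\<phi>[OF m(1)] in \<open>simp_all add: y_def\<close>)
      ultimately show False by simp
    qed
    then show "x \<in> cball 0 1 - {cis \<phi>}" using K_disk[OF x uV] by auto
  qed
  have "path_image f \<inter> path_image g \<noteq> {}"
  proof (rule interleaved_paths_in_disk_meet)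
    show "path f" "path g" by fact+
    show "path_image f \<subseteq> cball 0 1 - {cis \<phi>}" "path_image g \<subseteq> cball 0 1 - {cis \<phi>}"
      using f(4) g(4) sub lab nodeV by blast+
    show "pathstart f = cis (\<theta> i)" "pathstart g = cis (\<theta> j)" "pathfinish f = cis (\<theta> k)" "pathfinish g = cis (\<theta> l)"
      using f g \<theta>(2) lab by auto
    show "\<theta> i < \<theta> j" "\<theta> j < \<theta> k" "\<theta> k < \<theta> l"
      using strict_mono_onD[OF \<theta>(1)] lab order by blast+
    show "\<phi> - 2 * pi < \<theta> i" "\<theta> l < \<phi>" using \<theta>\<phi>[OF lab(1)] \<theta>\<phi>[OF lab(4)] by auto
  qed
  then show False using f(4) g(4) K_disjoint by blast
qed

section \<open>Superpositions of two matchings\<close>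

text \<open>A path has only one end besides x. Put g = b a. As \<open>a\<close> fixes x, it acts on
  the orbit of x as a reflection, so the whole component consists of the points g^k x with k modulo
  the period d. Such a point is fixed by \<open>a\<close> or by \<open>b\<close> only if d divides
  2k or 2k - 1; for 0 < k < d this leaves a single value of k.\<close>

lemma involution_pair_orbit_end_unique:
  fixes a b :: "'a \<Rightarrow> 'a"
  assumes V: "finite V" "\<And>v. v \<in> V \<Longrightarrow> a v \<in> V" "\<And>v. v \<in> V \<Longrightarrow> b v \<in> V"
    and inv: "\<And>v. a (a v) = v" "\<And>v. b (b v) = v"
    and x: "x \<in> V" "a x = x"
    and R: "\<And>u v. (u, v) \<in> R \<Longrightarrow> v = a u \<or> v = b u"
    and yz: "(x, y) \<in> R\<^sup>*" "(x, z) \<in> R\<^sup>*" "y \<noteq> x" "z \<noteq> x"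
    and ends: "a y = y \<or> b y = y" "a z = z \<or> b z = z"
  shows "y = z"
proof -
  define g where "g = (\<lambda>v. b (a v))"
  define h where "h = (\<lambda>v. a (b v))"
  have gh: "g (h v) = v" "h (g v) = v" for v by (simp_all add: g_def h_def inv)
  have cancel: "(h ^^ k) ((g ^^ k) v) = v" "(g ^^ k) ((h ^^ k) v) = v" for k v
    by (induction k arbitrary: v) (simp_all add: gh funpow_swap1)
  \<comment> \<open>Conjugation by \<open>a\<close> turns \<open>g\<close> into its inverse
    \<open>h\<close>, so \<open>a\<close> sends the k-th orbit point to the one numbered -k.\<close>
  have refl: "a ((g ^^ k) x) = (h ^^ k) x" for k
  proof (induction k)
    case (Suc k)
    have "a ((g ^^ Suc k) x) = h (a ((g ^^ k) x))" by (simp add: g_def h_def)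
    then show ?case using Suc by simp
  qed (simp add: x)
  have "(g ^^ k) x \<in> V" for k by (induction k) (auto simp: g_def x V)
  then have "range (\<lambda>k. (g ^^ k) x) \<subseteq> V" by blast
  then have "\<not> inj (\<lambda>k. (g ^^ k) x)"
    using V(1) finite_subset range_inj_infinite by blast
  then obtain i j where ij: "i < j" "(g ^^ i) x = (g ^^ j) x"
    unfolding inj_def by (metis linorder_neqE_nat)
  have "(g ^^ (j - i)) x = x"
  proof -
    have "(g ^^ j) x = (g ^^ i) ((g ^^ (j - i)) x)" using ij(1) funpow_add[of i "j - i" g] by simp
    then show ?thesis using ij(2) cancel(1) by metis
  qed
  then have ex: "\<exists>d. 0 < d \<and> (g ^^ d) x = x" using ij(1) by (intro exI[of _ "j - i"]) simp
  define d where "d = (LEAST d. 0 < d \<and> (g ^^ d) x = x)"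
  have d: "0 < d" "(g ^^ d) x = x" using LeastI_ex[OF ex] by (simp_all add: d_def)
  have d_min: "d \<le> r" if "0 < r" "(g ^^ r) x = x" for r
    unfolding d_def using that by (intro Least_le) simp
  have d_dvd: "d dvd r" if "(g ^^ r) x = x" for r
  proof -
    have "(g ^^ (r mod d)) x = x" using funpow_mod_eq[OF d(2), of r] that by simp
    then have "r mod d = 0" using d_min[of "r mod d"] mod_less_divisor[OF d(1), of r] by linarith
    then show ?thesis by (rule mod_0_imp_dvd)
  qed
  have orbit: "\<exists>k. v = (g ^^ k) x" if "(x, v) \<in> R\<^sup>*" for v
    using that
  proof (induction rule: rtrancl_induct)
    case base
    then show ?case by (intro exI[of _ 0]) simp
  next
    case (step u v)
    then obtain k where k: "u = (g ^^ k) x" by blast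
    have au: "a u = (g ^^ (d * k - k)) x"
    proof -
      have "x = (g ^^ (d * k)) x" using funpow_mod_eq[OF d(2), of "d * k"] by simp
      also have "\<dots> = (g ^^ k) ((g ^^ (d * k - k)) x)"
        using d(1) funpow_add[of k "d * k - k" g] by (simp add: algebra_simps)
      finally have "(h ^^ k) x = (g ^^ (d * k - k)) x" using cancel(1) by metis
      then show ?thesis using refl k by simp
    qed
    have "b u = g (a u)" by (simp add: g_def inv)
    then have "b u = (g ^^ Suc (d * k - k)) x" using au by simp
    then show ?case using R[OF step(2)] au by blast
  qed
  \<comment> \<open>Both 2k and 2k - 1 lie strictly between 0 and 2d, so the one divisible by d
    equals d; rounding covers both parities of d.\<close>
  have position: "v = (g ^^ ((d + 1) div 2)) x"
    if v: "(x, v) \<in> R\<^sup>*" "v \<noteq> x" "a v = v \<or> b v = v" for v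
  proof -
    obtain k' where "v = (g ^^ k') x" using orbit[OF v(1)] by blast
    then obtain k where k: "v = (g ^^ k) x" "k < d"
      using funpow_mod_eq[OF d(2), of k'] mod_less_divisor[OF d(1)] by metis
    then have "k \<noteq> 0" using v(2) by (metis funpow_0)
    from v(3) have "(g ^^ (2 * k)) x = x \<or> (g ^^ (2 * k - 1)) x = x"
    proof
      assume "a v = v"
      then have "(h ^^ k) x = (g ^^ k) x" using refl k by simp
      then have "(g ^^ k) ((g ^^ k) x) = x" using cancel(2) by metis
      then show ?thesis by (simp add: mult_2 funpow_add)
    next
      assume "b v = v"
      then have "v = g (a v)" by (simp add: g_def inv)
      also have "\<dots> = (h ^^ (k - 1)) x"
        using refl[of k] k \<open>k \<noteq> 0\<close> gh(1) by (cases k) simp_all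
      finally have "(h ^^ (k - 1)) x = (g ^^ k) x" using k by simp
      then have "(g ^^ (k - 1)) ((g ^^ k) x) = x" using cancel(2) by metis
      moreover have "2 * k - 1 = (k - 1) + k" using \<open>k \<noteq> 0\<close> by simp
      ultimately show ?thesis by (simp add: funpow_add)
    qed
    then obtain r where r: "r = 2 * k \<or> r = 2 * k - 1" "d dvd r" using d_dvd by blast
    then obtain m where m: "r = d * m" by blast
    have "0 < r" "r < d * 2" using r \<open>k \<noteq> 0\<close> k(2) by auto
    then have "m = 1" using m by (cases m) auto
    then have "k = (d + 1) div 2" using m r \<open>k \<noteq> 0\<close> by auto
    then show ?thesis using k by simp
  qed
  show ?thesis using position yz ends by metis
qed

section \<open>Mates and signed vertex counts in a bipartite graph\<close>

locale dimer_graph =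
  fixes V B :: "'v set" and E :: "('v \<times> 'v) set"
  assumes finV: "finite V" and EB: "E \<subseteq> B \<times> (V - B)" and BV: "B \<subseteq> V"
begin

lemma finE: "finite E"
  using finV EB BV by (meson finite_subset finite_SigmaI finite_Diff)

lemma edge_ends: "(u, v) \<in> E \<Longrightarrow> u \<in> B \<and> v \<notin> B \<and> u \<in> V \<and> v \<in> V"
  using EB BV by blast

lemma perfect_matching_iff:
  assumes "U \<subseteq> V"
  shows "M \<in> perfect_matchings U E \<longleftrightarrow> M \<subseteq> E \<and> (\<forall>e\<in>M. fst e \<in> U \<and> snd e \<in> U) \<and>
    (\<forall>v\<in>U. \<exists>!e. e \<in> M \<and> (fst e = v \<or> snd e = v))"
proof -
  have ex1: "card S = 1 \<longleftrightarrow> (\<exists>!e. e \<in> S)" for S :: "('v \<times> 'v) set"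
  proof
    assume "card S = 1"
    then obtain e where "S = {e}" by (rule card_1_singletonE)
    then show "\<exists>!e. e \<in> S" by simp
  next
    assume "\<exists>!e. e \<in> S"
    then obtain e where "S = {e}" by blast
    then show "card S = 1" by simp
  qed
  have card1: "card {e \<in> M. fst e = v \<or> snd e = v} = 1 \<longleftrightarrow> (\<exists>!e. e \<in> M \<and> (fst e = v \<or> snd e = v))" for v
    using ex1[of "{e \<in> M. fst e = v \<or> snd e = v}"] by (simp only: mem_Collect_eq)
  have "M \<subseteq> edges_in U E \<longleftrightarrow> M \<subseteq> E \<and> (\<forall>e\<in>M. fst e \<in> U \<and> snd e \<in> U)"
    by (auto simp: edges_in_def)
  then show ?thesis by (simp only: perfect_matchings_def mem_Collect_eq card1 conj_assoc)
qed

lemma finite_perfect_matchings: "finite (perfect_matchings U E)"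
  by (rule finite_subset[of _ "Pow E"]) (auto simp: perfect_matchings_def edges_in_def finE)

lemma perfect_matchingD:
  assumes "M \<in> perfect_matchings U E" "U \<subseteq> V"
  shows "M \<subseteq> E" "\<And>u v. (u, v) \<in> M \<Longrightarrow> u \<in> U \<and> v \<in> U"
    "\<And>v. v \<in> U \<Longrightarrow> \<exists>e. e \<in> M \<and> (fst e = v \<or> snd e = v)"
    "\<And>e e' v. e \<in> M \<Longrightarrow> e' \<in> M \<Longrightarrow> fst e = v \<or> snd e = v \<Longrightarrow> fst e' = v \<or> snd e' = v \<Longrightarrow> e = e'"
proof -
  note M = assms(1)[unfolded perfect_matching_iff[OF assms(2)]]
  show "M \<subseteq> E" using M by blast
  show "\<And>u v. (u, v) \<in> M \<Longrightarrow> u \<in> U \<and> v \<in> U" using M by force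
  show "\<And>v. v \<in> U \<Longrightarrow> \<exists>e. e \<in> M \<and> (fst e = v \<or> snd e = v)" using M by blast
  fix e e' v assume e: "e \<in> M" "e' \<in> M" "fst e = v \<or> snd e = v" "fst e' = v \<or> snd e' = v"
  then have "v \<in> U" using M by blast
  then show "e = e'" using M e by blast
qed

text \<open>An uncovered vertex is its own mate, so a matching becomes an involution on all vertices
  whose fixed points are those it misses. This is the form needed to follow alternating paths to
  their ends.\<close>

definition mate :: "('v \<times> 'v) set \<Rightarrow> 'v \<Rightarrow> 'v" where
  "mate M v = (if \<exists>w. (v, w) \<in> edge_rel M then SOME w. (v, w) \<in> edge_rel M else v)"

lemma mate_eq:
  assumes M: "M \<in> perfect_matchings U E" "U \<subseteq> V" and e: "(u, v) \<in> edge_rel M"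
  shows "mate M u = v"
proof -
  have uniq: "w = v" if w: "(u, w) \<in> edge_rel M" for w
  proof -
    obtain e e' where ee: "e \<in> M" "e' \<in> M" "e = (u, v) \<or> e = (v, u)" "e' = (u, w) \<or> e' = (w, u)"
      using e w by (auto simp: edge_rel_def)
    then have "e = e'" using perfect_matchingD(4)[OF M, of e e' u] by auto
    then show ?thesis using ee by auto
  qed
  have "(SOME w. (u, w) \<in> edge_rel M) = v" by (rule some_equality, rule e, rule uniq)
  moreover have "\<exists>w. (u, w) \<in> edge_rel M" using e by blast
  ultimately show ?thesis by (simp add: mate_def)
qed

lemma mate_rel:
  assumes M: "M \<in> perfect_matchings U E" "U \<subseteq> V" and "u \<in> U"
  shows "(u, mate M u) \<in> edge_rel M"
proof -
  obtain e where "e \<in> M" "fst e = u \<or> snd e = u" using perfect_matchingD(3)[OF M \<open>u \<in> U\<close>] by blast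
  then have ex: "\<exists>w. (u, w) \<in> edge_rel M" by (cases e) (auto simp: edge_rel_def)
  then show ?thesis using someI_ex[OF ex] by (simp add: mate_def)
qed

lemma edge_relD:
  assumes "(u, v) \<in> edge_rel D" "D \<subseteq> E"
  shows "u \<in> V" "v \<in> V" "u \<in> B \<longleftrightarrow> v \<notin> B"
  using assms edge_ends unfolding edge_rel_def by blast+

lemma mate_props:
  assumes M: "M \<in> perfect_matchings U E" "U \<subseteq> V"
  shows "mate M (mate M v) = v" "mate M v \<in> U \<longleftrightarrow> v \<in> U" "v \<in> U \<Longrightarrow> mate M v \<in> B \<longleftrightarrow> v \<notin> B"
    "mate M v = v \<longleftrightarrow> v \<notin> U"
proof -
  have out: "mate M v = v" if "v \<notin> U" for v
    using that perfect_matchingD(2)[OF M] by (auto simp: mate_def edge_rel_def)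
  have inU: "mate M v \<in> U" if "v \<in> U" for v
    using mate_rel[OF M that] perfect_matchingD(2)[OF M] by (auto simp: edge_rel_def)
  have col: "mate M v \<in> B \<longleftrightarrow> v \<notin> B" if "v \<in> U" for v
    using edge_relD(3)[OF mate_rel[OF M that] perfect_matchingD(1)[OF M]] by blast
  show "mate M (mate M v) = v"
  proof (cases "v \<in> U")
    case True
    have "(mate M v, v) \<in> edge_rel M" using mate_rel[OF M True] by (auto simp: edge_rel_def)
    then show ?thesis by (rule mate_eq[OF M])
  qed (simp add: out)
  show "mate M v \<in> U \<longleftrightarrow> v \<in> U" using out inU by metis
  show "v \<in> U \<Longrightarrow> mate M v \<in> B \<longleftrightarrow> v \<notin> B" by (rule col)
  show "mate M v = v \<longleftrightarrow> v \<notin> U" using out col by metis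
qed

text \<open>Passing to the mate stays in C and exchanges black with white.\<close>

lemma signed_count_zero:
  assumes M: "M \<in> perfect_matchings U E" "U \<subseteq> V"
    and C: "\<And>u v. (u, v) \<in> edge_rel M \<Longrightarrow> u \<in> C \<Longrightarrow> v \<in> C"
  shows "(\<Sum>v\<in>C \<inter> U. if v \<in> B then 1 else -1 :: int) = 0"
proof -
  let ?c = "\<lambda>v. if v \<in> B then 1 else -1 :: int"
  have mC: "mate M v \<in> C \<inter> U" if "v \<in> C \<inter> U" for v
    using that mate_rel[OF M, of v] C mate_props(2)[OF M] by blast
  have "sum ?c (C \<inter> U) = (\<Sum>v\<in>C \<inter> U. - ?c v)"
    by (rule sum.reindex_bij_witness[of _ "mate M" "mate M"])
      (use mC mate_props[OF M] in auto)
  also have "\<dots> = - sum ?c (C \<inter> U)" by (rule sum_negf)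
  finally show ?thesis by simp
qed

end

text \<open>Recolouring: M is replaced by M' on F. Each edge is tested at its black end, which
  decides for the whole edge as soon as no edge of the superposition leaves F. The companion with M
  and M' exchanged receives the edges given away here.\<close>

definition flip :: "'v set \<Rightarrow> ('v \<times> 'v) set \<Rightarrow> ('v \<times> 'v) set \<Rightarrow> ('v \<times> 'v) set" where
  "flip F M M' = {e \<in> M. fst e \<notin> F} \<union> {e \<in> M'. fst e \<in> F}"

lemma flip_flip: "flip F (flip F M M') (flip F M' M) = M"
  by (auto simp: flip_def)

lemma flip_Un: "flip F M M' \<union> flip F M' M = M \<union> M'"
  by (auto simp: flip_def)

lemma prod_flip:
  fixes w :: "'v \<times> 'v \<Rightarrow> 'a::comm_monoid_mult"
  assumes "finite M" "finite M'"
  shows "prod w (flip F M M') * prod w (flip F M' M) = prod w M * prod w M'"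
proof -
  have split: "prod w (flip F A A') = prod w {e \<in> A. fst e \<notin> F} * prod w {e \<in> A'. fst e \<in> F}"
    if "finite A" "finite A'" for A A'
    unfolding flip_def by (rule prod.union_disjoint) (use that in auto)
  have whole: "prod w A = prod w {e \<in> A. fst e \<notin> F} * prod w {e \<in> A. fst e \<in> F}" if "finite A" for A
  proof -
    have "prod w ({e \<in> A. fst e \<notin> F} \<union> {e \<in> A. fst e \<in> F}) = prod w {e \<in> A. fst e \<notin> F} * prod w {e \<in> A. fst e \<in> F}"
      by (rule prod.union_disjoint) (use that in auto)
    moreover have "{e \<in> A. fst e \<notin> F} \<union> {e \<in> A. fst e \<in> F} = A" by auto
    ultimately show ?thesis by simp
  qed
  show ?thesis
    unfolding split[OF assms] split[OF assms(2,1)] whole[OF assms(1)] whole[OF assms(2)]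
    by (simp add: ac_simps)
qed

text \<open>The embedding is condensed into \<open>noncross\<close>. It is asked for every set D of
  edges so that it can be applied to the superposition of any two matchings.\<close>

locale dimer_nodes = dimer_graph V B E for V B :: "'v set" and E :: "('v \<times> 'v) set" +
  fixes n :: nat and node :: "nat \<Rightarrow> 'v"
  assumes inj_node: "inj_on node {1..2*n}" and nodeV: "node ` {1..2*n} \<subseteq> V"
    and noncross: "\<And>D i j k l. D \<subseteq> E \<Longrightarrow> i \<in> {1..2*n} \<Longrightarrow> j \<in> {1..2*n} \<Longrightarrow> k \<in> {1..2*n} \<Longrightarrow> l \<in> {1..2*n} \<Longrightarrow>
      i < j \<Longrightarrow> j < k \<Longrightarrow> k < l \<Longrightarrow> (node i, node k) \<in> (edge_rel D)\<^sup>* \<Longrightarrow> (node j, node l) \<in> (edge_rel D)\<^sup>* \<Longrightarrow>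
      (node i, node j) \<in> (edge_rel D)\<^sup>*"
begin

abbreviation X :: "nat set" where "X \<equiv> {1..2*n}"

definition PM :: "nat set \<Rightarrow> ('v \<times> 'v) set set" where
  "PM A = perfect_matchings (V - node ` A) E"

lemma PM_D:
  assumes "M \<in> PM A"
  shows "M \<subseteq> E" "\<And>u v. (u, v) \<in> M \<Longrightarrow> u \<in> V - node ` A \<and> v \<in> V - node ` A"
    "\<And>v. v \<in> V - node ` A \<Longrightarrow> \<exists>e. e \<in> M \<and> (fst e = v \<or> snd e = v)"
    "\<And>e e' v. e \<in> M \<Longrightarrow> e' \<in> M \<Longrightarrow> fst e = v \<or> snd e = v \<Longrightarrow> fst e' = v \<or> snd e' = v \<Longrightarrow> e = e'"
  using perfect_matchingD[OF assms[unfolded PM_def]] by (simp, blast, simp, blast)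

lemma PM_I:
  assumes "M \<subseteq> E" "\<And>e. e \<in> M \<Longrightarrow> fst e \<in> V - node ` A \<and> snd e \<in> V - node ` A"
    "\<And>v. v \<in> V - node ` A \<Longrightarrow> \<exists>e. e \<in> M \<and> (fst e = v \<or> snd e = v)"
    "\<And>e e' v. e \<in> M \<Longrightarrow> e' \<in> M \<Longrightarrow> fst e = v \<or> snd e = v \<Longrightarrow> fst e' = v \<or> snd e' = v \<Longrightarrow> e = e'"
  shows "M \<in> PM A"
proof -
  have "\<exists>!e. e \<in> M \<and> (fst e = v \<or> snd e = v)" if v: "v \<in> V - node ` A" for v
  proof -
    obtain e where e: "e \<in> M" "fst e = v \<or> snd e = v" using assms(3)[OF v] by blast
    show ?thesis
    proof (rule ex1I)
      show "e \<in> M \<and> (fst e = v \<or> snd e = v)" using e by simp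
      show "e' = e" if "e' \<in> M \<and> (fst e' = v \<or> snd e' = v)" for e'
        using assms(4)[of e' e v] e that by simp
    qed
  qed
  then show ?thesis unfolding PM_def
    by (subst perfect_matching_iff) (use assms(1,2) in simp_all)
qed

lemma finite_PM: "finite (PM A)"
  unfolding PM_def by (rule finite_perfect_matchings)

lemma finite_matching: "M \<in> PM A \<Longrightarrow> finite M"
  using PM_D(1) finE finite_subset by blast

lemma node_eq_iff: "i \<in> X \<Longrightarrow> j \<in> X \<Longrightarrow> node i = node j \<longleftrightarrow> i = j"
  using inj_node by (rule inj_on_eq_iff)

lemma node_in_V: "i \<in> X \<Longrightarrow> node i \<in> V"
  using nodeV by blast

lemma node_in_image_iff: "i \<in> X \<Longrightarrow> A \<subseteq> X \<Longrightarrow> node i \<in> node ` A \<longleftrightarrow> i \<in> A"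
  using inj_on_image_mem_iff[OF inj_node] by blast

definition joined :: "('v \<times> 'v) set \<Rightarrow> ('v \<times> 'v) set" where
  "joined D = (edge_rel D)\<^sup>*"

lemma joined_refl: "(u, u) \<in> joined D" by (simp add: joined_def)
lemma joined_sym: "(u, v) \<in> joined D \<Longrightarrow> (v, u) \<in> joined D"
  unfolding joined_def by (rule symD[OF sym_rtrancl[OF sym_edge_rel]])
lemma joined_trans: "(u, v) \<in> joined D \<Longrightarrow> (v, w) \<in> joined D \<Longrightarrow> (u, w) \<in> joined D"
  unfolding joined_def by (rule rtrancl_trans)
lemma joined_edge: "(u, v) \<in> edge_rel D \<Longrightarrow> (u, v) \<in> joined D"
  unfolding joined_def by blast

lemma joined_V:
  assumes "(u, v) \<in> joined D" "u \<in> V" "D \<subseteq> E" shows "v \<in> V"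
  using assms(1,2) unfolding joined_def
  by (rule rtrancl_closed) (use edge_relD(2)[OF _ assms(3)] in blast)

definition flip_closed :: "('v \<times> 'v) set \<Rightarrow> 'v set \<Rightarrow> bool" where
  "flip_closed D F \<longleftrightarrow> (\<forall>e\<in>D. fst e \<in> F \<longleftrightarrow> snd e \<in> F)"

lemma flip_closed_joined: "flip_closed D (joined D `` U)"
proof -
  have "fst e \<in> joined D `` U \<longleftrightarrow> snd e \<in> joined D `` U" if "e \<in> D" for e
  proof -
    have "(fst e, snd e) \<in> edge_rel D" using that by (cases e) (simp add: edge_rel_def)
    then have "(fst e, snd e) \<in> joined D" "(snd e, fst e) \<in> joined D"
      using joined_edge joined_sym by blast+
    then show ?thesis using joined_trans by blast
  qed
  then show ?thesis by (simp add: flip_closed_def)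
qed

text \<open>At a vertex of F the new set looks like \<open>M2\<close>, elsewhere like
  \<open>M1\<close>. So it misses the nodes of \<open>A2\<close> inside F and those of
  \<open>A1\<close> outside.\<close>

lemma flip_PM:
  assumes M1: "M1 \<in> PM A1" and M2: "M2 \<in> PM A2" and A: "A1 \<subseteq> X" "A2 \<subseteq> X"
    and F: "flip_closed (M1 \<union> M2) F"
  shows "flip F M1 M2 \<in> PM ((A1 - {i. node i \<in> F}) \<union> (A2 \<inter> {i. node i \<in> F}))" (is "_ \<in> PM ?A")
proof (rule PM_I)
  have F1: "fst e \<in> F \<longleftrightarrow> snd e \<in> F" if "e \<in> M1 \<or> e \<in> M2" for e
    using F that by (auto simp: flip_closed_def)
  have at: "v \<in> F \<longleftrightarrow> fst e \<in> F" if "e \<in> M1 \<or> e \<in> M2" "fst e = v \<or> snd e = v" for e v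
    using F1[OF that(1)] that(2) by auto
  have U: "v \<in> V - node ` ?A \<longleftrightarrow> (if v \<in> F then v \<in> V - node ` A2 else v \<in> V - node ` A1)" for v
    by auto
  show "flip F M1 M2 \<subseteq> E" using PM_D(1)[OF M1] PM_D(1)[OF M2] by (auto simp: flip_def)
  show "fst e \<in> V - node ` ?A \<and> snd e \<in> V - node ` ?A" if e: "e \<in> flip F M1 M2" for e
  proof (cases "fst e \<in> F")
    case True
    then have "e \<in> M2" using e by (auto simp: flip_def)
    then show ?thesis using PM_D(2)[OF M2, of "fst e" "snd e"] True F1[of e] unfolding U by simp
  next
    case False
    then have "e \<in> M1" using e by (auto simp: flip_def)
    then show ?thesis using PM_D(2)[OF M1, of "fst e" "snd e"] False F1[of e] unfolding U by simp
  qed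
  show "\<exists>e. e \<in> flip F M1 M2 \<and> (fst e = v \<or> snd e = v)" if v: "v \<in> V - node ` ?A" for v
  proof (cases "v \<in> F")
    case True
    then have "v \<in> V - node ` A2" using v U by simp
    then obtain e where e: "e \<in> M2" "fst e = v \<or> snd e = v" using PM_D(3)[OF M2] by blast
    then have "e \<in> flip F M1 M2" using at[of e v] True by (simp add: flip_def)
    then show ?thesis using e by blast
  next
    case False
    then have "v \<in> V - node ` A1" using v U by simp
    then obtain e where e: "e \<in> M1" "fst e = v \<or> snd e = v" using PM_D(3)[OF M1] by blast
    then have "e \<in> flip F M1 M2" using at[of e v] False by (simp add: flip_def)
    then show ?thesis using e by blast
  qed
  show "e = e'" if e: "e \<in> flip F M1 M2" "e' \<in> flip F M1 M2" "fst e = v \<or> snd e = v" "fst e' = v \<or> snd e' = v" for e e' v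
  proof -
    have "e \<in> M1 \<and> e' \<in> M1 \<or> e \<in> M2 \<and> e' \<in> M2"
      using e(1,2) at[of e v] at[of e' v] e(3,4) by (auto simp: flip_def)
    then show ?thesis using PM_D(4)[OF M1, of e e' v] PM_D(4)[OF M2, of e e' v] e(3,4) by blast
  qed
qed

text \<open>The mates in the two matchings serve as the two reflections, and a node missed by a
  matching is a fixed point of its mate, hence a path end. The inner statement takes i in
  \<open>A1\<close>; otherwise the matchings are exchanged.\<close>

lemma path_end_unique:
  assumes M1: "M1 \<in> PM A1" and M2: "M2 \<in> PM A2" and A: "A1 \<subseteq> X" "A2 \<subseteq> X"
    and i: "i \<in> A1 \<union> A2" and j: "j \<in> A1 \<union> A2" "j \<noteq> i" "(node i, node j) \<in> joined (M1 \<union> M2)"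
    and k: "k \<in> A1 \<union> A2" "k \<noteq> i" "(node i, node k) \<in> joined (M1 \<union> M2)"
  shows "j = k"
proof -
  have main: "j = k"
    if M1: "M1 \<in> PM A1" and M2: "M2 \<in> PM A2" and A: "A1 \<subseteq> X" "A2 \<subseteq> X"
    and i: "i \<in> A1" and j: "j \<in> A1 \<union> A2" "j \<noteq> i" "(node i, node j) \<in> joined (M1 \<union> M2)"
    and k: "k \<in> A1 \<union> A2" "k \<noteq> i" "(node i, node k) \<in> joined (M1 \<union> M2)" for M1 M2 A1 A2
  proof -
    have m1: "M1 \<in> perfect_matchings (V - node ` A1) E" "V - node ` A1 \<subseteq> V"
      and m2: "M2 \<in> perfect_matchings (V - node ` A2) E" "V - node ` A2 \<subseteq> V"
      using M1 M2 by (auto simp: PM_def)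
    have inX: "i \<in> X" "j \<in> X" "k \<in> X" using i j(1) k(1) A by blast+
    have "node j = node k"
    proof (rule involution_pair_orbit_end_unique[where a = "mate M1" and b = "mate M2" and V = V and x = "node i" and R = "edge_rel (M1 \<union> M2)"])
      show "finite V" by (rule finV)
      show "mate M1 v \<in> V" if "v \<in> V" for v using mate_props(2,4)[OF m1, of v] that by (cases "v \<in> V - node ` A1") auto
      show "mate M2 v \<in> V" if "v \<in> V" for v using mate_props(2,4)[OF m2, of v] that by (cases "v \<in> V - node ` A2") auto
      show "mate M1 (mate M1 v) = v" for v by (rule mate_props(1)[OF m1])
      show "mate M2 (mate M2 v) = v" for v by (rule mate_props(1)[OF m2])
      show "node i \<in> V" using inX node_in_V by blast
      show "mate M1 (node i) = node i" using i mate_props(4)[OF m1] by blast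
      show "v = mate M1 u \<or> v = mate M2 u" if "(u, v) \<in> edge_rel (M1 \<union> M2)" for u v
      proof -
        have "(u, v) \<in> edge_rel M1 \<or> (u, v) \<in> edge_rel M2" using that by (auto simp: edge_rel_def)
        then show ?thesis using mate_eq[OF m1] mate_eq[OF m2] by blast
      qed
      show "(node i, node j) \<in> (edge_rel (M1 \<union> M2))\<^sup>*" "(node i, node k) \<in> (edge_rel (M1 \<union> M2))\<^sup>*"
        using j k by (simp_all add: joined_def)
      show "node j \<noteq> node i" "node k \<noteq> node i" using j(2) k(2) inX node_eq_iff by simp_all
      show "mate M1 (node j) = node j \<or> mate M2 (node j) = node j"
        using j(1) mate_props(4)[OF m1, of "node j"] mate_props(4)[OF m2, of "node j"] by blast
      show "mate M1 (node k) = node k \<or> mate M2 (node k) = node k"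
        using k(1) mate_props(4)[OF m1, of "node k"] mate_props(4)[OF m2, of "node k"] by blast
    qed
    then show ?thesis using inX node_eq_iff by blast
  qed
  show ?thesis
  proof (cases "i \<in> A1")
    case True
    then show ?thesis using main[OF M1 M2 A _ j k] by blast
  next
    case False
    then show ?thesis using main[OF M2 M1 A(2,1), unfolded Un_commute[of M2] Un_commute[of A2]] i j k by blast
  qed
qed

text \<open>Matched vertices of C cancel in pairs, so the excess of black over white in C is carried
  by the nodes that M misses. Evaluating the same excess with two matchings relates the ends of a
  path.\<close>

lemma signed_ends:
  assumes M: "M \<in> PM A" and A: "A \<subseteq> X" and C: "C \<subseteq> V"
    "\<And>u v. (u, v) \<in> edge_rel M \<Longrightarrow> u \<in> C \<Longrightarrow> v \<in> C"
  shows "(\<Sum>v\<in>C. if v \<in> B then 1 else -1 :: int) = (\<Sum>k\<in>{k \<in> A. node k \<in> C}. if node k \<in> B then 1 else -1)"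
proof -
  let ?c = "\<lambda>v. if v \<in> B then 1 else -1 :: int"
  have finC: "finite C" using C(1) finV finite_subset by blast
  have m: "M \<in> perfect_matchings (V - node ` A) E" "V - node ` A \<subseteq> V"
    using M by (auto simp: PM_def)
  have "sum ?c C = sum ?c (C \<inter> (V - node ` A)) + sum ?c (node ` {k \<in> A. node k \<in> C})"
  proof -
    have "C = (C \<inter> (V - node ` A)) \<union> (node ` {k \<in> A. node k \<in> C})" using C(1) by auto
    moreover have "sum ?c ((C \<inter> (V - node ` A)) \<union> (node ` {k \<in> A. node k \<in> C})) =
       sum ?c (C \<inter> (V - node ` A)) + sum ?c (node ` {k \<in> A. node k \<in> C})"
      by (rule sum.union_disjoint) (use finC A finite_subset[of A X] in auto)
    ultimately show ?thesis by simp
  qed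
  also have "sum ?c (C \<inter> (V - node ` A)) = 0" by (rule signed_count_zero[OF m C(2)])
  also have "sum ?c (node ` {k \<in> A. node k \<in> C}) = (\<Sum>k\<in>{k \<in> A. node k \<in> C}. ?c (node k))"
    by (rule sum.reindex[unfolded comp_def]) (rule inj_on_subset[OF inj_node], use A in blast)
  finally show ?thesis by simp
qed

text \<open>The missed nodes in the component of i have the same signed count for \<open>M1\<close>
  and for \<open>M2\<close>. A lone end would give 1 or -1 on one side and 0 on the other. With two
  ends, the equality says that ends missed by the same matching have opposite colours and ends
  missed by different matchings have equal colours.\<close>

lemma path_ends:
  assumes M1: "M1 \<in> PM A1" and M2: "M2 \<in> PM A2" and A: "A1 \<subseteq> X" "A2 \<subseteq> X" "A1 \<inter> A2 = {}"
    and i: "i \<in> A1 \<union> A2"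
  shows "\<exists>j\<in>A1 \<union> A2. j \<noteq> i \<and> (node i, node j) \<in> joined (M1 \<union> M2) \<and>
    ((i \<in> A1 \<longleftrightarrow> j \<in> A1) \<longleftrightarrow> (node i \<in> B \<longleftrightarrow> node j \<notin> B))"
proof -
  let ?D = "M1 \<union> M2" and ?c = "\<lambda>k. if node k \<in> B then 1 else -1 :: int"
  define C where "C = joined ?D `` {node i}"
  have DE: "?D \<subseteq> E" using PM_D(1)[OF M1] PM_D(1)[OF M2] by blast
  have iX: "i \<in> X" using i A by blast
  have CV: "C \<subseteq> V" unfolding C_def using joined_V[OF _ node_in_V[OF iX] DE] by blast
  have cl: "v \<in> C" if "(u, v) \<in> edge_rel M1 \<or> (u, v) \<in> edge_rel M2" "u \<in> C" for u v
  proof -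
    have "(u, v) \<in> edge_rel ?D" using that(1) by (auto simp: edge_rel_def)
    then have "(u, v) \<in> joined ?D" by (rule joined_edge)
    then show ?thesis using that(2) joined_trans unfolding C_def by blast
  qed
  have iC: "node i \<in> C" using joined_refl by (simp add: C_def)
  have eq: "(\<Sum>k\<in>{k \<in> A1. node k \<in> C}. ?c k) = (\<Sum>k\<in>{k \<in> A2. node k \<in> C}. ?c k)"
  proof -
    have "v \<in> C" if "(u, v) \<in> edge_rel M1" "u \<in> C" for u v using cl that by blast
    moreover have "v \<in> C" if "(u, v) \<in> edge_rel M2" "u \<in> C" for u v using cl that by blast
    ultimately show ?thesis using signed_ends[OF M1 A(1) CV] signed_ends[OF M2 A(2) CV] by simp
  qed
  have mem: "k \<in> A1 \<union> A2 \<and> node k \<in> C \<longleftrightarrow> k = i \<or> k \<in> A1 \<union> A2 \<and> k \<noteq> i \<and> (node i, node k) \<in> joined ?D" for k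
    using iC i by (auto simp: C_def)
  have "\<exists>j. j \<in> A1 \<union> A2 \<and> j \<noteq> i \<and> (node i, node j) \<in> joined ?D"
  proof (rule ccontr)
    assume "\<not> ?thesis"
    then have only: "k \<in> A1 \<union> A2 \<and> node k \<in> C \<longleftrightarrow> k = i" for k using mem by blast
    have "{k \<in> A1. node k \<in> C} = {k. k = i \<and> k \<in> A1}" using only by blast
    moreover have "{k \<in> A2. node k \<in> C} = {k. k = i \<and> k \<notin> A1}" using only i A(3) by blast
    ultimately have "(\<Sum>k\<in>{k. k = i \<and> k \<in> A1}. ?c k) = (\<Sum>k\<in>{k. k = i \<and> k \<notin> A1}. ?c k)"
      using eq by simp
    moreover have "{k. k = i \<and> k \<in> A1} = (if i \<in> A1 then {i} else {})"
      "{k. k = i \<and> k \<notin> A1} = (if i \<in> A1 then {} else {i})" by auto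
    ultimately show False by (simp split: if_splits)
  qed
  then obtain j where j: "j \<in> A1 \<union> A2" "j \<noteq> i" "(node i, node j) \<in> joined ?D" by blast
  have only: "k \<in> A1 \<union> A2 \<and> node k \<in> C \<longleftrightarrow> k = i \<or> k = j" for k
    using mem[of k] path_end_unique[OF M1 M2 A(1,2) i j] j by blast
  have jC: "node j \<in> C" using j(3) by (simp add: C_def)
  have "{k \<in> A1. node k \<in> C} = {k \<in> {i, j}. k \<in> A1}" using only iC jC by blast
  moreover have "{k \<in> A2. node k \<in> C} = {k \<in> {i, j}. k \<notin> A1}" using only iC jC i j(1) A(3) by blast
  ultimately have "(\<Sum>k\<in>{k \<in> {i, j}. k \<in> A1}. ?c k) = (\<Sum>k\<in>{k \<in> {i, j}. k \<notin> A1}. ?c k)" using eq by simp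
  moreover have "(\<Sum>k\<in>{k \<in> {i, j}. k \<in> A1}. ?c k) = (if i \<in> A1 then ?c i else 0) + (if j \<in> A1 then ?c j else 0)"
    "(\<Sum>k\<in>{k \<in> {i, j}. k \<notin> A1}. ?c k) = (if i \<notin> A1 then ?c i else 0) + (if j \<notin> A1 then ?c j else 0)"
    by (subst sum.inter_filter; use j(2) in simp)+
  ultimately have "(i \<in> A1 \<longleftrightarrow> j \<in> A1) \<longleftrightarrow> (node i \<in> B \<longleftrightarrow> node j \<notin> B)"
    by (auto split: if_splits)
  then show ?thesis using j by blast
qed

text \<open>The other end of the path through node i. Existence and uniqueness behind
  \<open>THE\<close> come from \<open>path_ends\<close> and \<open>path_end_unique\<close>; the
  default i off S places the map in \<open>pairs_on S\<close>.\<close>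

definition partner :: "('v \<times> 'v) set \<Rightarrow> nat set \<Rightarrow> nat \<Rightarrow> nat" where
  "partner D S i = (if i \<in> S then THE j. j \<in> S \<and> j \<noteq> i \<and> (node i, node j) \<in> joined D else i)"

lemma partner_props:
  assumes M1: "M1 \<in> PM A1" and M2: "M2 \<in> PM A2" and A: "A1 \<subseteq> X" "A2 \<subseteq> X" "A1 \<inter> A2 = {}"
    and S: "S = A1 \<union> A2" and i: "i \<in> S"
  shows "partner (M1 \<union> M2) S i \<in> S" "partner (M1 \<union> M2) S i \<noteq> i"
    "(node i, node (partner (M1 \<union> M2) S i)) \<in> joined (M1 \<union> M2)"
    "(i \<in> A1 \<longleftrightarrow> partner (M1 \<union> M2) S i \<in> A1) \<longleftrightarrow> (node i \<in> B \<longleftrightarrow> node (partner (M1 \<union> M2) S i) \<notin> B)"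
    "\<And>j. j \<in> S \<Longrightarrow> j \<noteq> i \<Longrightarrow> (node i, node j) \<in> joined (M1 \<union> M2) \<Longrightarrow> partner (M1 \<union> M2) S i = j"
proof -
  obtain j where j: "j \<in> S" "j \<noteq> i" "(node i, node j) \<in> joined (M1 \<union> M2)"
    "(i \<in> A1 \<longleftrightarrow> j \<in> A1) \<longleftrightarrow> (node i \<in> B \<longleftrightarrow> node j \<notin> B)"
    using path_ends[OF M1 M2 A, of i] i S by blast
  have uniq: "k = j" if "k \<in> S" "k \<noteq> i" "(node i, node k) \<in> joined (M1 \<union> M2)" for k
    using path_end_unique[OF M1 M2 A(1,2), of i k j] i j that S by blast
  have "(THE j. j \<in> S \<and> j \<noteq> i \<and> (node i, node j) \<in> joined (M1 \<union> M2)) = j"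
  proof (rule the_equality)
    show "j \<in> S \<and> j \<noteq> i \<and> (node i, node j) \<in> joined (M1 \<union> M2)" by (intro conjI j)
  qed (use uniq in blast)
  then have p: "partner (M1 \<union> M2) S i = j" using i by (simp add: partner_def)
  show "partner (M1 \<union> M2) S i \<in> S" "partner (M1 \<union> M2) S i \<noteq> i"
    "(node i, node (partner (M1 \<union> M2) S i)) \<in> joined (M1 \<union> M2)"
    "(i \<in> A1 \<longleftrightarrow> partner (M1 \<union> M2) S i \<in> A1) \<longleftrightarrow> (node i \<in> B \<longleftrightarrow> node (partner (M1 \<union> M2) S i) \<notin> B)"
    unfolding p by (rule j)+
  show "\<And>j. j \<in> S \<Longrightarrow> j \<noteq> i \<Longrightarrow> (node i, node j) \<in> joined (M1 \<union> M2) \<Longrightarrow> partner (M1 \<union> M2) S i = j"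
    unfolding p using uniq by blast
qed

lemma partner_pairs_on:
  assumes M1: "M1 \<in> PM A1" and M2: "M2 \<in> PM A2" and A: "A1 \<subseteq> X" "A2 \<subseteq> X" "A1 \<inter> A2 = {}"
    and S: "S = A1 \<union> A2"
  shows "partner (M1 \<union> M2) S \<in> pairs_on S"
proof -
  note P = partner_props[OF assms]
  have "partner (M1 \<union> M2) S (partner (M1 \<union> M2) S i) = i" if i: "i \<in> S" for i
    using P(5)[OF P(1)[OF i] i] P(2)[OF i] joined_sym[OF P(3)[OF i]] by auto
  then have "ff_involution S (partner (M1 \<union> M2) S)"
    unfolding ff_involution_def using P(1,2) by blast
  then show ?thesis by (simp add: pairs_on_def partner_def)
qed

text \<open>Two crossing paths would belong to one component, which would then contain too many
  ends.\<close>

lemma partner_noncrossing: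
  assumes M1: "M1 \<in> PM A1" and M2: "M2 \<in> PM A2" and A: "A1 \<subseteq> X" "A2 \<subseteq> X" "A1 \<inter> A2 = {}"
    and S: "S = A1 \<union> A2" and ab: "a \<in> S" "b \<in> S" "a < b" "b < partner (M1 \<union> M2) S a"
      "partner (M1 \<union> M2) S a < partner (M1 \<union> M2) S b"
  shows False
proof -
  note P = partner_props[OF assms(1-6)]
  have DE: "M1 \<union> M2 \<subseteq> E" using PM_D(1)[OF M1] PM_D(1)[OF M2] by blast
  have SX: "S \<subseteq> X" using A S by blast
  have "(node a, node b) \<in> joined (M1 \<union> M2)"
    unfolding joined_def
    by (rule noncross[OF DE, of a b "partner (M1 \<union> M2) S a" "partner (M1 \<union> M2) S b"])
      (use ab SX P(1)[OF ab(1)] P(1)[OF ab(2)] P(3)[OF ab(1)] P(3)[OF ab(2)] in \<open>auto simp: joined_def\<close>)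
  then have "partner (M1 \<union> M2) S a = b" using P(5)[OF ab(1) ab(2)] ab(3) by simp
  then show False using ab(4) by simp
qed

text \<open>The ends strictly between two partners are partners of each other, since paths do not
  cross. This parity controls every sign in the condensation.\<close>

lemma even_between_partners:
  assumes M1: "M1 \<in> PM A1" and M2: "M2 \<in> PM A2" and A: "A1 \<subseteq> X" "A2 \<subseteq> X" "A1 \<inter> A2 = {}"
    and S: "S = A1 \<union> A2" and i: "i \<in> S" "i < partner (M1 \<union> M2) S i"
  shows "even (card {k \<in> S. i < k \<and> k < partner (M1 \<union> M2) S i})"
proof -
  define q where "q = partner (M1 \<union> M2) S"
  have ff: "ff_involution S q" unfolding q_def by (rule pairs_on_ff[OF partner_pairs_on[OF assms(1-6)]])
  note Q = ff_involutionD[OF ff]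
  have nc: False if "a \<in> S" "b \<in> S" "a < b" "b < q a" "q a < q b" for a b
    using partner_noncrossing[OF assms(1-6)] that unfolding q_def by blast
  have "ff_involution {k \<in> S. i < k \<and> k < q i} q"
    unfolding ff_involution_def
  proof
    fix x assume "x \<in> {k \<in> S. i < k \<and> k < q i}"
    then have x: "x \<in> S" "i < x" "x < q i" by auto
    have "q x \<noteq> i" using x Q[OF x(1)] by auto
    moreover have "q x \<noteq> q i" using x Q(3)[OF x(1)] Q(3)[OF i(1)] by (metis less_irrefl)
    moreover have "\<not> q x < i" using nc[of "q x" i] Q[OF x(1)] x i by auto
    moreover have "\<not> q i < q x" using nc[of i x] x i by blast
    ultimately show "q x \<in> {k \<in> S. i < k \<and> k < q i} \<and> q x \<noteq> x \<and> q (q x) = x"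
      using Q[OF x(1)] by auto
  qed
  moreover have "finite S" using A S finite_subset[of _ X] by blast
  ultimately show ?thesis unfolding q_def by (intro even_card_ff_involution) auto
qed

end

section \<open>Condensation\<close>

definition between :: "nat set \<Rightarrow> nat \<Rightarrow> nat \<Rightarrow> nat" where
  "between S i j = card {k \<in> S. i < k \<and> k < j}"

definition crossings_on :: "nat set \<Rightarrow> (nat \<Rightarrow> nat) \<Rightarrow> nat" where
  "crossings_on S p = card {(a, b). a \<in> S \<and> b \<in> S \<and> a < b \<and> b < p a \<and> p a < p b}"

lemma between_split:
  assumes "finite S" "j \<in> S" "i < j" "j < k"
  shows "between S i k = between S i j + 1 + between S j k"
proof -
  have "{l \<in> S. i < l \<and> l < k} = insert j ({l \<in> S. i < l \<and> l < j} \<union> {l \<in> S. j < l \<and> l < k})"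
    using assms by auto
  also have "card \<dots> = Suc (card {l \<in> S. i < l \<and> l < j} + card {l \<in> S. j < l \<and> l < k})"
    using assms(1) by (subst card_insert_disjoint; (subst card_Un_disjoint)?) auto
  finally show ?thesis by (simp add: between_def)
qed

lemma sum_sign_reversing:
  fixes f :: "'a \<Rightarrow> real"
  assumes "\<And>t. t \<in> T \<Longrightarrow> \<phi> t \<in> T" "\<And>t. t \<in> T \<Longrightarrow> \<phi> (\<phi> t) = t" "\<And>t. t \<in> T \<Longrightarrow> f (\<phi> t) = - f t"
  shows "sum f T = 0"
proof -
  have "sum f T = (\<Sum>t\<in>T. - f t)"
    by (rule sum.reindex_bij_witness[of _ \<phi> \<phi>]) (use assms in auto)
  then show ?thesis by (simp add: sum_negf)
qed

locale weighted_dimer_nodes = dimer_nodes +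
  fixes wt :: "'a \<times> 'a \<Rightarrow> real"
begin

definition Z :: "nat set \<Rightarrow> real" where
  "Z A = (\<Sum>M\<in>PM A. prod wt M)"

lemma Z_mult: "Z A1 * Z A2 = (\<Sum>(M1, M2)\<in>PM A1 \<times> PM A2. prod wt M1 * prod wt M2)"
  unfolding Z_def sum_product by (rule sum.cartesian_product)

lemma path_labels:
  assumes M: "M1 \<in> PM A1" "M2 \<in> PM A2" "A1 \<subseteq> X" "A2 \<subseteq> X" "A1 \<inter> A2 = {}" "S = A1 \<union> A2"
    and j: "j \<in> S" and i: "i \<in> S"
  shows "node i \<in> joined (M1 \<union> M2) `` {node j} \<longleftrightarrow> i = j \<or> i = partner (M1 \<union> M2) S j"
  using partner_props(3,5)[OF M j] i joined_refl[of "node j"] by blast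

text \<open>The recoloured path contains exactly two ends, j and k, so exactly these two labels
  change sides.\<close>

lemma flip_path_PM:
  assumes M: "M1 \<in> PM A1" "M2 \<in> PM A2" "A1 \<subseteq> X" "A2 \<subseteq> X" "A1 \<inter> A2 = {}" "S = A1 \<union> A2"
    and j: "j \<in> S" and k: "k = partner (M1 \<union> M2) S j" and F: "F = joined (M1 \<union> M2) `` {node j}"
  shows "flip F M1 M2 \<in> PM ((A1 - {j, k}) \<union> (A2 \<inter> {j, k}))"
    "flip F M2 M1 \<in> PM ((A2 - {j, k}) \<union> (A1 \<inter> {j, k}))"
proof -
  have lab: "node i \<in> F \<longleftrightarrow> i = j \<or> i = k" if "i \<in> A1 \<union> A2" for i
    using path_labels[OF M j, of i] that k F M(6) by simp
  have cl: "flip_closed (M1 \<union> M2) F" unfolding F by (rule flip_closed_joined)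
  have "(A1 - {i. node i \<in> F}) \<union> (A2 \<inter> {i. node i \<in> F}) = (A1 - {j, k}) \<union> (A2 \<inter> {j, k})"
    "(A2 - {i. node i \<in> F}) \<union> (A1 \<inter> {i. node i \<in> F}) = (A2 - {j, k}) \<union> (A1 \<inter> {j, k})"
    using lab by auto
  then show "flip F M1 M2 \<in> PM ((A1 - {j, k}) \<union> (A2 \<inter> {j, k}))"
    "flip F M2 M1 \<in> PM ((A2 - {j, k}) \<union> (A1 \<inter> {j, k}))"
    using flip_PM[OF M(1-4) cl] flip_PM[OF M(2,1,4,3), of F] cl by (simp_all add: Un_commute)
qed

lemma joined_class_eq:
  assumes "(u, v) \<in> joined D" shows "joined D `` {u} = joined D `` {v}"
  using assms joined_sym joined_trans by blast

text \<open>Kuo--Ciucu condensation. Recolouring the path that starts at j is a sign-reversing involution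
  on the pairs of matchings in which that path does not end at the smallest node i.\<close>

lemma condensation:
  assumes SX: "S \<subseteq> X" and i: "i \<in> S" and min: "\<And>k. k \<in> S \<Longrightarrow> i \<le> k"
  shows "Z {} * Z S = (\<Sum>j\<in>S - {i}. (-1) ^ between S i j * (Z {i, j} * Z (S - {i, j})))"
proof -
  have finS: "finite S" using SX finite_subset by blast
  define P where "P = (\<lambda>j. PM {i, j} \<times> PM (S - {i, j}))"
  define T where "T = Sigma (S - {i}) P"
  define val where "val = (\<lambda>(j, M1, M2). (-1) ^ between S i j * (prod wt M1 * prod wt M2))"
  \<comment> \<open>\<open>T1\<close> collects the triples in which i and j are the two ends of one
    path and supplies the left-hand side; on \<open>T2\<close> the path from j ends elsewhere, and
    the terms cancel.\<close>
  define T1 where "T1 = {(j, M1, M2). (j, M1, M2) \<in> T \<and> partner (M1 \<union> M2) S j = i}"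
  define T2 where "T2 = {(j, M1, M2). (j, M1, M2) \<in> T \<and> partner (M1 \<union> M2) S j \<noteq> i}"
  have finT: "finite T" unfolding T_def P_def using finS finite_PM by (intro finite_SigmaI) auto
  have TD: "j \<in> S" "j \<noteq> i" "i < j" "M1 \<in> PM {i, j}" "M2 \<in> PM (S - {i, j})"
    "{i, j} \<subseteq> X" "S - {i, j} \<subseteq> X" "{i, j} \<inter> (S - {i, j}) = {}" "S = {i, j} \<union> (S - {i, j})"
    if "(j, M1, M2) \<in> T" for j M1 M2
    using that SX i min[of j] unfolding T_def P_def by (auto simp: less_le)
  have wflip: "prod wt (flip F M1 M2) * prod wt (flip F M2 M1) = prod wt M1 * prod wt M2"
    if "M1 \<in> PM A1" "M2 \<in> PM A2" for F M1 M2 A1 A2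
    using that finite_matching by (intro prod_flip) auto
  have sign_even: "(-1) ^ between S i j = (1::real)" if t: "(j, M1, M2) \<in> T1" for j M1 M2
  proof -
    have tT: "(j, M1, M2) \<in> T" and pj: "partner (M1 \<union> M2) S j = i" using t by (auto simp: T1_def)
    note D = TD[OF tT]
    have "partner (M1 \<union> M2) S i = j"
      using ff_involutionD(3)[OF pairs_on_ff[OF partner_pairs_on[OF D(4-9)]] D(1)] pj by simp
    then show ?thesis using even_between_partners[OF D(4-9) i] D(3) by (simp add: between_def)
  qed
  have sum2: "sum val T2 = 0"
  proof (rule sum_sign_reversing)
    \<comment> \<open>Recolouring moves the second missing node of the first matching from j to the
      other end of its path. That end lies on the same path, so a second application undoes the
      first.\<close>
    define \<phi> where "\<phi> = (\<lambda>(j, M1, M2). (partner (M1 \<union> M2) S j,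
      flip (joined (M1 \<union> M2) `` {node j}) M1 M2, flip (joined (M1 \<union> M2) `` {node j}) M2 M1))"
    have main: "\<phi> t \<in> T2 \<and> \<phi> (\<phi> t) = t \<and> val (\<phi> t) = - val t" if t: "t \<in> T2" for t
    proof -
      obtain j M1 M2 where tt: "t = (j, M1, M2)" by (cases t) auto
      have tT: "(j, M1, M2) \<in> T" and ne: "partner (M1 \<union> M2) S j \<noteq> i" using t by (auto simp: T2_def tt)
      note D = TD[OF tT]
      define k where "k = partner (M1 \<union> M2) S j"
      define F where "F = joined (M1 \<union> M2) `` {node j}"
      note Pj = partner_props[OF D(4-9) D(1), folded k_def]
      have kk: "k \<in> S" "k \<noteq> j" "k \<noteq> i" using Pj(1,2) ne by (auto simp: k_def)
      have qk: "partner (M1 \<union> M2) S k = j"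
        using ff_involutionD(3)[OF pairs_on_ff[OF partner_pairs_on[OF D(4-9)]] D(1)] by (simp add: k_def)
      have phi: "\<phi> t = (k, flip F M1 M2, flip F M2 M1)" by (simp add: \<phi>_def tt k_def F_def)
      have s1: "({i, j} - {j, k}) \<union> ((S - {i, j}) \<inter> {j, k}) = {i, k}" using kk D(1,2) by auto
      have s2: "((S - {i, j}) - {j, k}) \<union> ({i, j} \<inter> {j, k}) = S - {i, k}" using kk D(1,2) by auto
      have fl: "flip F M1 M2 \<in> PM {i, k}" "flip F M2 M1 \<in> PM (S - {i, k})"
        using flip_path_PM[OF D(4-9) D(1) k_def F_def] unfolding s1 s2 by auto
      have "\<phi> t \<in> T2"
        unfolding phi T2_def T_def P_def using kk fl qk D(2) by (simp add: flip_Un)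
      moreover have "joined (M1 \<union> M2) `` {node k} = F"
        unfolding F_def using joined_class_eq[OF Pj(3)] by simp
      then have "\<phi> (\<phi> t) = t"
        unfolding phi by (simp add: \<phi>_def flip_Un flip_flip qk tt)
      moreover have "val (\<phi> t) = - val t"
      proof -
        \<comment> \<open>The number of ends strictly between j and k is even, so
          \<open>between S i j\<close> and \<open>between S i k\<close> differ by an odd number, the
          extra 1 being the nearer of j and k.\<close>
        have ev: "even (between S j k)" if "j < k"
          using even_between_partners[OF D(4-9) D(1)] that by (simp add: between_def k_def)
        have ev': "even (between S k j)" if "k < j"
          using even_between_partners[OF D(4-9) kk(1)] that by (simp add: between_def qk)
        have ik: "i < k" using min[OF kk(1)] kk(3) by simp
        have "(-1) ^ between S i k = (- ((-1) ^ between S i j) :: real)"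
        proof (cases "j < k")
          case True
          then show ?thesis using between_split[OF finS D(1) D(3) True] ev by (simp add: power_add)
        next
          case False
          then have "k < j" using kk(2) by simp
          then show ?thesis using between_split[OF finS kk(1) ik] ev' by (simp add: power_add)
        qed
        then show ?thesis unfolding phi unfolding tt val_def using wflip[OF D(4,5), of F] by simp
      qed
      ultimately show ?thesis by blast
    qed
    show "\<And>t. t \<in> T2 \<Longrightarrow> \<phi> t \<in> T2" "\<And>t. t \<in> T2 \<Longrightarrow> \<phi> (\<phi> t) = t"
      "\<And>t. t \<in> T2 \<Longrightarrow> val (\<phi> t) = - val t" using main by blast+
  qed
  have sum1: "sum val T1 = Z {} * Z S"
    unfolding Z_mult
  proof (rule sum.reindex_bij_witness)
    \<comment> \<open>Recolouring the path between i and j lets the first matching cover all nodes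
      and the second miss all of S; conversely j is recovered as the other end of the path from
      i.\<close>
    define \<psi> :: "nat \<times> ('a \<times> 'a) set \<times> ('a \<times> 'a) set \<Rightarrow> ('a \<times> 'a) set \<times> ('a \<times> 'a) set"
      where "\<psi> = (\<lambda>(j, M1, M2).
      (flip (joined (M1 \<union> M2) `` {node i}) M1 M2, flip (joined (M1 \<union> M2) `` {node i}) M2 M1))"
    define \<eta> where "\<eta> = (\<lambda>(M1, M2). (partner (M1 \<union> M2) S i,
      flip (joined (M1 \<union> M2) `` {node i}) M1 M2, flip (joined (M1 \<union> M2) `` {node i}) M2 M1))"
    show "\<eta> (\<psi> t) = t" "\<psi> t \<in> PM {} \<times> PM S" "(case \<psi> t of (M1, M2) \<Rightarrow> prod wt M1 * prod wt M2) = val t"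
      if t: "t \<in> T1" for t
    proof -
      obtain j M1 M2 where tt: "t = (j, M1, M2)" by (cases t) auto
      have t1: "(j, M1, M2) \<in> T1" using t tt by simp
      have tT: "(j, M1, M2) \<in> T" and pj: "partner (M1 \<union> M2) S j = i" using t by (auto simp: T1_def tt)
      note D = TD[OF tT]
      define F where "F = joined (M1 \<union> M2) `` {node i}"
      have qi: "partner (M1 \<union> M2) S i = j"
        using ff_involutionD(3)[OF pairs_on_ff[OF partner_pairs_on[OF D(4-9)]] D(1)] pj by simp
      have psi: "\<psi> t = (flip F M1 M2, flip F M2 M1)" by (simp add: \<psi>_def tt F_def)
      show "\<eta> (\<psi> t) = t"
        unfolding psi by (simp add: \<eta>_def flip_Un flip_flip qi tt flip: F_def)
      have s1: "({i, j} - {i, j}) \<union> ((S - {i, j}) \<inter> {i, j}) = {}" by auto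
      have s2: "((S - {i, j}) - {i, j}) \<union> ({i, j} \<inter> {i, j}) = S" using i D(1) by auto
      show "\<psi> t \<in> PM {} \<times> PM S"
        using flip_path_PM[OF D(4-9) i qi[symmetric] F_def] unfolding s1 s2 psi by simp
      show "(case \<psi> t of (M1, M2) \<Rightarrow> prod wt M1 * prod wt M2) = val t"
        unfolding psi unfolding tt val_def using wflip[OF D(4,5), of F] sign_even[OF t1] by simp
    qed
    show "\<psi> (\<eta> u) = u" "\<eta> u \<in> T1" if u: "u \<in> PM {} \<times> PM S" for u
    proof -
      obtain M1 M2 where uu: "u = (M1, M2)" "M1 \<in> PM {}" "M2 \<in> PM S" using u by auto
      have D: "{} \<subseteq> X" "S \<subseteq> X" "{} \<inter> S = {}" "S = {} \<union> S" using SX by auto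
      define F where "F = joined (M1 \<union> M2) `` {node i}"
      define j where "j = partner (M1 \<union> M2) S i"
      note Pi = partner_props[OF uu(2,3) D i, folded j_def]
      have qj: "partner (M1 \<union> M2) S j = i"
        using ff_involutionD(3)[OF pairs_on_ff[OF partner_pairs_on[OF uu(2,3) D]] i] by (simp add: j_def)
      have chi: "\<eta> u = (j, flip F M1 M2, flip F M2 M1)" by (simp add: \<eta>_def uu(1) F_def j_def)
      show "\<psi> (\<eta> u) = u"
        unfolding chi by (simp add: \<psi>_def flip_Un flip_flip uu(1) flip: F_def)
      have s1: "({} - {i, j}) \<union> (S \<inter> {i, j}) = {i, j}" using i Pi(1) by auto
      have s2: "(S - {i, j}) \<union> ({} \<inter> {i, j}) = S - {i, j}" by auto
      have "flip F M1 M2 \<in> PM {i, j}" "flip F M2 M1 \<in> PM (S - {i, j})"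
        using flip_path_PM[OF uu(2,3) D i j_def F_def] unfolding s1 s2 by auto
      then show "\<eta> u \<in> T1"
        unfolding chi T1_def T_def P_def using Pi(1,2) qj by (simp add: flip_Un)
    qed
  qed
  have "(\<Sum>j\<in>S - {i}. (-1) ^ between S i j * (Z {i, j} * Z (S - {i, j}))) = (\<Sum>j\<in>S - {i}. \<Sum>m\<in>P j. val (j, m))"
    unfolding Z_mult sum_distrib_left P_def val_def
    by (intro sum.cong) (auto simp: case_prod_unfold)
  also have "\<dots> = sum val T"
    unfolding T_def by (subst sum.Sigma) (use finS finite_PM in \<open>auto simp: P_def\<close>)
  also have "T = T1 \<union> T2" unfolding T1_def T2_def by auto
  also have "sum val (T1 \<union> T2) = sum val T1 + sum val T2"
    by (rule sum.union_disjoint) (use finT in \<open>auto simp: T1_def T2_def intro: finite_subset[OF _ finT]\<close>)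
  finally show ?thesis using sum1 sum2 by simp
qed

end

text \<open>The summand of p in the Pfaffian of the skew-symmetric matrix with entries y above the
  diagonal: the sign of a perfect matching is the parity of its crossings.\<close>

definition pf_term :: "(nat \<Rightarrow> nat \<Rightarrow> real) \<Rightarrow> nat set \<Rightarrow> (nat \<Rightarrow> nat) \<Rightarrow> real" where
  "pf_term y S p = (-1) ^ crossings_on S p * (\<Prod>i\<in>{i \<in> S. i < p i}. y i (p i))"

text \<open>As i is the least label, the chord from i to j is crossed exactly by the pairs with one
  end strictly between them and the other beyond j. The remaining labels between are paired among
  themselves, so the crossings of this chord have the parity of
  \<open>between S i j\<close>.\<close>

lemma crossings_on_insert_min:
  assumes finS: "finite S" and i: "i \<in> S" and j: "j \<in> S" "j \<noteq> i" and min: "\<And>k. k \<in> S \<Longrightarrow> i \<le> k"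
    and p: "p \<in> pairs_on S" "p i = j"
  shows "even (crossings_on S p + (crossings_on (S - {i, j}) p + between S i j))"
proof -
  note P = ff_involutionD[OF pairs_on_ff[OF p(1)]]
  have pj: "p j = i" using P(3)[OF i] p(2) by simp
  have ij: "i < j" using min[OF j(1)] j(2) by simp
  let ?S' = "S - {i, j}"
  have stay: "p b \<in> ?S'" if "b \<in> ?S'" for b
  proof -
    have b: "b \<in> S" "b \<noteq> i" "b \<noteq> j" using that by auto
    have "p b \<noteq> i" "p b \<noteq> j" using P(3)[OF b(1)] b(2,3) pj p(2) by auto
    then show ?thesis using P(1)[OF b(1)] by simp
  qed
  let ?cr = "\<lambda>S. {(a, b). a \<in> S \<and> b \<in> S \<and> a < b \<and> b < p a \<and> p a < p b}"
  \<comment> \<open>The labels between i and j, split by whether their pair crosses the chord; the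
    second set is closed under p and has even size.\<close>
  let ?out = "{b \<in> ?S'. b < j \<and> j < p b}" and ?in = "{b \<in> ?S'. b < j \<and> p b < j}"
  have "?cr S = ?cr ?S' \<union> Pair i ` ?out"
  proof (intro equalityI subsetI)
    fix z assume "z \<in> ?cr S"
    then obtain a b where z: "z = (a, b)" "a \<in> S" "b \<in> S" "a < b" "b < p a" "p a < p b" by auto
    have "b \<noteq> i" using min[OF z(2)] z(4) by simp
    have "p b \<noteq> i" "p a \<noteq> i" using min[of a] z by auto
    then have "b \<noteq> j" "a \<noteq> j" using pj by auto
    show "z \<in> ?cr ?S' \<union> Pair i ` ?out"
    proof (cases "a = i")
      case True
      then have "b \<in> ?out" using z \<open>b \<noteq> i\<close> \<open>b \<noteq> j\<close> p(2) by simp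
      then show ?thesis using True z(1) by simp
    next
      case False
      then show ?thesis using z \<open>b \<noteq> i\<close> \<open>b \<noteq> j\<close> \<open>a \<noteq> j\<close> by simp
    qed
  next
    fix z assume "z \<in> ?cr ?S' \<union> Pair i ` ?out"
    then show "z \<in> ?cr S"
    proof
      assume "z \<in> Pair i ` ?out"
      then obtain b where b: "z = (i, b)" "b \<in> ?S'" "b < j" "j < p b" by auto
      then show ?thesis using i p(2) min[of b] by (auto simp: less_le)
    qed auto
  qed
  moreover have "finite (?cr ?S')"
    by (rule finite_subset[of _ "S \<times> S"]) (use finS in auto)
  moreover have "?cr ?S' \<inter> Pair i ` ?out = {}" by auto
  ultimately have "crossings_on S p = crossings_on ?S' p + card ?out"
    using finS by (simp add: crossings_on_def card_Un_disjoint card_image inj_on_def)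
  moreover have "between S i j = card ?out + card ?in"
  proof -
    have "{k \<in> S. i < k \<and> k < j} = ?out \<union> ?in"
    proof (intro equalityI subsetI)
      fix k assume k: "k \<in> {k \<in> S. i < k \<and> k < j}"
      then have "k \<in> ?S'" by auto
      then have "p k \<in> ?S'" by (rule stay)
      then have "p k \<noteq> j" by simp
      then show "k \<in> ?out \<union> ?in" using k \<open>k \<in> ?S'\<close> by auto
    next
      fix k assume "k \<in> ?out \<union> ?in"
      then have "k \<in> S" "k \<noteq> i" "k < j" by auto
      then show "k \<in> {k \<in> S. i < k \<and> k < j}" using min[of k] by simp
    qed
    moreover have "?out \<inter> ?in = {}" by auto
    ultimately show ?thesis using finS by (simp add: between_def card_Un_disjoint)
  qed
  moreover have "even (card ?in)"
  proof (rule even_card_ff_involution)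
    show "finite ?in" using finS by simp
    show "ff_involution ?in p"
      unfolding ff_involution_def
    proof
      fix b assume b: "b \<in> ?in"
      then have "b \<in> ?S'" "b \<in> S" by auto
      then show "p b \<in> ?in \<and> p b \<noteq> b \<and> p (p b) = b" using b stay[of b] P[of b] by auto
    qed
  qed
  ultimately show ?thesis by simp
qed

lemma pf_term_cong:
  assumes "\<And>k. k \<in> S \<Longrightarrow> p k = q k" shows "pf_term y S p = pf_term y S q"
proof -
  have "crossings_on S p = crossings_on S q"
    unfolding crossings_on_def using assms by (intro arg_cong[where f = card]) auto
  moreover have "{i \<in> S. i < p i} = {i \<in> S. i < q i}" using assms by auto
  moreover have "(\<Prod>i\<in>{i \<in> S. i < q i}. y i (p i)) = (\<Prod>i\<in>{i \<in> S. i < q i}. y i (q i))"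
    by (rule prod.cong) (use assms in auto)
  ultimately show ?thesis by (simp add: pf_term_def)
qed

lemma pf_term_insert_min:
  assumes finS: "finite S" and i: "i \<in> S" and j: "j \<in> S" "j \<noteq> i" and min: "\<And>k. k \<in> S \<Longrightarrow> i \<le> k"
    and p: "p \<in> pairs_on S" "p i = j"
  shows "pf_term y S p = (-1) ^ between S i j * (y i j * pf_term y (S - {i, j}) p)"
proof -
  have pj: "p j = i" using ff_involutionD(3)[OF pairs_on_ff[OF p(1)] i] p(2) by simp
  have ij: "i < j" using min[OF j(1)] j(2) by simp
  have "(-1) ^ crossings_on S p = ((-1) ^ between S i j * (-1) ^ crossings_on (S - {i, j}) p :: real)"
    using crossings_on_insert_min[OF assms]
    by (cases "even (crossings_on S p)"; cases "even (crossings_on (S - {i, j}) p)"; cases "even (between S i j)") simp_all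
  moreover have "{k \<in> S. k < p k} = insert i {k \<in> S - {i, j}. k < p k}"
    using i ij p(2) pj by auto
  then have "(\<Prod>k\<in>{k \<in> S. k < p k}. y k (p k)) = y i j * (\<Prod>k\<in>{k \<in> S - {i, j}. k < p k}. y k (p k))"
    using finS p(2) by simp
  ultimately show ?thesis by (simp add: pf_term_def)
qed

text \<open>Expansion along the first row: pairings are grouped by the partner j of the least label.
  Cutting out the pair resets p to the identity at i and j, as membership in the smaller
  \<open>pairs_on\<close> requires.\<close>

lemma pfaffian_expansion:
  assumes finS: "finite S" and i: "i \<in> S" and min: "\<And>k. k \<in> S \<Longrightarrow> i \<le> k"
  shows "(\<Sum>p\<in>pairs_on S. pf_term y S p) =
    (\<Sum>j\<in>S - {i}. (-1) ^ between S i j * (y i j * (\<Sum>p\<in>pairs_on (S - {i, j}). pf_term y (S - {i, j}) p)))"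
proof -
  let ?T = "Sigma (S - {i}) (\<lambda>j. pairs_on (S - {i, j}))"
  have "(\<Sum>p\<in>pairs_on S. pf_term y S p) =
      (\<Sum>(j, p)\<in>?T. (-1) ^ between S i j * (y i j * pf_term y (S - {i, j}) p))"
  proof (rule sum.reindex_bij_witness[where i = "\<lambda>(j, p). p(i := j, j := i)" and j = "\<lambda>p. (p i, p(i := i, p i := p i))"])
    fix p assume p: "p \<in> pairs_on S"
    note P = ff_involutionD[OF pairs_on_ff[OF p]]
    have out: "k \<notin> S \<Longrightarrow> p k = k" for k using p by (simp add: pairs_on_def)
    define j where "j = p i"
    have j: "j \<in> S" "j \<noteq> i" "p j = i" using P[OF i] by (simp_all add: j_def)
    show "(case (p i, p(i := i, p i := p i)) of (j, p) \<Rightarrow> p(i := j, j := i)) = p"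
      using j by (auto simp: fun_eq_iff j_def)
    have stay: "p b \<in> S - {i, j}" if "b \<in> S - {i, j}" for b
    proof -
      have b: "b \<in> S" "b \<noteq> i" "b \<noteq> j" using that by auto
      have "p b \<noteq> i" "p b \<noteq> j" using P(3)[OF b(1)] b(2,3) j(3) j_def by auto
      then show ?thesis using P(1)[OF b(1)] by simp
    qed
    have "ff_involution (S - {i, j}) (p(i := i, j := j))"
      unfolding ff_involution_def
    proof
      fix b assume b: "b \<in> S - {i, j}"
      then have "p b \<in> S - {i, j}" "b \<in> S" using stay by auto
      then show "(p(i := i, j := j)) b \<in> S - {i, j} \<and> (p(i := i, j := j)) b \<noteq> b \<and>
          (p(i := i, j := j)) ((p(i := i, j := j)) b) = b"
        using b P[of b] by auto
    qed
    then have "p(i := i, j := j) \<in> pairs_on (S - {i, j})" using out by (simp add: pairs_on_def)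
    then show "(p i, p(i := i, p i := p i)) \<in> ?T" using j by (simp add: j_def)
    have "pf_term y (S - {i, j}) (p(i := i, j := j)) = pf_term y (S - {i, j}) p"
      by (rule pf_term_cong) auto
    then show "(case (p i, p(i := i, p i := p i)) of (j, p) \<Rightarrow> (-1) ^ between S i j * (y i j * pf_term y (S - {i, j}) p)) = pf_term y S p"
      using pf_term_insert_min[OF finS i j(1,2) min p j_def[symmetric], of y] by (simp add: j_def)
  next
    fix t assume "t \<in> ?T"
    then obtain j p where t: "t = (j, p)" "j \<in> S" "j \<noteq> i" and p: "p \<in> pairs_on (S - {i, j})" by auto
    note P = ff_involutionD[OF pairs_on_ff[OF p]]
    have out: "k \<notin> S - {i, j} \<Longrightarrow> p k = k" for k using p by (simp add: pairs_on_def)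
    have fixed: "p i = i" "p j = j" using out by auto
    let ?q = "p(i := j, j := i)"
    have qi: "?q i = j" "?q j = i" using t by auto
    show "((case t of (j, p) \<Rightarrow> p(i := j, j := i)) i, (case t of (j, p) \<Rightarrow> p(i := j, j := i))
          (i := i, (case t of (j, p) \<Rightarrow> p(i := j, j := i)) i := (case t of (j, p) \<Rightarrow> p(i := j, j := i)) i)) = t"
      using t fixed by (auto simp: fun_eq_iff)
    have "ff_involution S ?q"
      unfolding ff_involution_def
    proof
      fix b assume b: "b \<in> S"
      show "?q b \<in> S \<and> ?q b \<noteq> b \<and> ?q (?q b) = b"
      proof (cases "b = i \<or> b = j")
        case True
        then show ?thesis using t i by auto
      next
        case False
        then have "b \<in> S - {i, j}" using b by simp
        note P[OF this]
        then show ?thesis using False by auto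
      qed
    qed
    then have "?q \<in> pairs_on S" using out t i by (simp add: pairs_on_def)
    then show "(case t of (j, p) \<Rightarrow> p(i := j, j := i)) \<in> pairs_on S" using t by simp
  qed
  also have "\<dots> = (\<Sum>j\<in>S - {i}. \<Sum>p\<in>pairs_on (S - {i, j}). (-1) ^ between S i j * (y i j * pf_term y (S - {i, j}) p))"
    by (rule sum.Sigma[symmetric]) (simp_all add: finS finite_pairs_on)
  finally show ?thesis by (simp add: sum_distrib_left)
qed

section \<open>Partition functions with removed nodes as Pfaffians\<close>

context weighted_dimer_nodes
begin

text \<open>After division by the square of \<open>Z {}\<close>, condensation is the first-row
  expansion of a Pfaffian, so both sides satisfy the same recursion; both are 1 for the empty
  set.\<close>

lemma Z_pfaffian:
  assumes Z0: "Z {} \<noteq> 0" and SX: "S \<subseteq> X"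
  shows "Z S / Z {} = (\<Sum>p\<in>pairs_on S. pf_term (\<lambda>i j. Z {i, j} / Z {}) S p)"
  using SX
proof (induction "card S" arbitrary: S rule: less_induct)
  case less
  have finS: "finite S" using less.prems finite_subset by blast
  show ?case
  proof (cases "S = {}")
    case True
    have "pairs_on ({} :: nat set) = {id}" by (auto simp: pairs_on_def ff_involution_def)
    then show ?thesis using Z0 True by (simp add: pf_term_def crossings_on_def)
  next
    case False
    define i where "i = Min S"
    have i: "i \<in> S" "\<And>k. k \<in> S \<Longrightarrow> i \<le> k" using finS False by (auto simp: i_def)
    have "Z S / Z {} = Z {} * Z S / (Z {})\<^sup>2" using Z0 by (simp add: power2_eq_square)
    also have "\<dots> = (\<Sum>j\<in>S - {i}. (-1) ^ between S i j * ((Z {i, j} / Z {}) * (Z (S - {i, j}) / Z {})))"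
    proof -
      have "Z {} * Z S / (Z {})\<^sup>2 =
          (\<Sum>j\<in>S - {i}. (-1) ^ between S i j * (Z {i, j} * Z (S - {i, j})) / (Z {})\<^sup>2)"
        by (simp only: condensation[OF less.prems i] sum_divide_distrib)
      then show ?thesis by (simp add: power2_eq_square)
    qed
    also have "\<dots> = (\<Sum>j\<in>S - {i}. (-1) ^ between S i j * ((Z {i, j} / Z {}) *
        (\<Sum>p\<in>pairs_on (S - {i, j}). pf_term (\<lambda>i j. Z {i, j} / Z {}) (S - {i, j}) p)))"
    proof (rule sum.cong[OF refl])
      fix j assume j: "j \<in> S - {i}"
      have "card (S - {i, j}) < card S" using i finS by (intro psubset_card_mono) auto
      then have IH: "Z (S - {i, j}) / Z {} =
          (\<Sum>p\<in>pairs_on (S - {i, j}). pf_term (\<lambda>i j. Z {i, j} / Z {}) (S - {i, j}) p)"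
        by (rule less.hyps) (use less.prems in blast)
      show "(-1) ^ between S i j * ((Z {i, j} / Z {}) * (Z (S - {i, j}) / Z {})) =
        (-1) ^ between S i j * ((Z {i, j} / Z {}) *
        (\<Sum>p\<in>pairs_on (S - {i, j}). pf_term (\<lambda>i j. Z {i, j} / Z {}) (S - {i, j}) p))"
        by (simp only: IH)
    qed
    also have "\<dots> = (\<Sum>p\<in>pairs_on S. pf_term (\<lambda>i j. Z {i, j} / Z {}) S p)"
      by (rule pfaffian_expansion[symmetric, OF finS i])
    finally show ?thesis .
  qed
qed

text \<open>Since \<open>Z {}\<close> is nonzero, some matching covers G and black and white are
  balanced. Removing two vertices of one colour destroys the balance and leaves no perfect
  matching.\<close>

lemma Z_same_colour:
  assumes Z0: "Z {} \<noteq> 0" and ij: "i \<in> X" "j \<in> X" "i \<noteq> j" "node i \<in> B \<longleftrightarrow> node j \<in> B"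
  shows "Z {i, j} = 0"
proof -
  let ?c = "\<lambda>v. if v \<in> B then 1 else -1 :: int"
  have "PM {} \<noteq> {}" using Z0 by (auto simp: Z_def)
  then obtain M0 where "M0 \<in> PM {}" by blast
  from signed_ends[OF this _ subset_refl] have "sum ?c V = 0"
    using edge_relD(2)[OF _ PM_D(1)[OF \<open>M0 \<in> PM {}\<close>]] by auto
  moreover have False if M: "M \<in> PM {i, j}" and "sum ?c V = 0" for M
  proof -
    have "sum ?c V = (\<Sum>k\<in>{k \<in> {i, j}. node k \<in> V}. ?c (node k))"
      by (rule signed_ends[OF M _ subset_refl]) (use ij edge_relD(2)[OF _ PM_D(1)[OF M]] in auto)
    also have "{k \<in> {i, j}. node k \<in> V} = {i, j}" using ij node_in_V by auto
    finally show False using that ij by (auto split: if_splits)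
  qed
  ultimately have "PM {i, j} = {}" by blast
  then show ?thesis by (simp add: Z_def)
qed

end

section \<open>Double-dimer configurations\<close>

definition mult :: "('v \<times> 'v) set \<Rightarrow> ('v \<times> 'v) set \<Rightarrow> 'v \<times> 'v \<Rightarrow> nat" where
  "mult M M' e = of_bool (e \<in> M) + of_bool (e \<in> M')"

lemma mult_flip: "mult (flip F M M') (flip F M' M) = mult M M'"
  by (auto simp: mult_def flip_def fun_eq_iff)

lemma mult_support: "{e. 0 < mult M M' e} = M \<union> M'"
  by (auto simp: mult_def)

text \<open>Multiplicities are conserved, so an edge given up by the first matching is gained by the
  second, and conversely.\<close>

lemma mult_eq_imp_diff_eq:
  assumes "mult M1 M2 = mult M1' M2'"
  shows "M1 - M1' = M2' - M2" "M1' - M1 = M2 - M2'"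
proof -
  have eq: "of_bool (e \<in> M1) + of_bool (e \<in> M2) = (of_bool (e \<in> M1') + of_bool (e \<in> M2') :: nat)" for e
    using fun_cong[OF assms, of e] by (simp add: mult_def)
  have "e \<in> M1 - M1' \<longleftrightarrow> e \<in> M2' - M2" "e \<in> M1' - M1 \<longleftrightarrow> e \<in> M2 - M2'" for e
    using eq[of e] by (cases "e \<in> M1"; cases "e \<in> M2"; cases "e \<in> M1'"; cases "e \<in> M2'"; simp)+
  then show "M1 - M1' = M2' - M2" "M1' - M1 = M2 - M2'" by blast+
qed

lemma mult_cancel: "mult M a = mult M b \<Longrightarrow> a = b"
  using mult_eq_imp_diff_eq[of M a M b] by blast

section \<open>Decompositions of a configuration into two matchings\<close>

context weighted_dimer_nodes
begin

definition configs :: "('a \<times> 'a \<Rightarrow> nat) set" where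
  "configs = dd_configs V E (node ` X)"

text \<open>A node has degree 1 in a configuration, so exactly one of the two matchings covers it;
  this is why the missed sets are A and its complement. The pairs are ordered.\<close>

definition decomps :: "('a \<times> 'a \<Rightarrow> nat) \<Rightarrow> nat set \<Rightarrow> (('a \<times> 'a) set \<times> ('a \<times> 'a) set) set" where
  "decomps m A = {(M1, M2). M1 \<in> PM A \<and> M2 \<in> PM (X - A) \<and> mult M1 M2 = m}"

lemma decompsD:
  assumes "(M1, M2) \<in> decomps m A" "A \<subseteq> X"
  shows "M1 \<in> PM A" "M2 \<in> PM (X - A)" "mult M1 M2 = m" "X - A \<subseteq> X" "A \<inter> (X - A) = {}" "X = A \<union> (X - A)"
  using assms by (auto simp: decomps_def)

lemma supp_rel_joined:
  assumes "(M1, M2) \<in> decomps m A"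
  shows "(supp_rel E m)\<^sup>* = joined (M1 \<union> M2)"
proof -
  have M: "M1 \<subseteq> E" "M2 \<subseteq> E" "m = mult M1 M2" using assms PM_D(1) by (auto simp: decomps_def)
  have "e \<in> E \<and> 0 < m e \<longleftrightarrow> e \<in> M1 \<union> M2" for e
    using M by (auto simp: mult_def)
  then have "supp_rel E m = edge_rel (M1 \<union> M2)" by (simp add: supp_rel_def edge_rel_def)
  then show ?thesis by (simp add: joined_def)
qed

lemma decomps_support:
  assumes "(M1, M2) \<in> decomps m A" "(M1', M2') \<in> decomps m A'"
  shows "M1 \<union> M2 = M1' \<union> M2'"
  using assms mult_support[of M1 M2] mult_support[of M1' M2'] by (auto simp: decomps_def)

lemma card_edges_at:
  assumes "M \<in> PM A" "v \<in> V"
  shows "card {e \<in> M. fst e = v \<or> snd e = v} = (if v \<in> node ` A then 0 else 1)"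
proof (cases "v \<in> node ` A")
  case True
  have "e \<notin> {e \<in> M. fst e = v \<or> snd e = v}" for e
    using PM_D(2)[OF assms(1), of "fst e" "snd e"] True by auto
  then have "{e \<in> M. fst e = v \<or> snd e = v} = {}" by blast
  then have "card {e \<in> M. fst e = v \<or> snd e = v} = 0" by (simp only: card.empty)
  then show ?thesis using True by simp
next
  case False
  then show ?thesis using assms by (simp add: PM_def perfect_matchings_def)
qed

lemma decomp_in_configs:
  assumes M: "M1 \<in> PM A" "M2 \<in> PM (X - A)" and A: "A \<subseteq> X"
  shows "mult M1 M2 \<in> configs"
proof -
  have sub: "M1 \<subseteq> E" "M2 \<subseteq> E" using PM_D(1) M by blast+
  have "mdeg E (mult M1 M2) v = (if v \<in> node ` X then 1 else 2)" if v: "v \<in> V" for v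
  proof -
    have half: "(\<Sum>e\<in>E. if fst e = v \<or> snd e = v then of_bool (e \<in> M) else 0 :: nat) =
        card {e \<in> M. fst e = v \<or> snd e = v}" if "M \<subseteq> E" for M
    proof -
      have "(\<Sum>e\<in>E. if fst e = v \<or> snd e = v then of_bool (e \<in> M) else 0 :: nat) =
          (\<Sum>e\<in>E. if e \<in> {e \<in> M. fst e = v \<or> snd e = v} then 1 else 0)"
        by (rule sum.cong) auto
      also have "\<dots> = card (E \<inter> {e \<in> M. fst e = v \<or> snd e = v})"
        by (simp only: sum.inter_restrict[OF finE, symmetric] card_eq_sum)
      also have "E \<inter> {e \<in> M. fst e = v \<or> snd e = v} = {e \<in> M. fst e = v \<or> snd e = v}" using that by blast
      finally show ?thesis .
    qed
    have "mdeg E (mult M1 M2) v = (\<Sum>e\<in>E. (if fst e = v \<or> snd e = v then of_bool (e \<in> M1) else 0) +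
        (if fst e = v \<or> snd e = v then of_bool (e \<in> M2) else 0))"
      unfolding mdeg_def mult_def by (rule sum.cong) auto
    also have "\<dots> = card {e \<in> M1. fst e = v \<or> snd e = v} + card {e \<in> M2. fst e = v \<or> snd e = v}"
      unfolding sum.distrib half[OF sub(1)] half[OF sub(2)] ..
    also have "\<dots> = (if v \<in> node ` A then 0 else 1) + (if v \<in> node ` (X - A) then 0 else 1)"
      unfolding card_edges_at[OF M(1) v] card_edges_at[OF M(2) v] ..
    also have "\<dots> = (if v \<in> node ` X then 1 else 2)"
    proof (cases "v \<in> node ` X")
      case True
      then obtain i where i: "i \<in> X" "v = node i" by blast
      then show ?thesis using node_in_image_iff[OF i(1) A] node_in_image_iff[OF i(1), of "X - A"] by auto
    next
      case False
      then show ?thesis using A by auto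
    qed
    finally show ?thesis .
  qed
  moreover have "mult M1 M2 e = 0" if "e \<notin> E" for e using sub that by (auto simp: mult_def)
  ultimately show ?thesis by (simp add: configs_def dd_configs_def)
qed

lemma config_weight:
  assumes "M1 \<subseteq> E" "M2 \<subseteq> E"
  shows "(\<Prod>e\<in>E. wt e ^ mult M1 M2 e) = prod wt M1 * prod wt M2"
proof -
  have half: "(\<Prod>e\<in>E. wt e ^ of_bool (e \<in> M)) = prod wt M" if "M \<subseteq> E" for M
  proof -
    have "(\<Prod>e\<in>E. wt e ^ of_bool (e \<in> M)) = (\<Prod>e\<in>E. if e \<in> M then wt e else 1)"
      by (rule prod.cong) auto
    also have "\<dots> = prod wt (E \<inter> M)" using finE by (simp flip: prod.inter_restrict)
    also have "E \<inter> M = M" using that by blast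
    finally show ?thesis .
  qed
  show ?thesis unfolding mult_def power_add prod.distrib half[OF assms(1)] half[OF assms(2)] ..
qed

text \<open>Orienting a configuration closed up along a pairing of the nodes: a half-edge is a triple of
  an edge, a copy of that edge and the choice of its black end.\<close>

lemma decomp_exists:
  assumes m: "m \<in> configs" and p: "p \<in> pairings n"
  shows "\<exists>A M1 M2. A \<subseteq> X \<and> (M1, M2) \<in> decomps m A"
proof -
  \<comment> \<open>The vertex at which a half-edge (e, k, s) sits: k numbers the copies of e, and s
    is true at the black end.\<close>
  define vert :: "('a \<times> 'a) \<times> nat \<times> bool \<Rightarrow> 'a" where "vert = (\<lambda>(e, k, s). if s then fst e else snd e)"
  define H where "H = (\<lambda>v. Sigma E (\<lambda>e. {..<m e} \<times> {s. (if s then fst e else snd e) = v}))"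
  have m0: "m e = 0" if "e \<notin> E" for e using m that unfolding configs_def dd_configs_def by blast
  have deg: "mdeg E m v = (if v \<in> node ` X then 1 else 2)" if "v \<in> V" for v
    using m that by (simp add: configs_def dd_configs_def)
  have memH: "h \<in> H v \<longleftrightarrow> fst h \<in> E \<and> fst (snd h) < m (fst h) \<and> vert h = v" for h v
    by (cases h) (simp add: H_def vert_def)
  have ends: "fst e \<in> V" "snd e \<in> V" "fst e \<in> B" "snd e \<notin> B" if "e \<in> E" for e
    using edge_ends[of "fst e" "snd e"] that by simp_all
  have cardH: "card (H v) = mdeg E m v" for v
  proof -
    have "card {s. (if s then fst e else snd e) = v} = (if fst e = v \<or> snd e = v then 1 else 0)" if "e \<in> E" for e
    proof -
      have ne: "fst e \<noteq> snd e" using ends[OF that] by metis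
      have "{s. (if s then fst e else snd e) = v} = (if fst e = v then {True} else if snd e = v then {False} else {})"
        using ne by (auto split: if_splits)
      then show ?thesis by simp
    qed
    then have "(\<Sum>e\<in>E. card ({..<m e} \<times> {s. (if s then fst e else snd e) = v})) = mdeg E m v"
      unfolding mdeg_def by (intro sum.cong) (simp_all add: card_cartesian_product)
    then show ?thesis unfolding H_def using finE by (subst card_SigmaI) auto
  qed
  have finH: "finite (H v)" for v unfolding H_def using finE by auto
  define HH where "HH = (\<Union>v\<in>V. H v)"
  have memHH: "h \<in> HH \<longleftrightarrow> fst h \<in> E \<and> fst (snd h) < m (fst h)" for h
  proof -
    have "vert h \<in> V" if "fst h \<in> E" using ends[OF that] by (cases h) (simp add: vert_def)
    then show ?thesis unfolding HH_def using memH by blast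
  qed
  have inH: "h \<in> H (vert h)" "vert h \<in> V" if "h \<in> HH" for h
    using that memH by (auto simp: HH_def)
  have finHH: "finite HH" unfolding HH_def using finV finH by blast
  define lab where "lab = the_inv_into X node"
  have lab: "lab (node i) = i" if "i \<in> X" for i
    unfolding lab_def using the_inv_into_f_f[OF inj_node] that by simp
  have pff: "ff_involution X p" using p by (simp add: pairings_eq_pairs_on pairs_on_ff)
  note P = ff_involutionD[OF pff]
  \<comment> \<open>The closing-up: the half-edge at a node is continued at the paired node, and all
    other vertices stay put.\<close>
  define \<sigma> where "\<sigma> = (\<lambda>v. if v \<in> node ` X then node (p (lab v)) else v)"
  have \<sigma>: "\<sigma> (\<sigma> v) = v \<and> (\<sigma> v \<in> V \<longleftrightarrow> v \<in> V)" for v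
  proof (cases "v \<in> node ` X")
    case True
    then obtain i where i: "i \<in> X" "v = node i" by blast
    then show ?thesis using lab P[OF i(1)] node_in_V by (simp add: \<sigma>_def)
  qed (simp add: \<sigma>_def)
  \<comment> \<open>The successor in the closed-up configuration: the second half-edge at an inner
    vertex, or the single half-edge at the paired node.\<close>
  define other where "other = (\<lambda>h. THE h'. h' \<in> H (\<sigma> (vert h)) \<and> h' \<noteq> h)"
  have ex1: "\<exists>!h'. h' \<in> H (\<sigma> (vert h)) \<and> h' \<noteq> h" if h: "h \<in> HH" for h
  proof (cases "vert h \<in> node ` X")
    case True
    then obtain i where i: "i \<in> X" "vert h = node i" by blast
    have s: "\<sigma> (vert h) = node (p i)" using i lab by (simp add: \<sigma>_def)
    have "card (H (node (p i))) = 1" using cardH deg node_in_V P(1)[OF i(1)] by simp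
    then obtain h' where h': "H (node (p i)) = {h'}" by (rule card_1_singletonE)
    have "vert h' = node (p i)" using h' memH by blast
    then have "h' \<noteq> h" using i P(1,2)[OF i(1)] node_eq_iff by metis
    then show ?thesis unfolding s h' by auto
  next
    case False
    then have s: "\<sigma> (vert h) = vert h" by (simp add: \<sigma>_def)
    have "card (H (vert h)) = 2" using cardH deg[OF inH(2)[OF h]] False by simp
    then have "card (H (vert h) - {h}) = 1" using inH(1)[OF h] finH by simp
    then obtain h' where h': "H (vert h) - {h} = {h'}" by (rule card_1_singletonE)
    then show ?thesis unfolding s by (metis Diff_iff insertE insertI1 singletonD singletonI)
  qed
  have other: "other h \<in> H (\<sigma> (vert h))" "other h \<noteq> h" if "h \<in> HH" for h
    using theI'[OF ex1[OF that]] by (simp_all add: other_def)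
  have other_eq: "other h = h'" if "h \<in> HH" "h' \<in> H (\<sigma> (vert h))" "h' \<noteq> h" for h h'
    unfolding other_def by (rule the1_equality[OF ex1[OF that(1)]]) (use that in simp)
  have "ff_involution HH other"
    unfolding ff_involution_def
  proof
    fix h assume h: "h \<in> HH"
    have v': "vert (other h) = \<sigma> (vert h)" using other(1)[OF h] memH by blast
    have oHH: "other h \<in> HH" using other(1)[OF h] inH(2)[OF h] \<sigma> unfolding HH_def by blast
    have "other (other h) = h"
      by (rule other_eq[OF oHH]) (use inH(1)[OF h] \<sigma> other(2)[OF h] v' in auto)
    then show "other h \<in> HH \<and> other h \<noteq> h \<and> other (other h) = h" using oHH other(2)[OF h] by blast
  qed
  moreover have "ff_involution HH (\<lambda>(e, k, s). (e, k, \<not> s))"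
    unfolding ff_involution_def by (auto simp: memHH)
  \<comment> \<open>T is an orientation: of each edge copy exactly one half-edge is a tail, and at
    each passage from one copy to the next one half-edge enters and the other leaves.\<close>
  ultimately obtain T where T: "is_section HH other T" "is_section HH (\<lambda>(e, k, s). (e, k, \<not> s)) T"
    using common_section_exists[OF finHH] by blast
  \<comment> \<open>\<open>N True\<close> takes the edges with a copy directed from black to white,
    \<open>N False\<close> those with a copy directed from white to black.\<close>
  define N where "N = (\<lambda>b. {e. \<exists>k < m e. (e, k, True) \<in> T \<longleftrightarrow> b})"
  \<comment> \<open>The condition that the copy of h goes to \<open>N b\<close>, phrased so that it
    can be tested at either of its two half-edges.\<close>
  define sel where "sel = (\<lambda>b h. h \<in> T \<longleftrightarrow> (snd (snd h) \<longleftrightarrow> b))"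
  have NE: "e \<in> E" if "e \<in> N b" for e b
    using that m0[of e] by (cases "e \<in> E") (auto simp: N_def)
  have sideT: "(e, k, True) \<in> T \<longleftrightarrow> (e, k, False) \<notin> T" if "e \<in> E" "k < m e" for e k
    using is_sectionD[OF T(2), of "(e, k, False)"] that by (simp add: memHH)
  have N_iff: "e \<in> N b \<longleftrightarrow> (\<exists>k. (e, k, s) \<in> HH \<and> sel b (e, k, s))" for e b s
  proof (cases "e \<in> E")
    case True
    have "((e, k, True) \<in> T \<longleftrightarrow> b) \<longleftrightarrow> sel b (e, k, s)" if "k < m e" for k
      using sideT[OF True that] by (cases s) (auto simp: sel_def)
    then show ?thesis using True by (auto simp: N_def memHH)
  next
    case False
    then show ?thesis using m0[OF False] by (simp add: N_def memHH)
  qed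
  have vs: "snd (snd h) \<longleftrightarrow> vert h \<in> B" if "h \<in> HH" for h
    using that ends by (cases h) (auto simp: memHH vert_def)
  have N_at: "(\<exists>e. e \<in> N b \<and> (fst e = v \<or> snd e = v)) \<longleftrightarrow> (\<exists>h\<in>H v. sel b h)" if v: "v \<in> V" for b v
  proof
    assume "\<exists>e. e \<in> N b \<and> (fst e = v \<or> snd e = v)"
    then obtain e where e: "e \<in> N b" "fst e = v \<or> snd e = v" by blast
    then obtain k where k: "(e, k, fst e = v) \<in> HH" "sel b (e, k, fst e = v)" using N_iff by blast
    have "vert (e, k, fst e = v) = v" using e(2) by (auto simp: vert_def)
    then show "\<exists>h\<in>H v. sel b h" using k inH(1) by metis
  next
    assume "\<exists>h\<in>H v. sel b h"
    then obtain e k s where h: "(e, k, s) \<in> H v" "sel b (e, k, s)" by (metis prod_cases3)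
    then have "(e, k, s) \<in> HH" using v unfolding HH_def by blast
    then have "e \<in> N b" using N_iff h(2) by blast
    moreover have "fst e = v \<or> snd e = v" using h(1) memH by (auto simp: vert_def split: if_splits)
    ultimately show "\<exists>e. e \<in> N b \<and> (fst e = v \<or> snd e = v)" by blast
  qed
  have sel_not: "sel (\<not> b) h \<longleftrightarrow> \<not> sel b h" for b h by (auto simp: sel_def)
  \<comment> \<open>Two half-edges at one inner vertex are at ends of the same colour but differ in
    T, so their copies go to different matchings.\<close>
  have sel_other: "sel b h' \<longleftrightarrow> \<not> sel b h" if h: "h \<in> HH" "h' \<in> H (vert h)" "h' \<noteq> h" "vert h \<notin> node ` X" for b h h'
  proof -
    have "\<sigma> (vert h) = vert h" using h(4) by (simp add: \<sigma>_def)
    then have o: "other h = h'" using other_eq[OF h(1)] h(2,3) by simp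
    have "h' \<in> HH" using h(2) inH(2)[OF h(1)] unfolding HH_def by blast
    moreover have "vert h' = vert h" using h(2) memH by blast
    ultimately have "snd (snd h') = snd (snd h)" using vs h(1) by metis
    moreover have "h' \<in> T \<longleftrightarrow> h \<notin> T" using is_sectionD[OF T(1) h(1)] o by simp
    ultimately show ?thesis by (auto simp: sel_def)
  qed
  have node_single: "\<exists>h. H v = {h}" if "v \<in> node ` X" for v
  proof -
    have "card (H v) = 1" using cardH deg[of v] that nodeV by auto
    then show ?thesis by (metis card_1_singletonE)
  qed
  have uniq: "h = h'" if h: "h \<in> H v" "h' \<in> H v" "sel b h" "sel b h'" "v \<in> V" for h h' b v
  proof (rule ccontr)
    assume ne: "h \<noteq> h'"
    have hH: "h \<in> HH" "vert h = v" using h(1,5) memH unfolding HH_def by blast+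
    show False
    proof (cases "v \<in> node ` X")
      case True
      then obtain g where "H v = {g}" using node_single by blast
      then have "h = g" "h' = g" using h(1,2) by simp_all
      then show False using ne by simp
    next
      case False
      then show False using sel_other[OF hH(1), of h' b] h(2-4) hH(2) ne by blast
    qed
  qed
  define A where "A = {i \<in> X. \<not> (\<exists>h\<in>H (node i). sel True h)}"
  have AX: "A \<subseteq> X" by (auto simp: A_def)
  have nodeA: "node i \<in> node ` A \<longleftrightarrow> \<not> (\<exists>h\<in>H (node i). sel True h)"
    "node i \<in> node ` (X - A) \<longleftrightarrow> \<not> (\<exists>h\<in>H (node i). sel False h)" if i: "i \<in> X" for i
  proof -
    obtain h where h: "H (node i) = {h}" using node_single i by blast
    show "node i \<in> node ` A \<longleftrightarrow> \<not> (\<exists>h\<in>H (node i). sel True h)"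
      using node_in_image_iff[OF i AX] i by (simp add: A_def)
    show "node i \<in> node ` (X - A) \<longleftrightarrow> \<not> (\<exists>h\<in>H (node i). sel False h)"
      using node_in_image_iff[OF i, of "X - A"] i sel_not[of True h] by (simp add: A_def h)
  qed
  have cover: "(\<exists>h\<in>H v. sel b h) \<longleftrightarrow> v \<notin> node ` (if b then A else X - A)" if v: "v \<in> V" for b v
  proof (cases "v \<in> node ` X")
    case True
    then obtain i where i: "i \<in> X" "v = node i" by blast
    show ?thesis using nodeA[OF i(1)] unfolding i(2) by (cases b) simp_all
  next
    case False
    have "card (H v) = 2" using cardH deg[OF v] False by simp
    then obtain h h' where hh: "H v = {h, h'}" "h \<noteq> h'" by (meson card_2_iff)
    have "h \<in> HH" "vert h = v" using hh v memH unfolding HH_def by blast+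
    then have "sel b h' \<longleftrightarrow> \<not> sel b h" using sel_other[of h h' b] hh False by simp
    then have "\<exists>h\<in>H v. sel b h" using hh by blast
    moreover have "v \<notin> node ` (if b then A else X - A)" using False AX by (auto split: if_splits)
    ultimately show ?thesis by blast
  qed
  have NPM: "N b \<in> PM (if b then A else X - A)" for b
  proof (rule PM_I)
    show "N b \<subseteq> E" using NE by blast
    show "fst e \<in> V - node ` (if b then A else X - A) \<and> snd e \<in> V - node ` (if b then A else X - A)" if e: "e \<in> N b" for e
    proof -
      have V: "fst e \<in> V" "snd e \<in> V" using ends NE[OF e] by blast+
      have "\<exists>h\<in>H (fst e). sel b h" "\<exists>h\<in>H (snd e). sel b h"
        using N_at[OF V(1)] N_at[OF V(2)] e by blast+
      then show ?thesis using cover[OF V(1)] cover[OF V(2)] V by blast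
    qed
    show "\<exists>e. e \<in> N b \<and> (fst e = v \<or> snd e = v)" if "v \<in> V - node ` (if b then A else X - A)" for v
      using N_at cover that by blast
    show "e = e'" if e: "e \<in> N b" "e' \<in> N b" "fst e = v \<or> snd e = v" "fst e' = v \<or> snd e' = v" for e e' v
    proof -
      have v: "v \<in> V" using ends NE[OF e(1)] e(3) by blast
      obtain k where k: "(e, k, fst e = v) \<in> HH" "sel b (e, k, fst e = v)" using N_iff e(1) by blast
      obtain k' where k': "(e', k', fst e' = v) \<in> HH" "sel b (e', k', fst e' = v)" using N_iff e(2) by blast
      have "vert (e, k, fst e = v) = v" "vert (e', k', fst e' = v) = v" using e(3,4) by (auto simp: vert_def)
      then have "(e, k, fst e = v) \<in> H v" "(e', k', fst e' = v) \<in> H v" using k k' inH(1) by metis+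
      then have "(e, k, fst e = v) = (e', k', fst e' = v)" using uniq k(2) k'(2) v by blast
      then show ?thesis by simp
    qed
  qed
  have "mult (N True) (N False) e = m e" for e
  proof (cases "e \<in> E")
    case False
    then have "e \<notin> N True" "e \<notin> N False" using NE by blast+
    then show ?thesis using m0[OF False] by (simp add: mult_def)
  next
    case True
    have "m e \<le> mdeg E m (fst e)"
    proof -
      have "m e = (if fst e = fst e \<or> snd e = fst e then m e else 0)" by simp
      also have "\<dots> \<le> mdeg E m (fst e)"
        unfolding mdeg_def using member_le_sum[OF True, of "\<lambda>e'. if fst e' = fst e \<or> snd e' = fst e then m e' else 0"] finE by simp
      finally show ?thesis .
    qed
    then have "m e \<le> 2" using deg[of "fst e"] ends[OF True] by (simp split: if_splits)
    then consider "m e = 0" | "m e = 1" | "m e = 2" by linarith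
    then show ?thesis
    proof cases
      case 1
      then show ?thesis by (simp add: mult_def N_def)
    next
      case 2
      then show ?thesis by (cases "(e, 0, True) \<in> T") (simp_all add: mult_def N_def)
    next
      case 3
      have h: "(e, 0, True) \<in> H (fst e)" "(e, 1, True) \<in> H (fst e)"
        using 3 True by (simp_all add: memH vert_def)
      have hH: "(e, 0, True) \<in> HH" using 3 True by (simp add: memHH)
      have "fst e \<notin> node ` X"
      proof
        assume "fst e \<in> node ` X"
        then obtain g where "H (fst e) = {g}" using node_single by blast
        then have "(e, 0, True) = g" "(e, 1, True) = g" using h by blast+
        then have "(e, 0 :: nat, True) = (e, 1, True)" by (simp only:)
        then show False by simp
      qed
      \<comment> \<open>The two copies of a doubled edge are consecutive at their black end, hence
        oppositely directed, and each matching receives one.\<close>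
      then have "sel True (e, 1, True) \<longleftrightarrow> \<not> sel True (e, 0, True)"
        using sel_other[OF hH, of "(e, 1, True)" True] h by (simp add: vert_def)
      then have "(e, 1, True) \<in> T \<longleftrightarrow> (e, 0, True) \<notin> T" by (simp add: sel_def)
      then have "e \<in> N True" "e \<in> N False"
        using 3 by (auto simp: N_def intro: exI[of _ 0] exI[of _ 1])
      then show ?thesis using 3 by (simp add: mult_def)
    qed
  qed
  then have "(N True, N False) \<in> decomps m A"
    using NPM[of True] NPM[of False] by (simp add: decomps_def fun_eq_iff)
  then show ?thesis using AX by blast
qed

text \<open>The pairing read from the superposition is the one traced by the paths of m, so m counts
  for exactly one \<tau> in \<open>ZDD\<close>. The section property is the colour rule of
  \<open>path_ends\<close>, with membership in A and colour merged into one bit.\<close>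

lemma decomp_partner:
  assumes d: "(M1, M2) \<in> decomps m A" and A: "A \<subseteq> X"
  shows "partner (M1 \<union> M2) X \<in> pairings n" "planar_pairing n (partner (M1 \<union> M2) X)"
    "is_section X (partner (M1 \<union> M2) X) {i \<in> X. (i \<in> A) \<noteq> (node i \<in> B)}"
    "\<And>\<tau>. \<tau> \<in> pairings n \<Longrightarrow> (\<forall>i\<in>X. (node i, node (\<tau> i)) \<in> (supp_rel E m)\<^sup>*) \<longleftrightarrow> \<tau> = partner (M1 \<union> M2) X"
proof -
  note D = decompsD[OF d A]
  note props = partner_props[OF D(1,2) A D(4,5,6)]
  let ?q = "partner (M1 \<union> M2) X"
  show q: "?q \<in> pairings n"
    unfolding pairings_eq_pairs_on by (rule partner_pairs_on[OF D(1,2) A D(4,5,6)])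
  show "planar_pairing n ?q"
    unfolding planar_pairing_def using q partner_noncrossing[OF D(1,2) A D(4,5,6)] by blast
  have "i \<in> {i \<in> X. (i \<in> A) \<noteq> (node i \<in> B)} \<longleftrightarrow> ?q i \<notin> {i \<in> X. (i \<in> A) \<noteq> (node i \<in> B)}" if i: "i \<in> X" for i
    using props(1,4)[OF i] i by blast
  then show "is_section X ?q {i \<in> X. (i \<in> A) \<noteq> (node i \<in> B)}"
    unfolding is_section_def by blast
  show "(\<forall>i\<in>X. (node i, node (\<tau> i)) \<in> (supp_rel E m)\<^sup>*) \<longleftrightarrow> \<tau> = ?q" if \<tau>: "\<tau> \<in> pairings n" for \<tau>
  proof
    assume *: "\<forall>i\<in>X. (node i, node (\<tau> i)) \<in> (supp_rel E m)\<^sup>*"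
    have ff: "ff_involution X \<tau>" and out: "\<And>i. i \<notin> X \<Longrightarrow> \<tau> i = i"
      using \<tau> unfolding pairings_eq_pairs_on pairs_on_def by blast+
    show "\<tau> = ?q"
    proof
      fix i
      show "\<tau> i = ?q i"
      proof (cases "i \<in> X")
        case True
        have "(node i, node (\<tau> i)) \<in> joined (M1 \<union> M2)" using * True supp_rel_joined[OF d] by blast
        then show ?thesis using props(5)[OF True ff_involutionD(1,2)[OF ff True]] by simp
      next
        case False
        then show ?thesis using out[OF False] unfolding partner_def by (simp only: if_False)
      qed
    qed
  next
    assume "\<tau> = ?q"
    then show "\<forall>i\<in>X. (node i, node (\<tau> i)) \<in> (supp_rel E m)\<^sup>*"
      using props(3) supp_rel_joined[OF d] by blast
  qed
qed

text \<open>The colour rule is also sufficient: starting from one decomposition, any admissible A is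
  reached by recolouring whole paths.\<close>

lemma decomps_nonempty_iff:
  assumes d: "(M1, M2) \<in> decomps m A0" and A0: "A0 \<subseteq> X" and A: "A \<subseteq> X"
  shows "decomps m A \<noteq> {} \<longleftrightarrow> is_section X (partner (M1 \<union> M2) X) {i \<in> X. (i \<in> A) \<noteq> (node i \<in> B)}"
proof
  assume "decomps m A \<noteq> {}"
  then obtain M1' M2' where d': "(M1', M2') \<in> decomps m A" by auto
  then show "is_section X (partner (M1 \<union> M2) X) {i \<in> X. (i \<in> A) \<noteq> (node i \<in> B)}"
    using decomp_partner(3)[OF d' A] decomps_support[OF d' d] by simp
next
  let ?q = "partner (M1 \<union> M2) X"
  assume sec: "is_section X ?q {i \<in> X. (i \<in> A) \<noteq> (node i \<in> B)}"
  note D = decompsD[OF d A0]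
  note sec0 = decomp_partner(3)[OF d A0]
  have ff: "ff_involution X ?q"
    using decomp_partner(1)[OF d A0] by (simp only: pairings_eq_pairs_on pairs_on_ff)
  \<comment> \<open>The labels that have to change sides. Both parity sets are sections of the path
    pairing, so their difference contains both ends of a path or neither.\<close>
  define L where "L = sym_diff A A0"
  have LX: "L \<subseteq> X" using A A0 by (auto simp: L_def)
  have qL: "?q i \<in> L \<longleftrightarrow> i \<in> L" if i: "i \<in> X" for i
    using is_sectionD[OF sec i] is_sectionD[OF sec0 i] i ff_involutionD(1)[OF ff i] by (simp add: L_def) blast
  define F where "F = joined (M1 \<union> M2) `` (node ` L)"
  have lab: "node i \<in> F \<longleftrightarrow> i \<in> L" if i: "i \<in> X" for i
  proof
    assume "node i \<in> F"
    then obtain j where j: "j \<in> L" "(node j, node i) \<in> joined (M1 \<union> M2)" by (auto simp: F_def)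
    then have "j \<in> X" using LX by blast
    then have "i = j \<or> i = ?q j"
      using path_labels[OF D(1,2) A0 D(4,5,6) _ i] j(2) by blast
    then show "i \<in> L" using j(1) qL[OF \<open>j \<in> X\<close>] by blast
  next
    assume "i \<in> L"
    then show "node i \<in> F" using joined_refl unfolding F_def by blast
  qed
  have cl: "flip_closed (M1 \<union> M2) F" "flip_closed (M2 \<union> M1) F"
    unfolding F_def Un_commute[of M2] by (rule flip_closed_joined)+
  have s1: "(A0 - {i. node i \<in> F}) \<union> ((X - A0) \<inter> {i. node i \<in> F}) = A"
    and s2: "((X - A0) - {i. node i \<in> F}) \<union> (A0 \<inter> {i. node i \<in> F}) = X - A"
    using lab A A0 unfolding L_def by blast+
  have "flip F M1 M2 \<in> PM A" "flip F M2 M1 \<in> PM (X - A)"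
    using flip_PM[OF D(1,2) A0 D(4) cl(1)] flip_PM[OF D(2,1,4) A0 cl(2)] unfolding s1 s2 by auto
  then have "(flip F M1 M2, flip F M2 M1) \<in> decomps m A"
    using D(3) by (simp add: decomps_def mult_flip)
  then show "decomps m A \<noteq> {}" by blast
qed

text \<open>With A fixed, the paths leave no freedom and doubled edges lie in both matchings. What
  can be changed is the alternation along each loop, so the decompositions correspond to the sets of
  loops to be recoloured.\<close>

lemma card_decomps:
  assumes d: "(M1, M2) \<in> decomps m A" and A: "A \<subseteq> X"
  shows "card (decomps m A) = 2 ^ nloops V E (node ` X) m"
proof -
  note D = decompsD[OF d A]
  let ?D = "M1 \<union> M2" and ?J = "joined (M1 \<union> M2)"
  define \<C> where "\<C> = {C \<in> V // ?J. C \<inter> node ` X = {} \<and> card C > 2}"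
  have DE: "?D \<subseteq> E" using PM_D(1) D(1,2) by blast
  have nl: "nloops V E (node ` X) m = card \<C>"
    unfolding nloops_def \<C>_def supp_rel_joined[OF d] ..
  have disj: "pairwise disjnt (V // ?J)"
    unfolding joined_def by (rule pairwise_disjnt_classes[OF sym_edge_rel])
  have noempty: "{} \<notin> V // ?J" unfolding joined_def by (rule empty_not_class)
  have finC: "finite \<C>" unfolding \<C>_def using finV by (simp add: quotient_def)
  have classV: "C \<subseteq> V" if "C \<in> V // ?J" for C
    using that joined_V[OF _ _ DE] unfolding quotient_def by blast
  have class_closed: "flip_closed ?D (\<Union>\<F>)" if "\<F> \<subseteq> V // ?J" for \<F>
  proof -
    have "\<F> \<subseteq> (\<lambda>u. ?J `` {u}) ` V" using that unfolding quotient_def by blast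
    then obtain U where "\<F> = (\<lambda>u. ?J `` {u}) ` U" by (rule subset_imageE)
    then have "\<Union>\<F> = ?J `` U" by blast
    then show ?thesis using flip_closed_joined by simp
  qed
  have class_joined: "(u, v) \<in> ?J" if C: "C \<in> V // ?J" "u \<in> C" "v \<in> C" for C u v
  proof -
    obtain w where "C = ?J `` {w}" using C(1) unfolding quotient_def by blast
    then show ?thesis using C(2,3) joined_sym joined_trans by blast
  qed
  have both: "\<exists>e e'. e \<in> M1 \<and> e' \<in> M2 \<and> (fst e = v \<or> snd e = v) \<and> (fst e' = v \<or> snd e' = v)"
    if "v \<in> V" "v \<notin> node ` X" for v
  proof -
    have "v \<in> V - node ` A" "v \<in> V - node ` (X - A)" using that A by blast+
    then show ?thesis using PM_D(3)[OF D(1)] PM_D(3)[OF D(2)] by blast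
  qed
  let ?\<Phi> = "\<lambda>\<F>. (flip (\<Union>\<F>) M1 M2, flip (\<Union>\<F>) M2 M1)"
  have into: "?\<Phi> \<F> \<in> decomps m A" if F: "\<F> \<subseteq> \<C>" for \<F>
  proof -
    have FV: "\<F> \<subseteq> V // ?J" using F unfolding \<C>_def by blast
    have cl: "flip_closed ?D (\<Union>\<F>)" "flip_closed (M2 \<union> M1) (\<Union>\<F>)"
      using class_closed[OF FV] by (simp_all add: Un_commute)
    have no: "node i \<notin> \<Union>\<F>" if "i \<in> X" for i
      using F that unfolding \<C>_def by blast
    have s1: "(A - {i. node i \<in> \<Union>\<F>}) \<union> ((X - A) \<inter> {i. node i \<in> \<Union>\<F>}) = A"
      and s2: "((X - A) - {i. node i \<in> \<Union>\<F>}) \<union> (A \<inter> {i. node i \<in> \<Union>\<F>}) = X - A"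
      using no A by blast+
    have "flip (\<Union>\<F>) M1 M2 \<in> PM A" "flip (\<Union>\<F>) M2 M1 \<in> PM (X - A)"
      using flip_PM[OF D(1,2) A D(4) cl(1)] flip_PM[OF D(2,1,4) A cl(2)] unfolding s1 s2 by auto
    then show ?thesis using D(3) by (simp add: decomps_def mult_flip)
  qed
  \<comment> \<open>If only one of the two families recolours C, the matchings agree on C. Then C
    consists of the two ends of one doubled edge and is no loop.\<close>
  have sub: "\<F> \<subseteq> \<G>" if F: "\<F> \<subseteq> \<C>" and G: "\<G> \<subseteq> \<C>" and eq: "flip (\<Union>\<F>) M1 M2 = flip (\<Union>\<G>) M1 M2" for \<F> \<G>
  proof (rule subsetI, rule ccontr)
    fix C assume C: "C \<in> \<F>" "C \<notin> \<G>"
    have CC: "C \<in> V // ?J" "C \<inter> node ` X = {}" "card C > 2" using C(1) F unfolding \<C>_def by blast+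
    have CF: "u \<in> \<Union>\<F>" "u \<notin> \<Union>\<G>" if u: "u \<in> C" for u
    proof -
      show "u \<in> \<Union>\<F>" using C(1) u by blast
      show "u \<notin> \<Union>\<G>"
      proof
        assume "u \<in> \<Union>\<G>"
        then obtain C' where C': "C' \<in> \<G>" "u \<in> C'" by blast
        then have "C' \<in> V // ?J" "C' \<noteq> C" using G C(2) unfolding \<C>_def by blast+
        then have "disjnt C' C" using disj CC(1) unfolding pairwise_def by blast
        then show False using C'(2) u by (simp add: disjnt_iff)
      qed
    qed
    have same: "e \<in> M1 \<longleftrightarrow> e \<in> M2" if "fst e \<in> C" for e
    proof -
      have "e \<in> flip (\<Union>\<F>) M1 M2 \<longleftrightarrow> e \<in> M2" "e \<in> flip (\<Union>\<G>) M1 M2 \<longleftrightarrow> e \<in> M1"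
        using CF[OF that] unfolding flip_def by blast+
      then show ?thesis using eq by simp
    qed
    have clC: "flip_closed ?D C" using class_closed[of "{C}"] CC(1) by simp
    have "C \<noteq> {}" using CC(3) by auto
    then obtain v where v: "v \<in> C" by blast
    have vV: "v \<in> V" "v \<notin> node ` X" using v CC classV by blast+
    obtain e where e: "e \<in> M1" "fst e = v \<or> snd e = v" using both[OF vV] by blast
    have "fst e \<in> C" using clC e v unfolding flip_closed_def by blast
    then have e2: "e \<in> M2" using same e(1) by blast
    have "u \<in> {fst e, snd e}" if u: "u \<in> C" for u
    proof -
      have "(v, u) \<in> (edge_rel ?D)\<^sup>*" using class_joined[OF CC(1) v u] by (simp add: joined_def)
      then show ?thesis
      proof (rule rtrancl_closed)
        show "v \<in> {fst e, snd e}" using e(2) by blast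
        fix a b assume ab: "(a, b) \<in> edge_rel ?D" "a \<in> {fst e, snd e}"
        then obtain g where g: "g \<in> ?D" "g = (a, b) \<or> g = (b, a)" by (auto simp: edge_rel_def)
        have ga: "fst g = a \<or> snd g = a" and ea: "fst e = a \<or> snd e = a" using g(2) ab(2) by auto
        have "g = e" using g(1) PM_D(4)[OF D(1) _ e(1) ga ea] PM_D(4)[OF D(2) _ e2 ga ea] by blast
        then show "b \<in> {fst e, snd e}" using g(2) by auto
      qed
    qed
    then have "card C \<le> card {fst e, snd e}" by (intro card_mono) auto
    also have "\<dots> \<le> 2" by (simp add: card_insert_if)
    finally show False using CC(3) by simp
  qed
  have onto: "\<exists>\<F>\<subseteq>\<C>. ?\<Phi> \<F> = (N1, N2)" if N: "(N1, N2) \<in> decomps m A" for N1 N2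
  proof -
    note D' = decompsD[OF N A]
    have meq: "mult M1 M2 = mult N1 N2" using D(3) D'(3) by simp
    have d1: "M1 - N1 = N2 - M2" and d2: "N1 - M1 = M2 - N2"
      using mult_eq_imp_diff_eq[OF meq] by simp_all
    \<comment> \<open>The vertices at which the new first matching differs from the old one; F turns
      out to be a union of loops.\<close>
    define F where "F = {v. \<exists>e\<in>M1 - N1. fst e = v \<or> snd e = v}"
    have F_swap: "\<exists>e'\<in>N1 - M1. fst e' = v \<or> snd e' = v" if v: "v \<in> F" for v
    proof -
      obtain e where e: "e \<in> M1" "e \<notin> N1" "fst e = v \<or> snd e = v" using v by (auto simp: F_def)
      have "v \<in> V - node ` A" using PM_D(2)[OF D(1), of "fst e" "snd e"] e by auto
      then obtain e' where e': "e' \<in> N1" "fst e' = v \<or> snd e' = v" using PM_D(3)[OF D'(1)] by blast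
      have "e' \<notin> M1"
      proof
        assume "e' \<in> M1"
        then have "e' = e" using PM_D(4)[OF D(1) _ e(1) e'(2) e(3)] by blast
        then show False using e' e(2) by simp
      qed
      then show ?thesis using e' by blast
    qed
    have F_edge1: "e \<in> M1 - N1" if ev: "e \<in> M1" "fst e = v \<or> snd e = v" "v \<in> F" for e v
    proof -
      obtain f where f: "f \<in> M1 - N1" "fst f = v \<or> snd f = v" using ev(3) by (auto simp: F_def)
      then have "f = e" using PM_D(4)[OF D(1) _ ev(1) f(2) ev(2)] by blast
      then show ?thesis using f by simp
    qed
    have F_edge2: "e \<in> M2 - N2" if ev: "e \<in> M2" "fst e = v \<or> snd e = v" "v \<in> F" for e v
    proof -
      obtain f where f: "f \<in> M2 - N2" "fst f = v \<or> snd f = v" using F_swap[OF ev(3)] d2 by blast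
      then have "f = e" using PM_D(4)[OF D(2) _ ev(1) f(2) ev(2)] by blast
      then show ?thesis using f by simp
    qed
    have FI1: "fst e \<in> F \<and> snd e \<in> F" if "e \<in> M1 - N1" for e using that by (auto simp: F_def)
    have FI2: "fst e \<in> F \<and> snd e \<in> F" if e: "e \<in> M2 - N2" for e
    proof -
      have eN: "e \<in> N1" "e \<notin> M1" using e d2 by blast+
      have "v \<in> F" if v: "fst e = v \<or> snd e = v" for v
      proof -
        have "v \<in> V - node ` A" using PM_D(2)[OF D'(1), of "fst e" "snd e"] eN v by auto
        then obtain g where g: "g \<in> M1" "fst g = v \<or> snd g = v" using PM_D(3)[OF D(1)] by blast
        have "g \<notin> N1"
        proof
          assume "g \<in> N1"
          then have "g = e" using PM_D(4)[OF D'(1) _ eN(1) g(2) v] by blast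
          then show False using g(1) eN(2) by simp
        qed
        then show ?thesis using g by (auto simp: F_def)
      qed
      then show ?thesis by blast
    qed
    have FV: "F \<subseteq> V" using PM_D(1)[OF D(1)] edge_ends by (force simp: F_def)
    have Fnode: "F \<inter> node ` X = {}"
    proof -
      have False if v: "v \<in> F" "v = node i" "i \<in> X" for v i
      proof -
        obtain e where e: "e \<in> M1 - N1" "fst e = v \<or> snd e = v" using v(1) by (auto simp: F_def)
        then have e2: "e \<in> N2" using d1 by blast
        have "v \<notin> node ` A" using PM_D(2)[OF D(1), of "fst e" "snd e"] e by auto
        moreover have "v \<notin> node ` (X - A)" using PM_D(2)[OF D'(2), of "fst e" "snd e"] e e2 by auto
        ultimately show False using v(2,3) by blast
      qed
      then show ?thesis by blast
    qed
    have Fcl: "v \<in> F" if uv: "(u, v) \<in> edge_rel ?D" "u \<in> F" for u v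
    proof -
      obtain e where e: "e \<in> ?D" "e = (u, v) \<or> e = (v, u)" using uv(1) by (auto simp: edge_rel_def)
      have eu: "fst e = u \<or> snd e = u" "fst e = v \<or> snd e = v" using e(2) by auto
      have "fst e \<in> F \<and> snd e \<in> F"
        using e(1) F_edge1[OF _ eu(1) uv(2)] F_edge2[OF _ eu(1) uv(2)] FI1[of e] FI2[of e] by blast
      then show ?thesis using eu(2) by blast
    qed
    have first: "flip F M1 M2 = N1"
    proof (intro equalityI subsetI)
      fix e assume e: "e \<in> flip F M1 M2"
      show "e \<in> N1"
      proof (cases "fst e \<in> F")
        case True
        then have "e \<in> M2" using e by (simp add: flip_def)
        then have "e \<in> M2 - N2" using F_edge2[of e "fst e"] True by simp
        then show ?thesis using d2 by blast
      next
        case False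
        then have "e \<in> M1" using e by (simp add: flip_def)
        then show ?thesis using FI1[of e] False by blast
      qed
    next
      fix e assume e: "e \<in> N1"
      show "e \<in> flip F M1 M2"
      proof (cases "e \<in> M1")
        case True
        then have "fst e \<notin> F" using F_edge1[of e "fst e"] e by auto
        then show ?thesis using True by (simp add: flip_def)
      next
        case False
        then have "e \<in> M2 - N2" using e d2 by blast
        then show ?thesis using FI2[of e] by (simp add: flip_def)
      qed
    qed
    have "mult N1 (flip F M2 M1) = mult N1 N2"
      using mult_flip[of F M1 M2] first meq by simp
    \<comment> \<open>The sum of multiplicities and the first matching determine the second.\<close>
    then have second: "flip F M2 M1 = N2" by (rule mult_cancel)
    define \<F> where "\<F> = {C \<in> V // ?J. C \<subseteq> F}"
    have UF: "\<Union>\<F> = F"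
    proof (intro equalityI subsetI)
      fix v assume v: "v \<in> F"
      have "?J `` {v} \<subseteq> F"
      proof
        fix u assume "u \<in> ?J `` {v}"
        then have "(v, u) \<in> (edge_rel ?D)\<^sup>*" by (simp add: joined_def)
        then show "u \<in> F" using v Fcl by (rule rtrancl_closed)
      qed
      moreover have "?J `` {v} \<in> V // ?J" using v FV by (intro quotientI) blast
      ultimately show "v \<in> \<Union>\<F>" using joined_refl[of v] unfolding \<F>_def by blast
    qed (auto simp: \<F>_def)
    \<comment> \<open>At a vertex of C the two matchings use different edges. These edges share that
      vertex only, since they have different other ends, so C has at least three vertices.\<close>
    have "C \<in> \<C>" if C: "C \<in> \<F>" for C
    proof -
      have CC: "C \<in> V // ?J" "C \<subseteq> F" using C by (simp_all add: \<F>_def)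
      then have finC: "finite C" using classV finV finite_subset by blast
      obtain v where v: "v \<in> C" using CC(1) noempty by (metis ex_in_conv)
      then obtain e where e: "e \<in> M1 - N1" "fst e = v \<or> snd e = v" using CC(2) by (auto simp: F_def)
      obtain e' where e': "e' \<in> M2 - N2" "fst e' = v \<or> snd e' = v"
        using F_swap[of v] v CC(2) d2 by blast
      have ne: "e \<noteq> e'" using e(1) e'(1) d1 by blast
      have clC: "flip_closed ?D C" using class_closed[of "{C}"] CC(1) by simp
      have inC: "fst e \<in> C" "snd e \<in> C" "fst e' \<in> C" "snd e' \<in> C"
      proof -
        have "fst e \<in> C \<longleftrightarrow> snd e \<in> C" "fst e' \<in> C \<longleftrightarrow> snd e' \<in> C"
          using clC e(1) e'(1) by (simp_all add: flip_closed_def)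
        then show "fst e \<in> C" "snd e \<in> C" "fst e' \<in> C" "snd e' \<in> C" using e(2) e'(2) v by auto
      qed
      have col: "fst e \<in> B" "snd e \<notin> B" "fst e' \<in> B" "snd e' \<notin> B"
        using edge_ends[of "fst e" "snd e"] edge_ends[of "fst e'" "snd e'"] DE e(1) e'(1) by auto
      have "card {fst e, snd e, fst e', snd e'} > 2"
      proof (cases "fst e = fst e'")
        case True
        then have "snd e \<noteq> snd e'" using ne by (simp add: prod_eq_iff)
        moreover have "fst e \<noteq> snd e" "fst e \<noteq> snd e'" using col by auto
        moreover have "{fst e, snd e, fst e', snd e'} = {fst e, snd e, snd e'}" using True by auto
        ultimately show ?thesis by simp
      next
        case False
        then have "snd e = snd e'" using e(2) e'(2) col by auto
        moreover have "fst e \<noteq> snd e" "fst e' \<noteq> snd e" using col calculation by auto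
        moreover have "{fst e, snd e, fst e', snd e'} = {fst e, fst e', snd e}" using calculation(1) by auto
        ultimately show ?thesis using False by simp
      qed
      also have "card {fst e, snd e, fst e', snd e'} \<le> card C"
        by (rule card_mono[OF finC]) (use inC in blast)
      finally show ?thesis using CC Fnode unfolding \<C>_def by blast
    qed
    then show ?thesis using first second UF by blast
  qed
  have "bij_betw ?\<Phi> (Pow \<C>) (decomps m A)"
    unfolding bij_betw_def
  proof
    show "inj_on ?\<Phi> (Pow \<C>)"
    proof (rule inj_onI)
      fix \<F> \<G> assume "\<F> \<in> Pow \<C>" "\<G> \<in> Pow \<C>" "?\<Phi> \<F> = ?\<Phi> \<G>"
      then show "\<F> = \<G>" using sub[of \<F> \<G>] sub[of \<G> \<F>] by simp
    qed
    show "?\<Phi> ` Pow \<C> = decomps m A"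
    proof
      show "?\<Phi> ` Pow \<C> \<subseteq> decomps m A" using into by blast
      show "decomps m A \<subseteq> ?\<Phi> ` Pow \<C>"
      proof
        fix t assume t: "t \<in> decomps m A"
        obtain N1 N2 where t': "t = (N1, N2)" by (cases t)
        obtain \<F> where "\<F> \<subseteq> \<C>" "?\<Phi> \<F> = t" using onto t unfolding t' by blast
        then show "t \<in> ?\<Phi> ` Pow \<C>" by blast
      qed
    qed
  qed
  then have "card (decomps m A) = card (Pow \<C>)" by (simp add: bij_betw_same_card)
  then show ?thesis using nl finC by (simp add: card_Pow)
qed

text \<open>Direct edges of the matching missing A from black to white and edges of the other one
  from white to black. Then \<open>parity_set A\<close> is the set of nodes from which a path
  departs, and the map is its own inverse on subsets of \<open>X\<close>.\<close>

definition parity_set :: "nat set \<Rightarrow> nat set" where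
  "parity_set A = {i \<in> X. (i \<in> A) \<noteq> (node i \<in> B)}"

lemma parity_set_parity_set: "A \<subseteq> X \<Longrightarrow> parity_set (parity_set A) = A"
  by (auto simp: parity_set_def)

lemma bij_parity_set:
  "bij_betw parity_set {A. A \<subseteq> X \<and> Q (parity_set A)} {T. T \<subseteq> X \<and> Q T}"
  by (rule bij_betwI[where g = parity_set]) (auto simp: parity_set_parity_set, auto simp: parity_set_def)

text \<open>Every pair of p joins a departing node to an arriving one, so the orientation of the
  paths extends over the closing-up by p.\<close>

definition compatible :: "(nat \<Rightarrow> nat) \<Rightarrow> nat set set" where
  "compatible p = {A. A \<subseteq> X \<and> is_section X p (parity_set A)}"

lemma finite_compatible: "finite (compatible p)"
  by (rule finite_subset[of _ "Pow X"]) (auto simp: compatible_def)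

lemma card_compatible:
  assumes "p \<in> pairings n" "q \<in> pairings n"
  shows "card (compatible p \<inter> compatible q) = 2 ^ ncomp n p q"
proof -
  have "compatible p \<inter> compatible q = {A. A \<subseteq> X \<and> (is_section X p (parity_set A) \<and> is_section X q (parity_set A))}"
    by (auto simp: compatible_def)
  moreover have "{T. T \<subseteq> X \<and> (is_section X p T \<and> is_section X q T)} = {T. is_section X p T \<and> is_section X q T}"
    by (auto simp: is_section_def)
  ultimately show ?thesis
    using bij_betw_same_card[OF bij_parity_set[of "\<lambda>T. is_section X p T \<and> is_section X q T"]]
      card_common_sections[OF assms] by simp
qed

text \<open>Decomposability bounds the multiplicity functions: each is the superposition of two
  subsets of E.\<close>

lemma finite_configs:
  assumes p: "p \<in> pairings n" shows "finite configs"
proof -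
  have "configs \<subseteq> (\<lambda>(M1, M2). mult M1 M2) ` (Pow E \<times> Pow E)"
  proof
    fix m assume "m \<in> configs"
    then obtain A M1 M2 where "(M1, M2) \<in> decomps m A" using decomp_exists[OF _ p] by blast
    then show "m \<in> (\<lambda>(M1, M2). mult M1 M2) ` (Pow E \<times> Pow E)"
      using PM_D(1) by (auto simp: decomps_def)
  qed
  then show ?thesis by (rule finite_subset) (simp add: finE)
qed

lemma double_dimer_sum:
  assumes p: "p \<in> pairings n"
  shows "(\<Sum>\<tau>\<in>{\<tau>. planar_pairing n \<tau>}. 2 ^ ncomp n p \<tau> * ZDD V E wt n node \<tau>) =
    (\<Sum>A\<in>compatible p. Z A * Z (X - A))"
proof -
  define W where "W = (\<lambda>m. \<Prod>e\<in>E. wt e ^ m e)"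
  define via where "via = (\<lambda>m \<tau>. \<forall>i\<in>X. (node i, node (\<tau> i)) \<in> (supp_rel E m)\<^sup>*)"
  define L where "L = (\<lambda>m. nloops V E (node ` X) m)"
  have finc: "finite configs" by (rule finite_configs[OF p])
  have finp: "finite {\<tau>. planar_pairing n \<tau>}"
    by (rule finite_subset[OF _ finite_pairs_on[of X]]) (auto simp: planar_pairing_def pairings_eq_pairs_on)
  \<comment> \<open>Let q be the path pairing of m. The compatible A with a decomposition are the
    2^c sets also compatible with q, and each has 2^(loops) decompositions, which together give the
    two factors on the left.\<close>
  have per_config: "(\<Sum>\<tau>\<in>{\<tau>. planar_pairing n \<tau> \<and> via m \<tau>}. 2 ^ ncomp n p \<tau> * (W m * 2 ^ L m)) =
      (\<Sum>A\<in>compatible p. \<Sum>t\<in>decomps m A. W m)" if m: "m \<in> configs" for m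
  proof -
    obtain A0 M1 M2 where d: "(M1, M2) \<in> decomps m A0" and A0: "A0 \<subseteq> X"
      using decomp_exists[OF m p] by blast
    define q where "q = partner (M1 \<union> M2) X"
    note q = decomp_partner[OF d A0, folded q_def]
    have "{\<tau>. planar_pairing n \<tau> \<and> via m \<tau>} = {q}"
      using q(2) q(4) unfolding via_def planar_pairing_def by blast
    then have "(\<Sum>\<tau>\<in>{\<tau>. planar_pairing n \<tau> \<and> via m \<tau>}. 2 ^ ncomp n p \<tau> * (W m * 2 ^ L m)) =
        2 ^ ncomp n p q * (W m * 2 ^ L m)" by simp
    also have "\<dots> = (\<Sum>A\<in>compatible p \<inter> compatible q. W m * 2 ^ L m)"
      using card_compatible[OF p q(1)] by simp
    also have "\<dots> = (\<Sum>A\<in>compatible p. real (card (decomps m A)) * W m)"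
    proof (rule sum.mono_neutral_cong_left)
      show "finite (compatible p)" by (rule finite_compatible)
      show "\<forall>A\<in>compatible p - compatible p \<inter> compatible q. real (card (decomps m A)) * W m = 0"
      proof
        fix A assume "A \<in> compatible p - compatible p \<inter> compatible q"
        then have "A \<subseteq> X" "\<not> is_section X q (parity_set A)" by (auto simp: compatible_def)
        then have "decomps m A = {}"
          using decomps_nonempty_iff[OF d A0, of A] unfolding q_def parity_set_def by blast
        then show "real (card (decomps m A)) * W m = 0" by simp
      qed
      fix A assume "A \<in> compatible p \<inter> compatible q"
      then have A: "A \<subseteq> X" "is_section X q (parity_set A)" by (auto simp: compatible_def)
      then have "decomps m A \<noteq> {}"
        using decomps_nonempty_iff[OF d A0, of A] unfolding q_def parity_set_def by blast
      then obtain N1 N2 where "(N1, N2) \<in> decomps m A" by auto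
      then have "card (decomps m A) = 2 ^ L m" unfolding L_def using A(1) by (rule card_decomps)
      then show "W m * 2 ^ L m = real (card (decomps m A)) * W m" by simp
    qed auto
    finally show ?thesis by simp
  qed
  have "(\<Sum>\<tau>\<in>{\<tau>. planar_pairing n \<tau>}. 2 ^ ncomp n p \<tau> * ZDD V E wt n node \<tau>) =
      (\<Sum>\<tau>\<in>{\<tau>. planar_pairing n \<tau>}. \<Sum>m\<in>{m \<in> configs. via m \<tau>}. 2 ^ ncomp n p \<tau> * (W m * 2 ^ L m))"
    unfolding ZDD_def sum_distrib_left configs_def via_def dd_weight_def W_def L_def ..
  also have "\<dots> = (\<Sum>m\<in>configs. \<Sum>\<tau>\<in>{\<tau> \<in> {\<tau>. planar_pairing n \<tau>}. via m \<tau>}. 2 ^ ncomp n p \<tau> * (W m * 2 ^ L m))"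
    by (rule sum.swap_restrict[OF finp finc])
  also have "\<dots> = (\<Sum>m\<in>configs. \<Sum>A\<in>compatible p. \<Sum>t\<in>decomps m A. W m)"
    by (rule sum.cong[OF refl]) (simp add: per_config)
  also have "\<dots> = (\<Sum>A\<in>compatible p. \<Sum>m\<in>configs. \<Sum>t\<in>decomps m A. W m)"
    by (rule sum.swap)
  also have "\<dots> = (\<Sum>A\<in>compatible p. Z A * Z (X - A))"
  proof (rule sum.cong[OF refl])
    fix A assume "A \<in> compatible p"
    then have A: "A \<subseteq> X" by (simp add: compatible_def)
    let ?g = "\<lambda>(M1, M2). mult M1 M2"
    have dec: "decomps m A = {t \<in> PM A \<times> PM (X - A). ?g t = m}" for m
      by (auto simp: decomps_def)
    have "(\<Sum>m\<in>configs. \<Sum>t\<in>decomps m A. W m) = (\<Sum>m\<in>configs. \<Sum>t\<in>{t \<in> PM A \<times> PM (X - A). ?g t = m}. W (?g t))"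
      unfolding dec by (intro sum.cong) auto
    \<comment> \<open>Every pair of matchings missing A and its complement superposes to exactly one
      configuration, so grouping by it loses nothing.\<close>
    also have "\<dots> = (\<Sum>t\<in>PM A \<times> PM (X - A). W (?g t))"
      by (rule sum.group) (use finc finite_PM decomp_in_configs[OF _ _ A] in auto)
    also have "\<dots> = (\<Sum>(M1, M2)\<in>PM A \<times> PM (X - A). prod wt M1 * prod wt M2)"
    proof (rule sum.cong[OF refl])
      fix t assume "t \<in> PM A \<times> PM (X - A)"
      then obtain M1 M2 where t: "t = (M1, M2)" "M1 \<in> PM A" "M2 \<in> PM (X - A)" by blast
      show "W (?g t) = (case t of (M1, M2) \<Rightarrow> prod wt M1 * prod wt M2)"
        unfolding t(1) W_def using config_weight[OF PM_D(1)[OF t(2)] PM_D(1)[OF t(3)]] by simp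
    qed
    finally show "(\<Sum>m\<in>configs. \<Sum>t\<in>decomps m A. W m) = Z A * Z (X - A)" by (simp add: Z_mult)
  qed
  finally show ?thesis .
qed

end

text \<open>The factors see only crossings within S and within S'. A crossing between the two parts
  is counted once in \<open>crossings_on (S \<union> S')\<close> and once in the added cardinality,
  so it drops out of the sign.\<close>

lemma pf_term_split:
  assumes fin: "finite S" "finite S'" and disj: "S \<inter> S' = {}"
  shows "pf_term y S p * pf_term y S' p =
    (-1) ^ (crossings_on (S \<union> S') p + card {(a, b). a \<in> S \<union> S' \<and> b \<in> S \<union> S' \<and> a < b \<and> b < p a \<and> p a < p b \<and> (a \<in> S) \<noteq> (b \<in> S)})
    * (\<Prod>i\<in>{i \<in> S \<union> S'. i < p i}. y i (p i))"
proof -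
  let ?cr = "\<lambda>S. {(a, b). a \<in> S \<and> b \<in> S \<and> a < b \<and> b < p a \<and> p a < p b}"
  let ?mix = "{(a, b). a \<in> S \<union> S' \<and> b \<in> S \<union> S' \<and> a < b \<and> b < p a \<and> p a < p b \<and> (a \<in> S) \<noteq> (b \<in> S)}"
  have f: "finite (?cr S)" "finite (?cr S')" "finite ?mix"
    by (rule finite_subset[of _ "(S \<union> S') \<times> (S \<union> S')"]; use fin in auto)+
  have "?cr (S \<union> S') = (?cr S \<union> ?cr S') \<union> ?mix" using disj by auto
  moreover have "(?cr S \<union> ?cr S') \<inter> ?mix = {}" "?cr S \<inter> ?cr S' = {}" using disj by auto
  ultimately have "card (?cr (S \<union> S')) = card (?cr S) + card (?cr S') + card ?mix"
    using f by (simp add: card_Un_disjoint)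
  then have c: "crossings_on (S \<union> S') p + card ?mix = crossings_on S p + crossings_on S' p + 2 * card ?mix"
    by (simp add: crossings_on_def)
  have "(-1) ^ (crossings_on (S \<union> S') p + card ?mix) = ((-1) ^ crossings_on S p * (-1) ^ crossings_on S' p :: real)"
    unfolding c power_add power_mult by simp
  moreover have "{i \<in> S \<union> S'. i < p i} = {i \<in> S. i < p i} \<union> {i \<in> S'. i < p i}" by auto
  then have "(\<Prod>i\<in>{i \<in> S \<union> S'. i < p i}. y i (p i)) = (\<Prod>i\<in>{i \<in> S. i < p i}. y i (p i)) * (\<Prod>i\<in>{i \<in> S'. i < p i}. y i (p i))"
    using fin disj by (simp add: prod.union_disjoint disjoint_iff)
  ultimately show ?thesis by (simp add: pf_term_def)
qed

text \<open>Pairings of S and of its complement glue to a pairing of X preserving S. Conversely such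
  a pairing, being an involution, preserves the complement as well and splits.\<close>

lemma pfaffian_product:
  assumes fin: "finite X" and SX: "S \<subseteq> X"
  shows "(\<Sum>p\<in>pairs_on S. pf_term y S p) * (\<Sum>p\<in>pairs_on (X - S). pf_term y (X - S) p) =
    (\<Sum>p\<in>{p \<in> pairs_on X. p ` S \<subseteq> S}. pf_term y S p * pf_term y (X - S) p)"
proof -
  have "(\<Sum>p\<in>pairs_on S. pf_term y S p) * (\<Sum>p\<in>pairs_on (X - S). pf_term y (X - S) p) =
      (\<Sum>(p, q)\<in>pairs_on S \<times> pairs_on (X - S). pf_term y S p * pf_term y (X - S) q)"
    unfolding sum_product by (rule sum.cartesian_product)
  also have "\<dots> = (\<Sum>p\<in>{p \<in> pairs_on X. p ` S \<subseteq> S}. pf_term y S p * pf_term y (X - S) p)"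
  proof (rule sum.reindex_bij_witness[where
        i = "\<lambda>p. (\<lambda>k. if k \<in> S then p k else k, \<lambda>k. if k \<in> X - S then p k else k)" and
        j = "\<lambda>(p, q) k. if k \<in> S then p k else q k"])
    fix t assume "t \<in> pairs_on S \<times> pairs_on (X - S)"
    then obtain p q where t: "t = (p, q)" and p: "p \<in> pairs_on S" and q: "q \<in> pairs_on (X - S)" by blast
    note P = ff_involutionD[OF pairs_on_ff[OF p]] and Q = ff_involutionD[OF pairs_on_ff[OF q]]
    have outp: "k \<notin> S \<Longrightarrow> p k = k" and outq: "k \<notin> X - S \<Longrightarrow> q k = k" for k
      using pairs_on_out[OF p] pairs_on_out[OF q] by simp_all
    show "(\<lambda>p. (\<lambda>k. if k \<in> S then p k else k, \<lambda>k. if k \<in> X - S then p k else k))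
        ((\<lambda>(p, q) k. if k \<in> S then p k else q k) t) = t"
      using outp outq by (auto simp: t fun_eq_iff)
    let ?r = "\<lambda>k. if k \<in> S then p k else q k"
    have "ff_involution X ?r"
      unfolding ff_involution_def
    proof
      fix k assume k: "k \<in> X"
      show "?r k \<in> X \<and> ?r k \<noteq> k \<and> ?r (?r k) = k"
      proof (cases "k \<in> S")
        case True
        then show ?thesis using P[OF True] SX by auto
      next
        case False
        then have "k \<in> X - S" using k by simp
        then show ?thesis using Q[of k] False by auto
      qed
    qed
    moreover have "?r k = k" if "k \<notin> X" for k using that outq SX by auto
    moreover have "?r ` S \<subseteq> S" using P by auto
    ultimately show "(\<lambda>(p, q) k. if k \<in> S then p k else q k) t \<in> {p \<in> pairs_on X. p ` S \<subseteq> S}"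
      by (simp add: t pairs_on_def)
    show "pf_term y S ((\<lambda>(p, q) k. if k \<in> S then p k else q k) t) * pf_term y (X - S) ((\<lambda>(p, q) k. if k \<in> S then p k else q k) t)
        = (case t of (p, q) \<Rightarrow> pf_term y S p * pf_term y (X - S) q)"
    proof -
      have "pf_term y S ?r = pf_term y S p" "pf_term y (X - S) ?r = pf_term y (X - S) q"
        by (rule pf_term_cong; simp)+
      then show ?thesis by (simp add: t)
    qed
  next
    fix p assume "p \<in> {p \<in> pairs_on X. p ` S \<subseteq> S}"
    then have p: "p \<in> pairs_on X" and pS: "\<And>k. k \<in> S \<Longrightarrow> p k \<in> S" by auto
    note P = ff_involutionD[OF pairs_on_ff[OF p]]
    note outp = pairs_on_out[OF p]
    show "(\<lambda>(p, q) k. if k \<in> S then p k else q k)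
        (\<lambda>k. if k \<in> S then p k else k, \<lambda>k. if k \<in> X - S then p k else k) = p"
      using outp by (auto simp: fun_eq_iff)
    have pS': "p k \<in> X - S" if "k \<in> X - S" for k
      using P[of k] pS[of "p k"] that by auto
    have "(\<lambda>k. if k \<in> S then p k else k) \<in> pairs_on S"
      using P pS SX by (auto simp: pairs_on_def ff_involution_def)
    moreover have "(\<lambda>k. if k \<in> X - S then p k else k) \<in> pairs_on (X - S)"
      using P pS' by (simp add: pairs_on_def ff_involution_def)
    ultimately show "(\<lambda>k. if k \<in> S then p k else k, \<lambda>k. if k \<in> X - S then p k else k) \<in> pairs_on S \<times> pairs_on (X - S)"
      by blast
  qed
  finally show ?thesis .
qed

text \<open>Each pair is represented on the left by its smaller element and on the right by its
  element in K; symmetry of y makes the choice immaterial.\<close>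

lemma prod_pairs_section:
  fixes y :: "nat \<Rightarrow> nat \<Rightarrow> real"
  assumes p: "ff_involution X p" and K: "is_section X p K" and sym: "\<And>i j. y i j = y j i"
  shows "(\<Prod>i\<in>{i \<in> X. i < p i}. y i (p i)) = (\<Prod>b\<in>K. y b (p b))"
proof (rule prod.reindex_bij_witness[where j = "\<lambda>i. if i \<in> K then i else p i" and i = "\<lambda>b. if b < p b then b else p b"])
  note P = ff_involutionD[OF p] and S = is_sectionD[OF K]
  have KX: "K \<subseteq> X" using K by (simp add: is_section_def)
  fix i assume "i \<in> {i \<in> X. i < p i}"
  then have i: "i \<in> X" "i < p i" by auto
  show "(if (if i \<in> K then i else p i) < p (if i \<in> K then i else p i) then if i \<in> K then i else p i
      else p (if i \<in> K then i else p i)) = i"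
    using i P(3)[OF i(1)] by simp
  show "(if i \<in> K then i else p i) \<in> K" using S[OF i(1)] by simp
  show "y (if i \<in> K then i else p i) (p (if i \<in> K then i else p i)) = y i (p i)"
    using P(3)[OF i(1)] sym[of i "p i"] by simp
next
  note P = ff_involutionD[OF p] and S = is_sectionD[OF K]
  fix b assume b: "b \<in> K"
  then have bX: "b \<in> X" using K by (auto simp: is_section_def)
  show "(if (if b < p b then b else p b) \<in> K then if b < p b then b else p b else p (if b < p b then b else p b)) = b"
    using b S[OF bX] P(3)[OF bX] by simp
  show "(if b < p b then b else p b) \<in> {i \<in> X. i < p i}"
    using bX P[OF bX] by auto
qed

section \<open>Collecting the terms of a fixed black-white pairing\<close>

context weighted_dimer_nodes
begin

definition Y :: "nat \<Rightarrow> nat \<Rightarrow> real" where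
  "Y i j = Z {i, j} / Z {}"

lemma Y_eq_Yij: "Yij V E wt node i j = Y i j"
  by (simp add: Yij_def ZD_def Y_def Z_def PM_def)

text \<open>A pairing that is not black-white has a pair of equal colour, whose factor vanishes.
  Otherwise the pairs are read from their black ends, as in \<open>Yprime\<close>.\<close>

lemma prod_Y:
  assumes Z0: "Z {} \<noteq> 0" and p: "p \<in> pairs_on X"
  shows "(\<Prod>i\<in>{i \<in> X. i < p i}. Y i (p i)) =
    (if bw_pairing n node B p then \<Prod>b\<in>black_labels n node B. Y b (p b) else 0)"
proof (cases "bw_pairing n node B p")
  case True
  then have "is_section X p (black_labels n node B)" by (simp only: black_section_iff)
  moreover have "Y i j = Y j i" for i j by (simp add: Y_def insert_commute)
  ultimately show ?thesis using prod_pairs_section[OF pairs_on_ff[OF p], of _ Y] True by simp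
next
  case False
  note P = ff_involutionD[OF pairs_on_ff[OF p]]
  obtain i where i: "i \<in> X" "(node i \<in> B) = (node (p i) \<in> B)"
    using False p unfolding bw_pairing_def pairings_eq_pairs_on by blast
  define j where "j = (if i < p i then i else p i)"
  have j: "j \<in> X" "j < p j" "(node j \<in> B) = (node (p j) \<in> B)" "p j \<in> X"
    using i P[OF i(1)] by (auto simp: j_def)
  have "Y j (p j) = 0"
    using Z_same_colour[OF Z0 j(1,4) _ j(3)] j(2) by (simp add: Y_def)
  moreover have "finite {i \<in> X. i < p i}" by simp
  ultimately have "(\<Prod>i\<in>{i \<in> X. i < p i}. Y i (p i)) = 0" using j(1,2) by (intro prod_zero) auto
  then show ?thesis using False by simp
qed

text \<open>The ends of a pair of p have different colours, so toggling at the black labels turns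
  agreement in A into disagreement in \<open>parity_set A\<close>.\<close>

lemma invariant_compatible:
  assumes bw: "bw_pairing n node B p" and A: "A \<subseteq> X"
  shows "p ` A \<subseteq> A \<longleftrightarrow> is_section X p (parity_set A)"
proof -
  have ff: "ff_involution X p" using bw by (simp add: bw_pairing_def pairings_eq_pairs_on pairs_on_ff)
  note P = ff_involutionD[OF ff]
  have col: "node (p i) \<in> B \<longleftrightarrow> node i \<notin> B" if "i \<in> X" for i
    using bw that unfolding bw_pairing_def by blast
  have ps: "i \<in> parity_set A \<longleftrightarrow> (i \<in> A) \<noteq> (node i \<in> B)" if "i \<in> X" for i
    using that by (simp add: parity_set_def)
  have "is_section X p (parity_set A) \<longleftrightarrow> (\<forall>i\<in>X. i \<in> A \<longleftrightarrow> p i \<in> A)"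
  proof -
    have "(i \<in> parity_set A \<longleftrightarrow> p i \<notin> parity_set A) \<longleftrightarrow> (i \<in> A \<longleftrightarrow> p i \<in> A)" if i: "i \<in> X" for i
      using ps[OF i] ps[OF P(1)[OF i]] col[OF i] by blast
    moreover have "parity_set A \<subseteq> X" unfolding parity_set_def by blast
    ultimately show ?thesis unfolding is_section_def by blast
  qed
  also have "\<dots> \<longleftrightarrow> p ` A \<subseteq> A"
  proof
    assume "\<forall>i\<in>X. i \<in> A \<longleftrightarrow> p i \<in> A"
    then show "p ` A \<subseteq> A" using A by blast
  next
    assume pA: "p ` A \<subseteq> A"
    have "p i \<in> A" if "i \<in> A" for i using pA that by blast
    moreover have "i \<in> A" if "i \<in> X" "p i \<in> A" for i
    proof -
      have "p (p i) \<in> A" using pA that(2) by blast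
      then show ?thesis using P(3)[OF that(1)] by simp
    qed
    ultimately show "\<forall>i\<in>X. i \<in> A \<longleftrightarrow> p i \<in> A" by blast
  qed
  finally show ?thesis by simp
qed

lemma double_dimer_black_white:
  assumes Z0: "Z {} \<noteq> 0" and card: "card (black_labels n node B) = n" and \<pi>: "planar_pairing n \<pi>"
  shows "(\<Sum>A\<in>compatible \<pi>. Z A * Z (X - A)) / (Z {})\<^sup>2 =
    (\<Sum>\<rho>\<in>{\<rho>. bw_pairing n node B \<rho>}.
      of_int ((-1) ^ n * (-1) ^ ncomp n \<pi> \<rho> * sign_OE n \<pi> * sign_BW n node B \<rho>)
      * 2 ^ ncomp n \<pi> \<rho> * Yprime V E wt n node B \<rho>)"
proof -
  have p: "\<pi> \<in> pairings n" using \<pi> by (simp add: planar_pairing_def)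
  have finp: "finite (pairs_on X)" by (rule finite_pairs_on) simp
  define g where "g = (\<lambda>A \<rho>. pf_term Y A \<rho> * pf_term Y (X - A) \<rho>)"
  have "(\<Sum>A\<in>compatible \<pi>. Z A * Z (X - A)) / (Z {})\<^sup>2 = (\<Sum>A\<in>compatible \<pi>. (Z A / Z {}) * (Z (X - A) / Z {}))"
    by (simp add: sum_divide_distrib power2_eq_square)
  also have "\<dots> = (\<Sum>A\<in>compatible \<pi>. \<Sum>\<rho>\<in>{\<rho> \<in> pairs_on X. \<rho> ` A \<subseteq> A}. g A \<rho>)"
  proof (rule sum.cong[OF refl])
    fix A assume "A \<in> compatible \<pi>"
    then have A: "A \<subseteq> X" by (simp add: compatible_def)
    have Yeta: "(\<lambda>i j. Z {i, j} / Z {}) = Y" by (simp add: Y_def fun_eq_iff)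
    show "(Z A / Z {}) * (Z (X - A) / Z {}) = (\<Sum>\<rho>\<in>{\<rho> \<in> pairs_on X. \<rho> ` A \<subseteq> A}. g A \<rho>)"
      unfolding Z_pfaffian[OF Z0 A] Z_pfaffian[OF Z0 Diff_subset] Yeta g_def
      by (rule pfaffian_product[OF finite_atLeastAtMost A])
  qed
  also have "\<dots> = (\<Sum>\<rho>\<in>pairs_on X. \<Sum>A\<in>{A \<in> compatible \<pi>. \<rho> ` A \<subseteq> A}. g A \<rho>)"
    by (rule sum.swap_restrict[OF finite_compatible finp])
  also have "\<dots> = (\<Sum>\<rho>\<in>{\<rho>. bw_pairing n node B \<rho>}.
      of_int ((-1) ^ n * (-1) ^ ncomp n \<pi> \<rho> * sign_OE n \<pi> * sign_BW n node B \<rho>)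
      * 2 ^ ncomp n \<pi> \<rho> * Yprime V E wt n node B \<rho>)"
  proof (rule sum.mono_neutral_cong_right[OF finp])
    show "{\<rho>. bw_pairing n node B \<rho>} \<subseteq> pairs_on X"
      by (auto simp: bw_pairing_def pairings_eq_pairs_on)
    have gA: "g A \<rho> = (-1) ^ (crossings_on X \<rho> + card {(a, b). a \<in> X \<and> b \<in> X \<and> a < b \<and> b < \<rho> a \<and> \<rho> a < \<rho> b \<and> (a \<in> A) \<noteq> (b \<in> A)})
        * (\<Prod>i\<in>{i \<in> X. i < \<rho> i}. Y i (\<rho> i))" if A: "A \<subseteq> X" for A \<rho>
    proof -
      have U: "A \<union> (X - A) = X" using A by blast
      show ?thesis
        using pf_term_split[of A "X - A" Y \<rho>] A finite_subset[OF A] unfolding g_def U by simp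
    qed
    show "\<forall>\<rho>\<in>pairs_on X - {\<rho>. bw_pairing n node B \<rho>}. (\<Sum>A\<in>{A \<in> compatible \<pi>. \<rho> ` A \<subseteq> A}. g A \<rho>) = 0"
    proof
      fix \<rho> assume r: "\<rho> \<in> pairs_on X - {\<rho>. bw_pairing n node B \<rho>}"
      then have "(\<Prod>i\<in>{i \<in> X. i < \<rho> i}. Y i (\<rho> i)) = 0" using prod_Y[OF Z0, of \<rho>] by simp
      then have "g A \<rho> = 0" if "A \<subseteq> X" for A using gA[OF that] by simp
      then show "(\<Sum>A\<in>{A \<in> compatible \<pi>. \<rho> ` A \<subseteq> A}. g A \<rho>) = 0"
        by (intro sum.neutral) (simp add: compatible_def)
    qed
    fix \<rho> assume "\<rho> \<in> {\<rho>. bw_pairing n node B \<rho>}"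
    then have bw: "bw_pairing n node B \<rho>" by simp
    then have q: "\<rho> \<in> pairings n" "\<rho> \<in> pairs_on X" by (simp_all add: bw_pairing_def pairings_eq_pairs_on)
    define s :: int where "s = (-1) ^ n * (-1) ^ ncomp n \<pi> \<rho> * sign_OE n \<pi> * sign_BW n node B \<rho>"
    have "{A \<in> compatible \<pi>. \<rho> ` A \<subseteq> A} = compatible \<pi> \<inter> compatible \<rho>"
      using invariant_compatible[OF bw] by (auto simp only: compatible_def)
    moreover have "g A \<rho> = of_int s * Yprime V E wt n node B \<rho>" if A: "A \<in> compatible \<pi> \<inter> compatible \<rho>" for A
    proof -
      have AX: "A \<subseteq> X" and T: "is_section X \<pi> (parity_set A)" "is_section X \<rho> (parity_set A)"
        using A by (auto simp: compatible_def)
      \<comment> \<open>The section \<open>parity_set A\<close> agrees with the black labels exactly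
        off A. Hence the crossings in \<open>pairing_sign_identity\<close> are the mixed crossings
        of \<open>pf_term_split\<close>, and their parity is the same for all A considered
        here.\<close>
      have mem: "(a \<in> parity_set A) = (a \<in> black_labels n node B) \<longleftrightarrow> a \<notin> A" if "a \<in> X" for a
        using that by (auto simp: parity_set_def black_labels_def)
      have "{(a, b). a \<in> X \<and> b \<in> X \<and> a < b \<and> b < \<rho> a \<and> \<rho> a < \<rho> b \<and>
          ((a \<in> parity_set A) = (a \<in> black_labels n node B)) \<noteq> ((b \<in> parity_set A) = (b \<in> black_labels n node B))} =
        {(a, b). a \<in> X \<and> b \<in> X \<and> a < b \<and> b < \<rho> a \<and> \<rho> a < \<rho> b \<and> (a \<in> A) \<noteq> (b \<in> A)}"
        using mem by blast
      then have "s = (-1) ^ card {(a, b). a \<in> X \<and> b \<in> X \<and> a < b \<and> b < \<rho> a \<and> \<rho> a < \<rho> b \<and> (a \<in> A) \<noteq> (b \<in> A)}"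
        using pairing_sign_identity[OF \<pi> bw card T] by (simp only: s_def)
      then have "of_int s = ((-1) ^ card {(a, b). a \<in> X \<and> b \<in> X \<and> a < b \<and> b < \<rho> a \<and> \<rho> a < \<rho> b \<and> (a \<in> A) \<noteq> (b \<in> A)} :: real)"
        by simp
      then show ?thesis
        using gA[OF AX, of \<rho>] prod_Y[OF Z0 q(2)] bw
        by (simp add: Yprime_def crossings_def crossings_on_def Y_eq_Yij power_add)
    qed
    ultimately have "(\<Sum>A\<in>{A \<in> compatible \<pi>. \<rho> ` A \<subseteq> A}. g A \<rho>) = 2 ^ ncomp n \<pi> \<rho> * (of_int s * Yprime V E wt n node B \<rho>)"
      using card_compatible[OF p q(1)] by simp
    then show "(\<Sum>A\<in>{A \<in> compatible \<pi>. \<rho> ` A \<subseteq> A}. g A \<rho>) =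
        of_int ((-1) ^ n * (-1) ^ ncomp n \<pi> \<rho> * sign_OE n \<pi> * sign_BW n node B \<rho>)
        * 2 ^ ncomp n \<pi> \<rho> * Yprime V E wt n node B \<rho>"
      unfolding s_def by simp
  qed
  finally show ?thesis .
qed

end

theorem mainTheorem12:
  fixes V B :: "'v set" and E :: "('v \<times> 'v) set" and wt :: "'v \<times> 'v \<Rightarrow> real"
    and n :: nat and node :: "nat \<Rightarrow> 'v"
    and pos :: "'v \<Rightarrow> complex" and \<gamma> :: "'v \<times> 'v \<Rightarrow> real \<Rightarrow> complex"
    and \<pi> :: "nat \<Rightarrow> nat"
  assumes "finite V" and "B \<subseteq> V" and "E \<subseteq> B \<times> (V - B)"
    and "inj_on node {1..2*n}" and "node ` {1..2*n} \<subseteq> V"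
    and "card (black_labels n node B) = n"
    and "circular_planar V E n node pos \<gamma>"
    and "ZD V E wt \<noteq> 0"
    and "planar_pairing n \<pi>"
  shows "(\<Sum>\<tau>\<in>{\<tau>. planar_pairing n \<tau>}.
            2 ^ ncomp n \<pi> \<tau> * ZDD V E wt n node \<tau> / (ZD V E wt)\<^sup>2)
       = (\<Sum>\<rho>\<in>{\<rho>. bw_pairing n node B \<rho>}.
            of_int ((-1) ^ n * (-1) ^ ncomp n \<pi> \<rho> * sign_OE n \<pi> * sign_BW n node B \<rho>)
            * 2 ^ ncomp n \<pi> \<rho> * Yprime V E wt n node B \<rho>)"
proof -
  have EV: "E \<subseteq> V \<times> V" using assms(2,3) by blast
  interpret weighted_dimer_nodes V B E n node wt
    by unfold_locales (use assms circular_planar_noncrossing[OF assms(7) EV assms(5)] in \<open>blast+\<close>)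
  have Z: "ZD V E wt = Z {}" by (simp add: ZD_def Z_def PM_def)
  have p: "\<pi> \<in> pairings n" using assms(9) by (simp add: planar_pairing_def)
  show ?thesis
    unfolding sum_divide_distrib[symmetric] double_dimer_sum[OF p] Z
    using double_dimer_black_white assms(6,8,9) Z by simp
qed

end
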